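(* Let $\dim S_1=3$. The maximum open rank of quartic forms that essentially depend on three variables is $8$. That is, $\operatorname{Ork} f\le 8$ for every $f\in S_4$ that essentially depends on three variables, and there exists $f\in S_4$ that essentially depends on three variables with $\operatorname{Ork} f=8$. (In other words, $\operatorname{Ork}(3,4)=8$.)
   Context: $\mathbb{K}$ is an algebraically closed field of characteristic $0$. $S_\bullet=\operatorname{Sym}^\bullet S_1$ is the graded ring of polynomials over $\mathbb{K}$ on the finite-dimensional vector space $S_1$ of linear forms, and $S^\bullet=\operatorname{Sym}^\bullet S^1$ is the graded polynomial ring on the dual space $S^1$ of $S_1$. For $p\in S^\bullet$, $\partial_p:S_\bullet\to S_\bullet$ is the contraction operator: in dual bases $x_0,\ldots,x_n$ of $S_1$ and $x^0,\ldots,x^n$ of $S^1$, $\partial_{x^i}$ is the partial derivative with respect to $x_i$, $p\mapsto\partial_p$ is linear and $\partial_{pq}=\partial_p\circ\partial_q$ (so $S^\bullet$ acts as constant-coefficient differential operators). For a vector space $V$, $\mathbb{P}V$ is the set of one-dimensional subspaces $\langle v\rangle$, $v\neq0$. A form $f\in S_d$ with $\dim S_1=n$ essentially depends on $n$ variables if $\partial_l f\ne 0$ for all nonzero $l\in S^1$. For $f\in S_d$, the open rank $\operatorname{Ork} f$ is the minimum of all nonnegative integers $r$ with the property: for every Zariski closed proper subset $X\subsetneq\mathbb{P}S_1$ there is a decomposition $f={v_1}^d+\cdots+{v_r}^d$ with $\langle v_1\rangle,\ldots,\langle v_r\rangle\in\mathbb{P}S_1\setminus X$. $\operatorname{Ork}(n,d)$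 denotes the maximum of $\operatorname{Ork} f$ over the degree $d$ forms $f$ in $n$ variables ($\dim S_1=n$) that essentially depend on $n$ variables. *)

theory Defs
  imports
    "HOL-Computational_Algebra.Computational_Algebra"
    "HOL-Library.Poly_Mapping"
    "HOL-Library.Extended_Nat"
    "HOL-Library.Cardinality"
begin

text \<open>
  A basis of \<open>S\<^sub>1\<close> indexed by the finite type \<open>'n\<close> is fixed, so that \<open>dim S\<^sub>1 = CARD('n)\<close>.
  Both \<open>S\<^sub>\<bullet> = Sym S\<^sub>1\<close> and \<open>S\<^sup>\<bullet> = Sym S\<^sup>1\<close> are then polynomial rings in variables
  indexed by \<open>'n\<close> (the basis of \<open>S\<^sub>1\<close> and its dual basis, respectively), and the same
  type serves for both.  A polynomial maps exponent vectors to coefficients.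
\<close>

type_synonym ('n, 'k) mpoly = "('n \<Rightarrow>\<^sub>0 nat) \<Rightarrow>\<^sub>0 'k"

definition Const :: "'k::comm_ring_1 \<Rightarrow> ('n::finite, 'k) mpoly" where
  "Const c = Poly_Mapping.single 0 c"

definition Var :: "'n \<Rightarrow> ('n::finite, 'k::comm_ring_1) mpoly" where
  "Var i = Poly_Mapping.single (Poly_Mapping.single i 1) 1"

definition monom_degree :: "('n::finite \<Rightarrow>\<^sub>0 nat) \<Rightarrow> nat" where
  "monom_degree m = (\<Sum>i\<in>UNIV. Poly_Mapping.lookup m i)"

definition forms :: "nat \<Rightarrow> ('n::finite, 'k::comm_ring_1) mpoly set" where
  "forms d = {p. \<forall>m\<in>Poly_Mapping.keys p. monom_degree m = d}"

text \<open>
  On monomials, the contraction of \<open>x\<^sup>b\<close> by \<open>x\<^sup>a\<close> is \<open>x\<^sup>b\<^sup>-\<^sup>a\<close> times the product over \<open>i\<close> of the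
  falling factorials \<open>b\<^sub>i (b\<^sub>i - 1) \<dots> (b\<^sub>i - a\<^sub>i + 1)\<close>.  Because of truncated subtraction, this
  product vanishes unless \<open>a \<le> b\<close> componentwise.
\<close>

definition contraction_coeff :: "('n::finite \<Rightarrow>\<^sub>0 nat) \<Rightarrow> ('n \<Rightarrow>\<^sub>0 nat) \<Rightarrow> nat" where
  "contraction_coeff a b =
     (\<Prod>i\<in>UNIV. \<Prod>j<Poly_Mapping.lookup a i. Poly_Mapping.lookup b i - j)"

definition contraction ::
    "('n::finite, 'k::comm_ring_1) mpoly \<Rightarrow> ('n, 'k) mpoly \<Rightarrow> ('n, 'k) mpoly" where
  "contraction p f =
     (\<Sum>a\<in>Poly_Mapping.keys p. \<Sum>b\<in>Poly_Mapping.keys f.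
        Poly_Mapping.single (b - a)
          (Poly_Mapping.lookup p a * Poly_Mapping.lookup f b * of_nat (contraction_coeff a b)))"

definition essentially_depends_on_all :: "('n::finite, 'k::comm_ring_1) mpoly \<Rightarrow> bool" where
  "essentially_depends_on_all f \<longleftrightarrow> (\<forall>l\<in>forms 1. l \<noteq> 0 \<longrightarrow> contraction l f \<noteq> 0)"

definition line :: "('n::finite, 'k::comm_ring_1) mpoly \<Rightarrow> ('n, 'k) mpoly set" where
  "line v = {Const c * v | c. True}"

definition proj_S1 :: "('n::finite, 'k::comm_ring_1) mpoly set set" where
  "proj_S1 = line ` (forms 1 - {0})"

text \<open>
  The value of an element of \<open>S\<^sup>\<bullet>\<close>, regarded as a polynomial function on \<open>S\<^sub>1\<close>, at a vector
  \<open>v \<in> S\<^sub>1\<close>: the dual basis vector \<open>x\<^sup>i\<close> takes \<open>v\<close> to its coefficient at \<open>x\<^sub>i\<close>.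
\<close>

definition eval_at :: "('n::finite, 'k::comm_ring_1) mpoly \<Rightarrow> ('n, 'k) mpoly \<Rightarrow> 'k" where
  "eval_at p v =
     (\<Sum>m\<in>Poly_Mapping.keys p. Poly_Mapping.lookup p m *
        (\<Prod>i\<in>UNIV. Poly_Mapping.lookup v (Poly_Mapping.single i 1) ^ Poly_Mapping.lookup m i))"

definition zariski_closed :: "('n::finite, 'k::comm_ring_1) mpoly set set \<Rightarrow> bool" where
  "zariski_closed X \<longleftrightarrow>
     (\<exists>E :: ('n, 'k) mpoly set. (\<forall>p\<in>E. \<exists>d. p \<in> forms d) \<and>
        X = {line v | v. v \<in> forms 1 \<and> v \<noteq> 0 \<and> (\<forall>p\<in>E. eval_at p v = 0)})"

definition open_decomposable :: "nat \<Rightarrow> ('n::finite, 'k::comm_ring_1) mpoly \<Rightarrow> nat \<Rightarrow> bool" where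
  "open_decomposable d f r \<longleftrightarrow>
     (\<forall>X. zariski_closed X \<and> X \<subset> proj_S1 \<longrightarrow>
        (\<exists>v :: nat \<Rightarrow> ('n, 'k) mpoly.
           (\<forall>i<r. v i \<in> forms 1 \<and> v i \<noteq> 0 \<and> line (v i) \<in> proj_S1 - X) \<and>
           f = (\<Sum>i<r. v i ^ d)))"

text \<open>
  The infimum in \<open>enat\<close> is a minimum when some \<open>r\<close> has the property, and \<open>\<infinity>\<close> otherwise; in
  particular a finite bound includes the existence of such an \<open>r\<close>.
\<close>

definition open_rank :: "nat \<Rightarrow> ('n::finite, 'k::comm_ring_1) mpoly \<Rightarrow> enat" where
  "open_rank d f = Inf {enat r | r. open_decomposable d f r}"


subsection \<open>The defining properties of contraction\<close>

lemma contraction_superset: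
  assumes "finite A" "Poly_Mapping.keys p \<subseteq> A" "finite B" "Poly_Mapping.keys f \<subseteq> B"
  shows "contraction p f =
     (\<Sum>a\<in>A. \<Sum>b\<in>B. Poly_Mapping.single (b - a)
          (Poly_Mapping.lookup p a * Poly_Mapping.lookup f b * of_nat (contraction_coeff a b)))"
proof -
  have "contraction p f = (\<Sum>a\<in>Poly_Mapping.keys p. \<Sum>b\<in>B. Poly_Mapping.single (b - a)
          (Poly_Mapping.lookup p a * Poly_Mapping.lookup f b * of_nat (contraction_coeff a b)))"
    unfolding contraction_def
    by (intro sum.cong refl sum.mono_neutral_left assms) (auto simp: in_keys_iff)
  also have "\<dots> = (\<Sum>a\<in>A. \<Sum>b\<in>B. Poly_Mapping.single (b - a)
          (Poly_Mapping.lookup p a * Poly_Mapping.lookup f b * of_nat (contraction_coeff a b)))"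
    by (intro sum.mono_neutral_left assms) (auto simp: in_keys_iff)
  finally show ?thesis .
qed

lemma contraction_add_left: "contraction (p + q) f = contraction p f + contraction q f"
proof -
  let ?A = "Poly_Mapping.keys p \<union> Poly_Mapping.keys q"
  have "Poly_Mapping.keys (p + q) \<subseteq> ?A" by (rule keys_add)
  then show ?thesis
    by (simp add: contraction_superset[of ?A _ "Poly_Mapping.keys f"] lookup_add ring_distribs
        single_add sum.distrib)
qed

lemma contraction_add_right: "contraction p (f + g) = contraction p f + contraction p g"
proof -
  let ?A = "Poly_Mapping.keys f \<union> Poly_Mapping.keys g"
  have "Poly_Mapping.keys (f + g) \<subseteq> ?A" by (rule keys_add)
  then show ?thesis
    by (simp add: contraction_superset[of "Poly_Mapping.keys p" _ ?A] lookup_add ring_distribs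
        single_add sum.distrib)
qed

lemma contraction_zero_left [simp]: "contraction 0 f = 0"
  by (simp add: contraction_def)

lemma contraction_zero_right [simp]: "contraction p 0 = 0"
  by (simp add: contraction_def)

lemma contraction_single:
  "contraction (Poly_Mapping.single a s) (Poly_Mapping.single b t) =
     Poly_Mapping.single (b - a) (s * t * of_nat (contraction_coeff a b))"
  by (simp add: contraction_superset[of "{a}" _ "{b}"])

lemma poly_mapping_single_add_induct [case_names zero monomial]:
  fixes p :: "'a \<Rightarrow>\<^sub>0 'b::comm_monoid_add"
  assumes "P 0" and "\<And>a c q. P q \<Longrightarrow> P (Poly_Mapping.single a c + q)"
  shows "P p"
proof (induction p rule: update_induct)
  case const
  show ?case by (rule assms(1))
next
  case (update f a b)
  have "Poly_Mapping.update a b f = Poly_Mapping.single a b + f"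
    using update.hyps
    by (intro poly_mapping_eqI)
      (auto simp: lookup_update lookup_add lookup_single when_def in_keys_iff)
  then show ?case using assms(2) update.IH by simp
qed

lemma contraction_Const_left: "contraction (Const c * p) f = Const c * contraction p f"
proof (induction p rule: poly_mapping_single_add_induct)
  case (monomial a s p)
  have "contraction (Const c * Poly_Mapping.single a s) f =
        Const c * contraction (Poly_Mapping.single a s) f"
    by (induction f rule: poly_mapping_single_add_induct)
      (simp_all add: contraction_add_right contraction_single ring_distribs Const_def mult_single
        mult.assoc)
  with monomial show ?case by (simp add: contraction_add_left ring_distribs)
qed simp

lemma contraction_Const_right: "contraction p (Const c * f) = Const c * contraction p f"
proof (induction p rule: poly_mapping_single_add_induct)
  case (monomial a s p)
  have "contraction (Poly_Mapping.single a s) (Const c * f) =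
        Const c * contraction (Poly_Mapping.single a s) f"
    by (induction f rule: poly_mapping_single_add_induct)
      (simp_all add: contraction_add_right contraction_single ring_distribs Const_def mult_single
        mult_ac)
  with monomial show ?case by (simp add: contraction_add_left ring_distribs)
qed simp

lemma contraction_one: "contraction 1 f = f"
proof (induction f rule: poly_mapping_single_add_induct)
  case (monomial a s f)
  then show ?case
    by (simp add: contraction_add_right contraction_single contraction_coeff_def
        flip: single_one)
qed simp

lemma falling_factorial_add:
  "(\<Prod>j<a + b. c - j) = (\<Prod>j<b. c - j) * (\<Prod>j<a. c - b - j)" for a b c :: nat
  by (induction a) (simp_all add: ac_simps)

lemma contraction_coeff_add:
  "contraction_coeff (a + b) c = contraction_coeff b c * contraction_coeff a (c - b)"
  by (simp add: contraction_coeff_def lookup_add lookup_minus falling_factorial_add prod.distrib)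

lemma contraction_mult: "contraction (p * q) f = contraction p (contraction q f)"
proof (induction p rule: poly_mapping_single_add_induct)
  case (monomial a s p)
  have "contraction (Poly_Mapping.single a s * q) f =
        contraction (Poly_Mapping.single a s) (contraction q f)"
  proof (induction q rule: poly_mapping_single_add_induct)
    case (monomial b t q)
    have "contraction (Poly_Mapping.single a s * Poly_Mapping.single b t) f =
          contraction (Poly_Mapping.single a s) (contraction (Poly_Mapping.single b t) f)"
      by (induction f rule: poly_mapping_single_add_induct)
        (simp_all add: contraction_add_right contraction_single mult_single
          contraction_coeff_add diff_diff_eq ac_simps)
    with monomial show ?case
      by (simp add: contraction_add_left contraction_add_right ring_distribs)
  qed simp
  with monomial show ?case by (simp add: contraction_add_left ring_distribs)
qed simp

lemma contraction_coeff_single: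
  "contraction_coeff (Poly_Mapping.single i 1) b = Poly_Mapping.lookup b i"
proof -
  have "contraction_coeff (Poly_Mapping.single i 1) b =
        (\<Prod>k\<in>UNIV. if k = i then Poly_Mapping.lookup b i else 1)"
    unfolding contraction_coeff_def
    by (intro prod.cong) (auto simp: lookup_single when_def)
  then show ?thesis by simp
qed

lemma contraction_Var_Var: "contraction (Var i) (Var j) = (if i = j then 1 else 0)"
  by (auto simp: Var_def contraction_single contraction_coeff_single[simplified] lookup_single)

lemma contraction_Var_mult:
  "contraction (Var i) (f * g) = contraction (Var i) f * g + f * contraction (Var i) g"
proof (induction f rule: poly_mapping_single_add_induct)
  case (monomial a s f)
  let ?e = "Poly_Mapping.single i (1::nat)"
  have shift: "Poly_Mapping.single (a + b - ?e) (c * of_nat (Poly_Mapping.lookup a i)) =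
         Poly_Mapping.single (a - ?e + b) (c * of_nat (Poly_Mapping.lookup a i))"
    for a b :: "'a \<Rightarrow>\<^sub>0 nat" and c :: 'b
  proof (cases "Poly_Mapping.lookup a i = 0")
    case False
    then have "a + b - ?e = a - ?e + b"
      by (intro poly_mapping_eqI) (auto simp: lookup_add lookup_minus lookup_single when_def)
    then show ?thesis by simp
  qed simp
  have "contraction (Var i) (Poly_Mapping.single a s * g) =
        contraction (Var i) (Poly_Mapping.single a s) * g +
        Poly_Mapping.single a s * contraction (Var i) g"
  proof (induction g rule: poly_mapping_single_add_induct)
    case (monomial b t g)
    have "contraction (Var i) (Poly_Mapping.single a s * Poly_Mapping.single b t) =
          Poly_Mapping.single (a + b - ?e) (s * t * of_nat (Poly_Mapping.lookup a i)) +
          Poly_Mapping.single (b + a - ?e) (s * t * of_nat (Poly_Mapping.lookup b i))"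
      by (simp add: Var_def contraction_single mult_single contraction_coeff_single[simplified]
          lookup_add ring_distribs single_add add.commute)
    also have "\<dots> = contraction (Var i) (Poly_Mapping.single a s) * Poly_Mapping.single b t +
          Poly_Mapping.single a s * contraction (Var i) (Poly_Mapping.single b t)"
      unfolding shift
      by (simp add: Var_def contraction_single mult_single contraction_coeff_single[simplified]
          ac_simps)
    finally show ?case
      using monomial by (simp add: contraction_add_right ring_distribs)
  qed simp
  with monomial show ?case by (simp add: contraction_add_right ring_distribs)
qed simp

end

(*
  Upper bound.  Regard f as a symmetric 4-linear form T on the dual space.  By Hesse's theorem in
  three variables, some l makes the quadric T(l, l, -, -) nondegenerate, and l can be chosen such
  that the line l = 0 is not contained in the set to be avoided.  The conics apolar to the cubic
  T(l, -, -, -) form a net that cuts out all point pairs on this line, and they cannot all be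
  singular.  So in suitable dual coordinates a, b, c, with b proportional to l, the conic
  b^2 = ac kills T(l, -, -, -), i.e. f is a sum of an octic on the rational curve
  (s^2, s, 1) and a binary quartic on the line b = 0.  Two coefficients can be shifted freely between
  the two parts, at the intersection points of the line and the conic.  For a generic shift the 5x5
  Hankel determinant of the octic and the 3x3 one of the quartic do not vanish, the former because
  its middle minor is the discriminant of T(l, l, -, -), and this gives 5 points on the conic and 3
  on the line, in general position.  If no shift works for the line, its quartic is supported on the
  two intersection points, and 5 + 2 points suffice.

  Lower bound.  x^2 y^2 + z^4 is not a sum of 7 powers of linear forms off the line z = 0.
*)
theory Submission
  imports Defs "HOL-Library.Product_Plus"
begin

section \<open>Linear systems and Gaussian quadrature\<close>

text \<open>A closed set enters only through one of its equations \<open>h\<close>, nonzero at some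
  point. The basis is chosen so that \<open>h\<close> is nonzero at both points where the line meets
  the conic. Then \<open>h\<close> restricts to a nonzero polynomial in the parameter of either
  curve, and only finitely many parameters are forbidden. The counts 5 and 3 are the numbers k for
  binary forms of degree 2k - 2 = 8 and 4: if the k x k Hankel matrix is invertible, such a form is
  a sum of k powers in a one-parameter family of ways, which leaves room to avoid finitely many
  parameters. The line must be b = 0 because apolarity of the conic only identifies monomials
  divisible by b. The other five monomials are a^i c^(4-i), exactly those seen on the line, so the
  line can correct them. A further obstacle is that the number of points found may depend on the
  closed set, whereas the open rank asks for a single r that serves every closed set. Shorter sums
  are therefore padded to exactly 8 terms.\<close>

lemma underdetermined_system:
  fixes A :: "nat \<Rightarrow> nat \<Rightarrow> 'k::field"
  assumes "finite J" "n < card J"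
  shows "\<exists>x. (\<exists>j\<in>J. x j \<noteq> 0) \<and> (\<forall>i<n. (\<Sum>j\<in>J. A i j * x j) = 0)"
  using assms
proof (induction n arbitrary: A J)
  case 0
  then have "J \<noteq> {}" by auto
  then show ?case by (intro exI[of _ "\<lambda>_. 1"]) auto
next
  case (Suc n)
  show ?case
  proof (cases "\<forall>j\<in>J. A n j = 0")
    case True
    obtain x where x: "\<exists>j\<in>J. x j \<noteq> 0" "\<forall>i<n. (\<Sum>j\<in>J. A i j * x j) = 0"
      using Suc.IH[of J A] Suc.prems by auto
    have "(\<Sum>j\<in>J. A n j * x j) = 0" using True by (intro sum.neutral) auto
    with x show ?thesis by (auto simp: less_Suc_eq)
  next
    case False
    then obtain j0 where j0: "j0 \<in> J" "A n j0 \<noteq> 0" by blast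
    \<comment> \<open>Row \<open>n\<close> eliminates the variable \<open>j0\<close>; its value is
      recovered from that row in \<open>y\<close>.\<close>
    define B where "B i j = A i j - A i j0 * A n j / A n j0" for i j
    obtain x where x: "\<exists>j\<in>J - {j0}. x j \<noteq> 0" "\<forall>i<n. (\<Sum>j\<in>J - {j0}. B i j * x j) = 0"
      using Suc.IH[of "J - {j0}" B] Suc.prems j0 by (auto simp: less_diff_conv)
    define y where "y = x(j0 := - (\<Sum>j\<in>J - {j0}. A n j * x j) / A n j0)"
    have split: "(\<Sum>j\<in>J. A i j * y j) = A i j0 * y j0 + (\<Sum>j\<in>J - {j0}. A i j * x j)" for i
    proof -
      have "(\<Sum>j\<in>J. A i j * y j) = A i j0 * y j0 + (\<Sum>j\<in>J - {j0}. A i j * y j)"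
        using Suc.prems j0 by (intro sum.remove) auto
      also have "(\<Sum>j\<in>J - {j0}. A i j * y j) = (\<Sum>j\<in>J - {j0}. A i j * x j)"
        by (intro sum.cong) (auto simp: y_def)
      finally show ?thesis .
    qed
    have "(\<Sum>j\<in>J. A i j * y j) = 0" if "i < n" for i
    proof -
      have "0 = (\<Sum>j\<in>J - {j0}. B i j * x j)" using x(2) that by simp
      also have "\<dots> = (\<Sum>j\<in>J - {j0}. A i j * x j) - A i j0 / A n j0 * (\<Sum>j\<in>J - {j0}. A n j * x j)"
        by (simp add: B_def algebra_simps sum_subtractf sum_distrib_left)
      finally show ?thesis unfolding split by (simp add: y_def)
    qed
    moreover have "(\<Sum>j\<in>J. A n j * y j) = 0"
      unfolding split using j0 by (simp add: y_def)
    moreover have "\<exists>j\<in>J. y j \<noteq> 0" using x(1) by (auto simp: y_def)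
    ultimately show ?thesis by (auto simp: less_Suc_eq)
  qed
qed

text \<open>Split off one root \<open>z\<close> at a time: by the product rule, a double root of the
  quotient \<open>q\<close>, or a root of \<open>q\<close> at \<open>z\<close>, would be a double
  root of \<open>p\<close>.\<close>

lemma card_roots_rsquarefree:
  fixes p :: "'k::{alg_closed_field,field_char_0} poly"
  assumes "rsquarefree p"
  shows "card {x. poly p x = 0} = degree p"
  using assms
proof (induction "degree p" arbitrary: p)
  case 0
  then obtain c where "p = [:c:]" by (metis degree_eq_zeroE)
  with 0 show ?case by (auto simp: rsquarefree_def)
next
  case (Suc n)
  have p0: "p \<noteq> 0" using Suc.hyps(2) by auto
  obtain z where z: "poly p z = 0" using alg_closed_imp_poly_has_root[of p] Suc.hyps(2) by auto
  then obtain q where q: "p = [:-z, 1:] * q" by (auto simp: poly_eq_0_iff_dvd elim: dvdE)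
  have q0: "q \<noteq> 0" using p0 q by auto
  have dq: "degree q = n" using Suc.hyps(2) q0 unfolding q by (subst (asm) degree_mult_eq) auto
  have roots: "\<not> (poly p a = 0 \<and> poly (pderiv p) a = 0)" for a
    using Suc.prems by (simp add: rsquarefree_roots)
  have der: "poly (pderiv p) a = poly q a + (a - z) * poly (pderiv q) a" for a
    unfolding q pderiv_mult by (simp add: pderiv_pCons algebra_simps del: mult_pCons_left)
  have "rsquarefree q" unfolding rsquarefree_roots
    using roots der by (metis add_0 mult_zero_right q poly_mult)
  then have card: "card {x. poly q x = 0} = n" using Suc.hyps(1)[of q] dq by simp
  have "poly q z \<noteq> 0" using roots[of z] der[of z] z by simp
  moreover have "{x. poly p x = 0} = insert z {x. poly q x = 0}"
    by (auto simp: q)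
  moreover have "finite {x. poly q x = 0}" using q0 by (rule poly_roots_finite)
  ultimately show ?case using card Suc.hyps(2) by simp
qed

text \<open>The linear functional that takes the i-th power of the variable to \<open>F i\<close>.
  The Hankel matrix of \<open>F\<close> is the Gram matrix of the bilinear form taking
  \<open>p\<close>, \<open>q\<close> to its value at \<open>p * q\<close>.\<close>

definition moment_functional :: "(nat \<Rightarrow> 'k) \<Rightarrow> 'k::comm_ring_1 poly \<Rightarrow> 'k" where
  "moment_functional F p = (\<Sum>i\<le>degree p. F i * coeff p i)"

lemma moment_functional_bound:
  "degree p \<le> n \<Longrightarrow> moment_functional F p = (\<Sum>i\<le>n. F i * coeff p i)"
  unfolding moment_functional_def
  by (intro sum.mono_neutral_left) (auto simp: coeff_eq_0)

lemma moment_functional_add: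
  "moment_functional F (p + q) = moment_functional F p + moment_functional F q"
proof -
  let ?n = "max (degree p) (degree q)"
  have "degree (p + q) \<le> ?n" by (rule degree_add_le_max)
  then show ?thesis
    by (simp add: moment_functional_bound[of _ ?n] algebra_simps sum.distrib)
qed

lemma moment_functional_0 [simp]: "moment_functional F 0 = 0"
  by (simp add: moment_functional_def)

lemma moment_functional_smult:
  "moment_functional F (smult c p) = c * moment_functional F p"
  using degree_smult_le[of c p]
  by (simp add: moment_functional_bound[of _ "degree p"] sum_distrib_left algebra_simps)

lemma moment_functional_diff:
  "moment_functional F (p - q) = moment_functional F p - moment_functional F q"
  using moment_functional_add[of F "p - q" q] by simp

lemma moment_functional_sum:
  "moment_functional F (sum g A) = (\<Sum>x\<in>A. moment_functional F (g x))"
  by (induction A rule: infinite_finite_induct) (auto simp: moment_functional_add)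

lemma moment_functional_monom: "moment_functional F (monom c n) = F n * c"
  using degree_monom_le[of c n]
  by (simp add: moment_functional_bound[of _ n] if_distrib[of "\<lambda>x. _ * x"] cong: if_cong)

lemma moment_functional_monom_mult:
  assumes "degree p \<le> n"
  shows "moment_functional F (monom 1 i * p) = (\<Sum>j\<le>n. F (i + j) * coeff p j)"
proof -
  have "p = (\<Sum>j\<le>n. monom (coeff p j) j)"
    using assms by (metis poly_as_sum_of_monoms')
  then have "monom 1 i * p = (\<Sum>j\<le>n. monom (coeff p j) (i + j))"
    by (metis (no_types, lifting) mult_1 mult_monom sum.cong sum_distrib_left)
  then show ?thesis by (simp add: moment_functional_sum moment_functional_monom)
qed

lemma moment_functional_mult_eq_0:
  assumes "\<And>i. i \<le> degree q \<Longrightarrow> moment_functional F (monom 1 i * p) = 0"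
  shows "moment_functional F (p * q) = 0"
proof -
  have "p * q = (\<Sum>i\<le>degree q. smult (coeff q i) (monom 1 i * p))"
  proof -
    have "p * q = p * (\<Sum>i\<le>degree q. monom (coeff q i) i)" by (simp only: poly_as_sum_of_monoms)
    also have "\<dots> = (\<Sum>i\<le>degree q. p * smult (coeff q i) (monom 1 i))"
      by (simp add: sum_distrib_left smult_monom)
    finally show ?thesis by (simp add: mult.commute)
  qed
  then show ?thesis
    using assms by (simp add: moment_functional_sum moment_functional_smult)
qed

text \<open>Gaussian quadrature with one condition dropped: orthogonality is asked below degree
  \<open>k - 1\<close> instead of \<open>k\<close>, and exactness stops at degree
  \<open>2 * k - 2\<close> instead of \<open>2 * k - 1\<close>. This is what allows \<open>P\<close>
  to vary in a pencil. Modulo \<open>P\<close> a power is determined by its values at the nodes, so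
  the weights are the functional at the Lagrange polynomials \<open>l s\<close>.\<close>

lemma quadrature_from_nodes:
  fixes P :: "'k::field poly"
  assumes roots: "card {x. poly P x = 0} = k" and deg: "degree P = k" and k: "k > 0"
    and orth: "\<And>i. i < k - 1 \<Longrightarrow> moment_functional F (monom 1 i * P) = 0"
  shows "\<exists>c. \<forall>m<2*k-1. F m = (\<Sum>s\<in>{x. poly P x = 0}. c s * s ^ m)"
proof -
  define S where "S = {x. poly P x = 0}"
  have fin: "finite S" and cS: "card S = k" using roots k by (auto simp: S_def intro: card_ge_0_finite)
  define l where "l s = (\<Prod>t\<in>S - {s}. smult (1 / (s - t)) [:-t, 1:])" for s
  have degl: "degree (l s) < k" if "s \<in> S" for s
  proof -
    have "degree (l s) \<le> (\<Sum>t\<in>S-{s}. degree (smult (1 / (s - t)) [:-t, 1:]))"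
      unfolding l_def using degree_prod_sum_le[of "S-{s}" "\<lambda>t. smult (1 / (s - t)) [:-t, 1:]"] fin
      by (simp add: comp_def del: smult_pCons)
    also have "\<dots> \<le> (\<Sum>t\<in>S-{s}. 1)" by (intro sum_mono) auto
    also have "\<dots> = k - 1" using that fin cS by simp
    finally show ?thesis using k by simp
  qed
  have l: "poly (l s) t = (if s = t then 1 else 0)" if "s \<in> S" "t \<in> S" for s t
  proof (cases "s = t")
    case True
    then show ?thesis
      by (auto simp: l_def poly_prod diff_divide_distrib[symmetric] intro!: prod.neutral split: if_splits)
  next
    case False
    then have "\<exists>u\<in>S - {s}. poly (smult (1 / (s - u)) [:-u, 1:]) t = 0"
      using that by (intro bexI[of _ t]) auto
    then show ?thesis using False fin by (auto simp: l_def poly_prod)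
  qed
  have "F m = (\<Sum>s\<in>S. moment_functional F (l s) * s ^ m)" if m: "m < 2*k-1" for m
  proof -
    let ?x = "monom (1::'k) m"
    define q r where "q = ?x div P" and "r = ?x mod P"
    have P0: "P \<noteq> 0" using deg k by auto
    have eq: "?x = P * q + r" by (simp add: q_def r_def)
    have degr: "degree r < k" using degree_mod_less[OF P0, of ?x] deg k by (auto simp: r_def)
    have rs: "poly r s = s ^ m" if "s \<in> S" for s
      using arg_cong[OF eq, of "\<lambda>p. poly p s"] that by (simp add: S_def poly_monom)
    have "r = (\<Sum>s\<in>S. smult (poly r s) (l s))"
    proof (rule poly_eqI_degree[of S])
      fix t assume t: "t \<in> S"
      have "poly (\<Sum>s\<in>S. smult (poly r s) (l s)) t = (\<Sum>s\<in>S. if s = t then poly r s else 0)"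
        unfolding poly_sum by (intro sum.cong) (use l t in auto)
      then show "poly r t = poly (\<Sum>s\<in>S. smult (poly r s) (l s)) t"
        using t fin by simp
    next
      show "card S > degree r" using degr cS by simp
      have "degree (\<Sum>s\<in>S. smult (poly r s) (l s)) \<le> k - 1"
      proof (rule degree_sum_le[OF fin])
        fix s assume "s \<in> S"
        then show "degree (smult (poly r s) (l s)) \<le> k - 1"
          using degl[of s] degree_smult_le[of "poly r s" "l s"] by linarith
      qed
      then show "card S > degree (\<Sum>s\<in>S. smult (poly r s) (l s))" using cS k by simp
    qed
    then have "moment_functional F r = (\<Sum>s\<in>S. poly r s * moment_functional F (l s))"
      by (metis (no_types, lifting) moment_functional_smult moment_functional_sum sum.cong)
    moreover have "moment_functional F (P * q) = 0"
    proof (cases "q = 0")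
      case False
      \<comment> \<open>From \<open>m \<le> 2 * k - 2\<close> the quotient by \<open>P\<close> has
        degree at most \<open>k - 2\<close>, which is exactly the range of
        \<open>orth\<close>.\<close>
      have "degree q < k - 1"
      proof -
        have "degree (P * q) \<le> m"
        proof (rule ccontr)
          assume *: "\<not> degree (P * q) \<le> m"
          have "degree (P * q) \<ge> k" using degree_mult_eq[OF P0 False] deg by simp
          then have "degree ?x = degree (P * q)"
            unfolding eq using degr by (intro degree_add_eq_left) simp
          then show False using * by (simp add: degree_monom_eq)
        qed
        then show ?thesis using degree_mult_eq[OF P0 False] deg m by simp
      qed
      then show ?thesis
        by (intro moment_functional_mult_eq_0[OF orth]) linarith
    qed simp
    ultimately have "moment_functional F ?x = (\<Sum>s\<in>S. poly r s * moment_functional F (l s))"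
      unfolding eq moment_functional_add by simp
    then show ?thesis by (simp add: moment_functional_monom rs mult.commute)
  qed
  then show ?thesis by (auto simp: S_def)
qed

text \<open>
  The nodes are the roots of a generic member of the pencil spanned by the orthogonal polynomials of
  degrees \<open>k\<close> and \<open>k - 1\<close>.  The pencil has no base point, so the Wronskian leaves only finitely many
  members with a double root or with a root in common with \<open>H\<close>.
\<close>

theorem hankel_quadrature:
  fixes F :: "nat \<Rightarrow> 'k::{alg_closed_field,field_char_0}"
  assumes nondeg: "\<And>x. (\<And>i. i < k \<Longrightarrow> (\<Sum>j<k. F (i + j) * x j) = 0) \<Longrightarrow> \<forall>j<k. x j = 0"
    and H: "H \<noteq> 0" and k: "k > 0"
  shows "\<exists>S c. finite S \<and> card S = k \<and> (\<forall>s\<in>S. poly H s \<noteq> 0) \<and>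
            (\<forall>m<2*k-1. F m = (\<Sum>s\<in>S. c s * s ^ m))"
proof -
  let ?L = "moment_functional F"
  \<comment> \<open>Invertibility of the Hankel matrix, read as nondegeneracy of the bilinear form
    on polynomials of degree below \<open>k\<close>.\<close>
  have nd: "p = 0" if deg: "degree p < k" and z: "\<And>i. i < k \<Longrightarrow> ?L (monom 1 i * p) = 0" for p
  proof -
    have "\<forall>j<k. coeff p j = 0"
    proof (rule nondeg)
      fix i assume i: "i < k"
      have "{..k-1} = {..<k}" using k by auto
      then show "(\<Sum>j<k. F (i + j) * coeff p j) = 0"
        using z[OF i] deg moment_functional_monom_mult[of p "k-1" F i] by simp
    qed
    then show ?thesis using deg by (metis coeff_eq_0 leI le_less_trans poly_eqI coeff_0)
  qed
  have ex: "\<exists>p. p \<noteq> 0 \<and> degree p \<le> n \<and> (\<forall>i<n. ?L (monom 1 i * p) = 0)" for n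
  proof -
    obtain x where x: "\<exists>j\<in>{..n}. x j \<noteq> 0" "\<forall>i<n. (\<Sum>j\<le>n. F (i + j) * x j) = 0"
      using underdetermined_system[of "{..n}" n "\<lambda>i j. F (i + j)"] by auto
    define p where "p = (\<Sum>j\<le>n. monom (x j) j)"
    have c: "coeff p j = (if j \<le> n then x j else 0)" for j
      by (simp add: p_def coeff_sum)
    have "p \<noteq> 0" using x(1) c by (metis atMost_iff coeff_0)
    moreover have d: "degree p \<le> n" by (rule degree_le) (auto simp: c)
    moreover have "?L (monom 1 i * p) = 0" if "i < n" for i
      using x(2) that by (simp add: moment_functional_monom_mult[OF d] c)
    ultimately show ?thesis by blast
  qed
  obtain P0 where P0: "P0 \<noteq> 0" "degree P0 \<le> k" "\<And>i. i < k \<Longrightarrow> ?L (monom 1 i * P0) = 0"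
    using ex[of k] by blast
  have dP0: "degree P0 = k" using nd[of P0] P0 by (meson le_neq_implies_less)
  obtain R where R: "R \<noteq> 0" "degree R \<le> k - 1" "\<And>i. i < k - 1 \<Longrightarrow> ?L (monom 1 i * R) = 0"
    using ex[of "k-1"] by blast
  have dR: "degree R < k" using R(2) k by simp
  \<comment> \<open>Dividing by the factor of a common root \<open>z\<close> turns orthogonality
    into multiplicativity: multiplying \<open>A\<close> or \<open>B\<close> by the i-th power of the
    variable multiplies the functional by \<open>z ^ i\<close>, for all \<open>i < k\<close>. Hence
    the combination \<open>C\<close> is orthogonal to everything and vanishes. Its coefficient of
    degree \<open>k - 1\<close> then gives \<open>?L B = 0\<close>, so \<open>B\<close> itself is
    orthogonal to everything.\<close>
  have coprime: "\<not> (poly P0 z = 0 \<and> poly R z = 0)" for z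
  proof
    assume "poly P0 z = 0 \<and> poly R z = 0"
    then obtain A B where A: "P0 = [:-z,1:] * A" and B: "R = [:-z,1:] * B"
      by (auto simp: poly_eq_0_iff_dvd elim!: dvdE)
    have A0: "A \<noteq> 0" and B0: "B \<noteq> 0" using A B P0(1) R(1) by auto
    have dA: "degree A = k - 1" using dP0 A0 k unfolding A by (subst (asm) degree_mult_eq) auto
    have dB: "degree B < k - 1" using dR B0 unfolding B by (subst (asm) degree_mult_eq) auto
    have step: "?L (monom 1 (Suc i) * C) = z * ?L (monom 1 i * C)"
      if "?L (monom 1 i * ([:-z,1:] * C)) = 0" for i C
    proof -
      have "monom 1 i * ([:-z,1:] * C) = monom 1 (Suc i) * C - smult z (monom 1 i * C)"
        by (simp add: monom_Suc algebra_simps)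
      with that show ?thesis by (simp add: moment_functional_diff moment_functional_smult)
    qed
    have a: "?L (monom 1 i * A) = z ^ i * ?L A" if "i < k" for i
      using that
    proof (induction i)
      case (Suc i) 
      then show ?case using step[of i A] P0(3)[of i] A by simp
    qed simp
    have b: "?L (monom 1 i * B) = z ^ i * ?L B" if "i < k" for i
      using that
    proof (induction i)
      case (Suc i) 
      then show ?case using step[of i B] R(3)[of i] B by simp
    qed simp
    define C where "C = smult (?L B) A - smult (?L A) B"
    have "C = 0"
    proof (rule nd)
      have "degree C \<le> k - 1" unfolding C_def using dA dB
        by (intro degree_diff_le order.trans[OF degree_smult_le]) auto
      then show "degree C < k" using k by simp
    next
      fix i assume "i < k"
      then show "?L (monom 1 i * C) = 0"
        by (simp add: C_def right_diff_distrib moment_functional_diff moment_functional_smult a b)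
    qed
    moreover have "coeff C (k - 1) = ?L B * lead_coeff A"
      using dA dB by (simp add: C_def coeff_eq_0)
    ultimately have "?L B = 0" using A0 by simp
    then have "B = 0" using b dB by (intro nd) auto
    then show False using B0 by simp
  qed
  \<comment> \<open>The Wronskian of the pencil, which vanishes at every double root of a member
    \<open>P0 + u R\<close>. Its leading coefficient is a multiple of \<open>k - degree R\<close>,
    nonzero in characteristic 0.\<close>
  define W where "W = pderiv P0 * R - P0 * pderiv R"
  have W0: "W \<noteq> 0"
  proof
    assume "W = 0"
    then have eq: "pderiv P0 * R = P0 * pderiv R" by (simp add: W_def)
    let ?r = "degree R"
    have 1: "coeff (pderiv P0 * R) (k - 1 + ?r) = of_nat k * lead_coeff P0 * lead_coeff R"
      using coeff_mult_degree_sum[of "pderiv P0" R] dP0 k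
      by (simp add: degree_pderiv coeff_pderiv)
    have 2: "coeff (P0 * pderiv R) (k - 1 + ?r) = of_nat ?r * lead_coeff P0 * lead_coeff R"
    proof (cases "?r = 0")
      case True
      then show ?thesis by (simp add: pderiv_eq_0_iff[THEN iffD2])
    next
      case False
      then have "coeff (P0 * pderiv R) (k + (?r - 1)) = of_nat ?r * lead_coeff P0 * lead_coeff R"
        using coeff_mult_degree_sum[of P0 "pderiv R"] dP0
        by (simp add: degree_pderiv coeff_pderiv)
      then show ?thesis using False k by simp
    qed
    have "of_nat k * lead_coeff P0 * lead_coeff R = of_nat ?r * lead_coeff P0 * lead_coeff R"
      using 1 2 eq by simp
    then have "k = ?r" using P0(1) R(1) by simp
    then show False using dR by simp
  qed
  define Z where "Z = {z. poly (W * H) z = 0}"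
  have "finite Z" unfolding Z_def using W0 H by (intro poly_roots_finite) simp
  then have "finite ((\<lambda>z. - poly P0 z / poly R z) ` Z)" by simp
  \<comment> \<open>The excluded value at \<open>z\<close> is the parameter of the member with root
    \<open>z\<close>. Where \<open>R\<close> vanishes, \<open>P0\<close> does not, so no member has
    that root and the value 0 of the division does no harm.\<close>
  then obtain u where u: "u \<notin> (\<lambda>z. - poly P0 z / poly R z) ` Z"
    using infinite_UNIV_char_0 ex_new_if_finite by blast
  define P where "P = P0 + smult u R"
  have good: "z \<notin> Z" if "poly P z = 0" for z
  proof
    assume "z \<in> Z"
    with u have "u \<noteq> - poly P0 z / poly R z" by blast
    with that coprime[of z] show False
      by (cases "poly R z = 0") (auto simp: P_def field_simps eq_neg_iff_add_eq_0)
  qed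
  have dP: "degree P = k"
    unfolding P_def using dP0 dR degree_smult_le[of u R] by (subst degree_add_eq_left) auto
  have "rsquarefree P" unfolding rsquarefree_roots
  proof (intro allI notI)
    fix z assume *: "poly P z = 0 \<and> poly (pderiv P) z = 0"
    then have "poly P0 z = - u * poly R z" "poly (pderiv P0) z = - u * poly (pderiv R) z"
      by (auto simp: P_def pderiv_add pderiv_smult eq_neg_iff_add_eq_0)
    then have "poly W z = 0" by (simp add: W_def)
    then show False using good[of z] * by (simp add: Z_def)
  qed
  then have "card {x. poly P x = 0} = k" using card_roots_rsquarefree dP by metis
  moreover have "?L (monom 1 i * P) = 0" if "i < k - 1" for i
    using P0(3)[of i] R(3)[of i] that
    by (simp add: P_def distrib_left moment_functional_add moment_functional_smult)
  ultimately obtain c where "\<forall>m<2*k-1. F m = (\<Sum>s\<in>{x. poly P x = 0}. c s * s ^ m)"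
    using quadrature_from_nodes[of P k F] dP k by blast
  moreover have "finite {x. poly P x = 0}" using dP k by (intro poly_roots_finite) auto
  ultimately show ?thesis using good \<open>card {x. poly P x = 0} = k\<close>
    by (intro exI[of _ "{x. poly P x = 0}"] exI[of _ c]) (auto simp: Z_def)
qed

section \<open>Symmetric quadrilinear forms on a three-dimensional space\<close>

definition det3 :: "'k::comm_ring_1 \<Rightarrow> 'k \<Rightarrow> 'k \<Rightarrow> 'k \<Rightarrow> 'k \<Rightarrow> 'k \<Rightarrow> 'k \<Rightarrow> 'k \<Rightarrow> 'k \<Rightarrow> 'k" where
  "det3 a b c d e f g h i = a * (e * i - f * h) - b * (d * i - f * g) + c * (d * h - e * g)"

text \<open>The cross product of two rows is orthogonal to both, and to the third row as the
  determinant is 0. If all three cross products vanish, the rank is at most one and a vector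
  orthogonal to one row with nonzero first entry suffices.\<close>

lemma det3_eq_0_kernel:
  fixes a :: "'k::field"
  assumes "det3 a b c d e f g h i = 0"
  shows "\<exists>x y z. (x, y, z) \<noteq> (0, 0, 0) \<and>
    a * x + b * y + c * z = 0 \<and> d * x + e * y + f * z = 0 \<and> g * x + h * y + i * z = 0"
proof -
  note D = assms[unfolded det3_def]
  consider "(b * f - c * e, c * d - a * f, a * e - b * d) \<noteq> (0, 0, 0)"
    | "(b * i - c * h, c * g - a * i, a * h - b * g) \<noteq> (0, 0, 0)"
    | "(e * i - f * h, f * g - d * i, d * h - e * g) \<noteq> (0, 0, 0)"
    | "b * f = c * e" "c * d = a * f" "a * e = b * d" "b * i = c * h" "c * g = a * i" "a * h = b * g"
      "e * i = f * h" "f * g = d * i" "d * h = e * g"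
    by fastforce
  then show ?thesis
  proof cases
    case 1
    then show ?thesis
      by - (rule exI[of _ "b * f - c * e"], rule exI[of _ "c * d - a * f"], rule exI[of _ "a * e - b * d"],
          use D in \<open>simp add: algebra_simps\<close>)
  next
    case 2
    then show ?thesis
      by - (rule exI[of _ "b * i - c * h"], rule exI[of _ "c * g - a * i"], rule exI[of _ "a * h - b * g"],
          use D in \<open>simp add: algebra_simps\<close>)
  next
    case 3
    then show ?thesis
      by - (rule exI[of _ "e * i - f * h"], rule exI[of _ "f * g - d * i"], rule exI[of _ "d * h - e * g"],
          use D in \<open>simp add: algebra_simps\<close>)
  next
    case 4
    show ?thesis
    proof (cases "a = 0 \<and> d = 0 \<and> g = 0")
      case True
      then show ?thesis by - (rule exI[of _ 1], rule exI[of _ 0], rule exI[of _ 0], simp)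
    next
      case False
      then consider "a \<noteq> 0" | "d \<noteq> 0" | "g \<noteq> 0" by blast
      then show ?thesis
      proof cases
        case 1
        then show ?thesis
          by - (rule exI[of _ "- b"], rule exI[of _ a], rule exI[of _ 0],
              use 4 in \<open>simp add: algebra_simps\<close>)
      next
        case 2
        then show ?thesis
          by - (rule exI[of _ "- e"], rule exI[of _ d], rule exI[of _ 0],
              use 4 in \<open>simp add: algebra_simps\<close>)
      next
        case 3
        then show ?thesis
          by - (rule exI[of _ "- h"], rule exI[of _ g], rule exI[of _ 0],
              use 4 in \<open>simp add: algebra_simps\<close>)
      qed
    qed
  qed
qed

lemma det3_neq_0_solve:
  fixes a :: "'k::field"
  assumes "det3 a b c d e f g h i \<noteq> 0"
  shows "\<exists>x y z. a * x + b * y + c * z = p \<and> d * x + e * y + f * z = q \<and> g * x + h * y + i * z = r"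
proof -
  let ?D = "det3 a b c d e f g h i"
  have "a * det3 p b c q e f r h i + b * det3 a p c d q f g r i + c * det3 a b p d e q g h r = p * ?D"
    "d * det3 p b c q e f r h i + e * det3 a p c d q f g r i + f * det3 a b p d e q g h r = q * ?D"
    "g * det3 p b c q e f r h i + h * det3 a p c d q f g r i + i * det3 a b p d e q g h r = r * ?D"
    by (simp_all add: det3_def algebra_simps)
  then show ?thesis
    using assms
    by - (rule exI[of _ "det3 p b c q e f r h i / ?D"], rule exI[of _ "det3 a p c d q f g r i / ?D"],
        rule exI[of _ "det3 a b p d e q g h r / ?D"], simp add: divide_simps)
qed

text \<open>Triples serve for both spaces: the arguments of the form \<open>T\<close> are covectors,
  the points of the decomposition are vectors, and \<open>dot3\<close> pairs the two.\<close>

type_synonym 'k vec3 = "'k \<times> 'k \<times> 'k"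

definition scale3 :: "'k::field \<Rightarrow> 'k vec3 \<Rightarrow> 'k vec3" (infixr "\<cdot>" 75) where
  "c \<cdot> v = (case v of (x, y, z) \<Rightarrow> (c * x, c * y, c * z))"

interpretation vec3: vector_space "(\<cdot>) :: 'k::field \<Rightarrow> 'k vec3 \<Rightarrow> 'k vec3"
  by unfold_locales (auto simp: scale3_def algebra_simps split: prod.splits)

definition indep3 :: "'k::field vec3 \<Rightarrow> 'k vec3 \<Rightarrow> 'k vec3 \<Rightarrow> bool" where
  "indep3 u v w \<longleftrightarrow> (\<forall>a b c. a \<cdot> u + b \<cdot> v + c \<cdot> w = 0 \<longrightarrow> a = 0 \<and> b = 0 \<and> c = 0)"

lemma indep3_span:
  assumes "indep3 u v w"
  obtains a b c where "x = a \<cdot> u + b \<cdot> v + c \<cdot> w"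
proof -
  obtain u1 u2 u3 v1 v2 v3 w1 w2 w3 x1 x2 x3 where
    [simp]: "u = (u1, u2, u3)" "v = (v1, v2, v3)" "w = (w1, w2, w3)" "x = (x1, x2, x3)"
    by (metis prod.exhaust)
  have "det3 u1 v1 w1 u2 v2 w2 u3 v3 w3 \<noteq> 0"
  proof
    assume "det3 u1 v1 w1 u2 v2 w2 u3 v3 w3 = 0"
    from det3_eq_0_kernel[OF this] obtain a b c where
      abc: "(a, b, c) \<noteq> (0, 0, 0)" "u1 * a + v1 * b + w1 * c = 0" "u2 * a + v2 * b + w2 * c = 0"
        "u3 * a + v3 * b + w3 * c = 0" by blast
    then have "a \<cdot> u + b \<cdot> v + c \<cdot> w = 0"
      by (simp add: scale3_def zero_prod_def mult.commute)
    then show False using assms abc(1) by (auto simp: indep3_def)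
  qed
  from det3_neq_0_solve[OF this, of x1 x2 x3] that show thesis
    by (auto simp: scale3_def mult.commute)
qed

definition dot3 :: "'k::field vec3 \<Rightarrow> 'k vec3 \<Rightarrow> 'k" where
  "dot3 u v = (case u of (a, b, c) \<Rightarrow> case v of (x, y, z) \<Rightarrow> a * x + b * y + c * z)"

lemma dot3_add [simp]: "dot3 (u + u') v = dot3 u v + dot3 u' v" "dot3 u (v + v') = dot3 u v + dot3 u v'"
  by (auto simp: dot3_def algebra_simps split: prod.splits)

lemma dot3_scale [simp]: "dot3 (c \<cdot> u) v = c * dot3 u v" "dot3 u (c \<cdot> v) = c * dot3 u v"
  by (auto simp: dot3_def scale3_def algebra_simps split: prod.splits)

lemma dot3_zero [simp]: "dot3 0 v = 0" "dot3 u 0 = 0"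
  by (auto simp: dot3_def zero_prod_def split: prod.splits)

lemma dot3_diff [simp]: "dot3 (u - u') v = dot3 u v - dot3 u' v" "dot3 u (v - v') = dot3 u v - dot3 u v'"
  by (auto simp: dot3_def algebra_simps split: prod.splits)

locale symmetric_quadrilinear =
  fixes T :: "'k::{alg_closed_field,field_char_0} vec3 \<Rightarrow> 'k vec3 \<Rightarrow> 'k vec3 \<Rightarrow> 'k vec3 \<Rightarrow> 'k"
  assumes add: "T (u + u') v w x = T u v w x + T u' v w x"
    and scale: "T (c \<cdot> u) v w x = c * T u v w x"
    and swap12: "T u v w x = T v u w x"
    and swap23: "T u v w x = T u w v x"
    and swap34: "T u v w x = T u v x w"
begin

lemma add2: "T u (v + v') w x = T u v w x + T u v' w x"
  using add[of v v' u w x] by (metis swap12)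

lemma add3: "T u v (w + w') x = T u v w x + T u v w' x"
  using add2[of u w w' v x] by (metis swap23)

lemma add4: "T u v w (x + x') = T u v w x + T u v w x'"
  using add3[of u v x x' w] by (metis swap34)

lemma scale2: "T u (c \<cdot> v) w x = c * T u v w x"
  using scale[of c v u w x] by (metis swap12)

lemma scale3: "T u v (c \<cdot> w) x = c * T u v w x"
  using scale2[of u c w v x] by (metis swap23)

lemma scale4: "T u v w (c \<cdot> x) = c * T u v w x"
  using scale3[of u v c x w] by (metis swap34)

lemmas sym = swap12 swap23 swap34

lemma zero1: "T 0 v w x = 0" using scale[of 0 0] by simp
lemma zero2: "T u 0 w x = 0" using scale2[of _ 0 0] by simp
lemma zero3: "T u v 0 x = 0" using scale3[of _ _ 0 0] by simp
lemma zero4: "T u v w 0 = 0" using scale4[of _ _ _ 0 0] by simp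

lemma uminus1: "T (- u) v w x = - T u v w x" using scale[of "-1" u] by simp
lemma uminus2: "T u (- v) w x = - T u v w x" using scale2[of u "-1" v] by simp
lemma uminus3: "T u v (- w) x = - T u v w x" using scale3[of u v "-1" w] by simp
lemma uminus4: "T u v w (- x) = - T u v w x" using scale4[of u v w "-1" x] by simp

lemma diff1: "T (u - u') v w x = T u v w x - T u' v w x" using add[of u "- u'"] by (simp add: uminus1)
lemma diff2: "T u (v - v') w x = T u v w x - T u v' w x" using add2[of u v "- v'"] by (simp add: uminus2)
lemma diff3: "T u v (w - w') x = T u v w x - T u v w' x" using add3[of u v w "- w'"] by (simp add: uminus3)
lemma diff4: "T u v w (x - x') = T u v w x - T u v w x'" using add4[of u v w x "- x'"] by (simp add: uminus4)

lemmas linear = add add2 add3 add4 scale scale2 scale3 scale4 zero1 zero2 zero3 zero4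
  uminus1 uminus2 uminus3 uminus4 diff1 diff2 diff3 diff4

section \<open>Polarization on a linear subspace \<open>P\<close>: the whole space, or a polar
  hyperplane\<close>

context
  fixes P :: "'k vec3 \<Rightarrow> bool"
  assumes closed: "P m \<Longrightarrow> P n \<Longrightarrow> P (m + c \<cdot> n)"
begin

lemma polarize2:
  assumes z: "\<And>m. P m \<Longrightarrow> T a b m m = 0" and "P m" "P n"
  shows "T a b m n = 0"
  using z[OF closed[OF assms(2,3), of 1]] z[OF assms(2)] z[OF assms(3)] swap34[of a b m n]
  by (simp add: linear)

text \<open>The restriction to \<open>m + c \<cdot> n\<close> is a polynomial in \<open>c\<close>
  that vanishes identically. Its linear coefficient is a multiple of the mixed value, and the factor
  3 cancels in characteristic 0.\<close>

lemma polarize3: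
  assumes z: "\<And>m. P m \<Longrightarrow> T a m m m = 0" and "P m" "P n" "P q"
  shows "T a m n q = 0"
proof -
  have "T a n m m = 0" if "P m" "P n" for m n
  proof -
    have "T a (m + c \<cdot> n) (m + c \<cdot> n) (m + c \<cdot> n) = poly [:0, 3 * T a n m m, 3 * T a n n m:] c" for c
      using z[OF that(1)] z[OF that(2)] by (simp add: linear sym algebra_simps)
    then have "[:0, 3 * T a n m m, 3 * T a n n m:] = 0"
      using z[OF closed[OF that]] by (intro poly_all_0_iff_0[THEN iffD1] allI) metis
    then show ?thesis by simp
  qed
  then show ?thesis using polarize2[of a m n q] assms(2-) by (metis sym)
qed

lemma polarize4:
  assumes z: "\<And>m. P m \<Longrightarrow> T m m m m = 0" and "P m" "P n" "P q" "P r"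
  shows "T m n q r = 0"
proof -
  have *: "T n m m m = 0" if "P m" "P n" for m n
  proof -
    have "T (m + c \<cdot> n) (m + c \<cdot> n) (m + c \<cdot> n) (m + c \<cdot> n) =
        poly [:0, 4 * T n m m m, 6 * T n n m m, 4 * T n n n m:] c" for c
      using z[OF that(1)] z[OF that(2)] by (simp add: linear sym algebra_simps)
    then have "[:0, 4 * T n m m m, 6 * T n n m m, 4 * T n n n m:] = 0"
      using z[OF closed[OF that]] by (intro poly_all_0_iff_0[THEN iffD1] allI) metis
    then show ?thesis by simp
  qed
  show ?thesis by (rule polarize3) (use * assms(2-) in auto)
qed

end

end

section \<open>Nonvanishing of the Hessian\<close>

lemma poly_det3:
  "poly (det3 a b c d e f g h i) x =
    det3 (poly a x) (poly b x) (poly c x) (poly d x) (poly e x) (poly f x) (poly g x) (poly h x) (poly i x)"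
  by (simp add: det3_def)

lemma det3_neq_0_unique:
  fixes a :: "'k::field"
  assumes "det3 a b c d e f g h i \<noteq> 0"
    and "a * x + b * y + c * z = 0" "d * x + e * y + f * z = 0" "g * x + h * y + i * z = 0"
  shows "x = 0 \<and> y = 0 \<and> z = 0"
proof -
  let ?D = "det3 a b c d e f g h i"
  have "x * ?D = (a * x + b * y + c * z) * (e * i - f * h) - (d * x + e * y + f * z) * (b * i - c * h)
          + (g * x + h * y + i * z) * (b * f - c * e)"
    "y * ?D = (d * x + e * y + f * z) * (a * i - c * g) - (a * x + b * y + c * z) * (d * i - f * g)
          - (g * x + h * y + i * z) * (a * f - c * d)"
    "z * ?D = (a * x + b * y + c * z) * (d * h - e * g) - (d * x + e * y + f * z) * (a * h - b * g)
          + (g * x + h * y + i * z) * (a * e - b * d)"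
    by (simp_all add: det3_def algebra_simps)
  then have "x * ?D = 0" "y * ?D = 0" "z * ?D = 0" unfolding assms(2-4) by simp_all
  then show ?thesis using assms(1) by simp
qed

context symmetric_quadrilinear
begin

text \<open>Up to a nonzero factor, the Hessian at \<open>l\<close> of the quartic
  \<open>T l l l l\<close>. The basis is a parameter because the vanishing is later exploited in a
  basis adapted to a particular covector.\<close>

definition gram :: "'k vec3 \<Rightarrow> 'k vec3 \<Rightarrow> 'k vec3 \<Rightarrow> 'k vec3 \<Rightarrow> 'k" where
  "gram l u v w = det3 (T l l u u) (T l l u v) (T l l u w)
     (T l l u v) (T l l v v) (T l l v w) (T l l u w) (T l l v w) (T l l w w)"

definition nondegenerate_at :: "'k vec3 \<Rightarrow> bool" where
  "nondegenerate_at l \<longleftrightarrow> (\<forall>m. (\<forall>n. T l l m n = 0) \<longrightarrow> m = 0)"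

lemma gram_eq_0_iff:
  assumes ind: "indep3 u v w"
  shows "gram l u v w = 0 \<longleftrightarrow> \<not> nondegenerate_at l"
proof
  assume "gram l u v w = 0"
  from det3_eq_0_kernel[OF this[unfolded gram_def]] obtain x y z where xyz: "(x, y, z) \<noteq> (0, 0, 0)"
    and eq: "T l l u u * x + T l l u v * y + T l l u w * z = 0"
      "T l l u v * x + T l l v v * y + T l l v w * z = 0"
      "T l l u w * x + T l l v w * y + T l l w w * z = 0" by blast
  define m where "m = x \<cdot> u + y \<cdot> v + z \<cdot> w"
  have "m \<noteq> 0" using ind xyz by (auto simp: indep3_def m_def)
  moreover have "T l l m n = 0" for n
  proof -
    obtain a b c where n: "n = a \<cdot> u + b \<cdot> v + c \<cdot> w" using indep3_span[OF ind] .
    have "T l l m n = a * (T l l u u * x + T l l u v * y + T l l u w * z)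
      + b * (T l l u v * x + T l l v v * y + T l l v w * z)
      + c * (T l l u w * x + T l l v w * y + T l l w w * z)"
      unfolding m_def n by (simp add: linear algebra_simps) (simp add: swap34)
    then show ?thesis using eq by simp
  qed
  ultimately show "\<not> nondegenerate_at l" unfolding nondegenerate_at_def by blast
next
  assume "\<not> nondegenerate_at l"
  then obtain m where m0: "m \<noteq> 0" and m: "\<And>n. T l l m n = 0"
    unfolding nondegenerate_at_def by blast
  obtain a b c where abc: "m = a \<cdot> u + b \<cdot> v + c \<cdot> w" using indep3_span[OF ind] .
  show "gram l u v w = 0"
  proof (rule ccontr)
    assume "gram l u v w \<noteq> 0"
    then have "a = 0 \<and> b = 0 \<and> c = 0"
      using m[of u] m[of v] m[of w] unfolding abc
      by (intro det3_neq_0_unique[OF _, of "T l l u u" "T l l u v" "T l l u w" "T l l u v" "T l l v v"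
            "T l l v w" "T l l u w" "T l l v w" "T l l w w"])
        (auto simp: gram_def linear algebra_simps swap34[of l l v u] swap34[of l l w u] swap34[of l l w v])
    then show False using m0 abc by simp
  qed
qed

text \<open>
  All information is extracted from the vanishing of the Hessian along \<open>l + cv\<close>, where \<open>v\<close> is
  successively arbitrary, \<open>m\<close>, and a combination of \<open>k\<close> and \<open>m\<close>.
\<close>

lemma degenerate_kernel_vanishes:
  assumes deg: "\<And>l. \<not> nondegenerate_at l"
    and p: "T l l l l \<noteq> 0" and k: "T l l l k = 0" "T l l k k \<noteq> 0"
    and m0: "m \<noteq> 0" and m: "\<And>n. T l l m n = 0"
  shows "T m u v w = 0"
proof -
  have ind: "indep3 l m k" unfolding indep3_def
  proof (intro allI impI)
    fix a b c assume *: "a \<cdot> l + b \<cdot> m + c \<cdot> k = 0"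
    have "T l l (a \<cdot> l + b \<cdot> m + c \<cdot> k) l = a * T l l l l"
      using m[of l] k by (simp add: linear sym)
    then have a: "a = 0" using * p by (simp add: linear)
    have "T l l (a \<cdot> l + b \<cdot> m + c \<cdot> k) k = c * T l l k k"
      using m[of k] k by (simp add: linear sym)
    then have c: "c = 0" using * k by (simp add: linear)
    show "a = 0 \<and> b = 0 \<and> c = 0" using a c * m0 by simp
  qed
  have gram0: "gram l' l m k = 0" for l' using gram_eq_0_iff[OF ind] deg by blast
  note ml = m[of l] and mm = m[of m] and mk = m[of k]
  let ?p = "T l l l l" and ?s = "T l l k k"
  \<comment> \<open>At \<open>c = 0\<close> the Gram matrix on \<open>l\<close>, \<open>m\<close>,
    \<open>k\<close> is diagonal with entries \<open>?p\<close>, 0, \<open>?s\<close>. The linear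
    coefficient of its determinant is therefore \<open>?p * ?s\<close> times the derivative of the
    middle entry.\<close>
  have first: "T l m m v = 0" for v
  proof -
    define q1 q2 q3 q4 q5 q6 where
      "q1 = [:?p, 2 * T l l l v, T v v l l:]" and "q2 = [:0, 0, T v v l m:]" and
      "q3 = [:0, 2 * T l l k v, T v v l k:]" and "q4 = [:0, 2 * T l m m v, T v v m m:]" and
      "q5 = [:0, 2 * T l m k v, T v v m k:]" and "q6 = [:?s, 2 * T l k k v, T v v k k:]"
    note q = q1_def q2_def q3_def q4_def q5_def q6_def
    have ev: "T (l + c \<cdot> v) (l + c \<cdot> v) l l = poly q1 c" "T (l + c \<cdot> v) (l + c \<cdot> v) l m = poly q2 c"
      "T (l + c \<cdot> v) (l + c \<cdot> v) l k = poly q3 c" "T (l + c \<cdot> v) (l + c \<cdot> v) m m = poly q4 c"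
      "T (l + c \<cdot> v) (l + c \<cdot> v) m k = poly q5 c" "T (l + c \<cdot> v) (l + c \<cdot> v) k k = poly q6 c" for c
      using ml mm mk m[of v] k(1) unfolding q by (simp_all add: linear sym algebra_simps)
    have "poly (det3 q1 q2 q3 q2 q4 q5 q3 q5 q6) c = 0" for c
      using gram0[of "l + c \<cdot> v"] by (simp only: poly_det3 gram_def ev)
    then have "det3 q1 q2 q3 q2 q4 q5 q3 q5 q6 = 0"
      by (intro poly_all_0_iff_0[THEN iffD1]) simp
    then have "coeff (det3 q1 q2 q3 q2 q4 q5 q3 q5 q6) 1 = 0" by simp
    then have "?p * ?s * T l m m v = 0"
      by (simp add: det3_def q coeff_mult mult_ac)
    then show ?thesis using p k by simp
  qed
  \<comment> \<open>By \<open>first\<close> the row of \<open>l\<close> stays diagonal along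
    \<open>m\<close>, so only the block of \<open>m\<close> and \<open>k\<close> matters: its
    coefficient of degree 2 in \<open>c\<close> kills \<open>?w\<close>, and then the one of degree
    4 kills \<open>?x\<close>.\<close>
  have second: "T m m m l = 0" "T m m m m = 0" "T m m m k = 0"
  proof -
    show 0: "T m m m l = 0" using first[of m] by (simp add: sym)
    let ?w = "T m m m m" and ?x = "T m m m k"
    have ev: "T (l + c \<cdot> m) (l + c \<cdot> m) l l = ?p" "T (l + c \<cdot> m) (l + c \<cdot> m) l m = 0"
      "T (l + c \<cdot> m) (l + c \<cdot> m) l k = 0" "T (l + c \<cdot> m) (l + c \<cdot> m) m m = c\<^sup>2 * ?w"
      "T (l + c \<cdot> m) (l + c \<cdot> m) m k = c\<^sup>2 * ?x"
      "T (l + c \<cdot> m) (l + c \<cdot> m) k k = ?s + c * (2 * T l m k k) + c\<^sup>2 * T m m k k" for c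
      using ml mm mk k(1) first[of l] first[of m] first[of k]
      by (simp_all add: linear sym algebra_simps power2_eq_square)
    have "poly [:0, 0, ?p * ?w * ?s, ?p * ?w * (2 * T l m k k), ?p * (?w * T m m k k - ?x\<^sup>2):] c = 0" for c
      using gram0[of "l + c \<cdot> m"] unfolding gram_def ev
      by (simp add: det3_def algebra_simps power2_eq_square)
    then have "[:0, 0, ?p * ?w * ?s, ?p * ?w * (2 * T l m k k), ?p * (?w * T m m k k - ?x\<^sup>2):] = 0"
      by (intro poly_all_0_iff_0[THEN iffD1]) blast
    then show "?w = 0" "?x = 0" using p k by auto
  qed
  \<comment> \<open>The shift by \<open>e \<cdot> m\<close> is a second parameter. For
    \<open>e = 0\<close> the coefficient of degree 2 in \<open>c\<close> only relates
    \<open>?b * ?s\<close> to the square of \<open>?a\<close>; its dependence on \<open>e\<close>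
    forces \<open>?b = 0\<close> and then \<open>?a = 0\<close>. After that the coefficient of
    degree 4 at \<open>e = 0\<close> is a multiple of the square of \<open>?c\<close>.\<close>
  have third: "T l m k k = 0 \<and> T m m k k = 0 \<and> T m k k k = 0"
  proof -
    let ?a = "T l m k k" and ?b = "T m m k k" and ?c = "T m k k k"
    let ?v = "\<lambda>c e. l + c \<cdot> k + e \<cdot> m"
    define q1 q2 q3 q4 q5 q6 where
      "q1 = (\<lambda>e::'k. [:?p, 0, ?s:])" and "q2 = (\<lambda>e::'k. [:0, 0, ?a:])" and
      "q3 = (\<lambda>e::'k. [:0, 2 * ?s + 2 * e * ?a, T l k k k:])" and "q4 = (\<lambda>e::'k. [:0, 0, ?b:])" and
      "q5 = (\<lambda>e::'k. [:0, 2 * ?a + 2 * e * ?b, ?c:])" and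
      "q6 = (\<lambda>e::'k. [:?s + 2 * e * ?a + e * e * ?b, 2 * T l k k k + 2 * e * ?c, T k k k k:])"
    note q = q1_def q2_def q3_def q4_def q5_def q6_def
    have ev: "T (?v c e) (?v c e) l l = poly (q1 e) c" "T (?v c e) (?v c e) l m = poly (q2 e) c"
      "T (?v c e) (?v c e) l k = poly (q3 e) c" "T (?v c e) (?v c e) m m = poly (q4 e) c"
      "T (?v c e) (?v c e) m k = poly (q5 e) c" "T (?v c e) (?v c e) k k = poly (q6 e) c" for c e
      using ml mm mk k(1) first[of l] first[of m] first[of k] second unfolding q
      by (simp_all add: linear sym algebra_simps)
    have "poly (det3 (q1 e) (q2 e) (q3 e) (q2 e) (q4 e) (q5 e) (q3 e) (q5 e) (q6 e)) c = 0" for c e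
      using gram0[of "?v c e"] by (simp only: poly_det3 gram_def ev)
    then have det: "det3 (q1 e) (q2 e) (q3 e) (q2 e) (q4 e) (q5 e) (q3 e) (q5 e) (q6 e) = 0" for e
      by (intro poly_all_0_iff_0[THEN iffD1]) simp
    have "poly [:?p * (?b * ?s - 4 * ?a * ?a), - 6 * ?p * ?a * ?b, - 3 * ?p * ?b * ?b:] e = 0" for e
    proof -
      have "coeff (det3 (q1 e) (q2 e) (q3 e) (q2 e) (q4 e) (q5 e) (q3 e) (q5 e) (q6 e)) 2 = 0"
        using det by simp
      then show ?thesis
        by (simp add: det3_def q coeff_mult numeral_2_eq_2 algebra_simps)
    qed
    then have "[:?p * (?b * ?s - 4 * ?a * ?a), - 6 * ?p * ?a * ?b, - 3 * ?p * ?b * ?b:] = 0"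
      by (intro poly_all_0_iff_0[THEN iffD1]) blast
    then have ab: "?b = 0" "?a = 0" using p by auto
    have "coeff (det3 (q1 0) (q2 0) (q3 0) (q2 0) (q4 0) (q5 0) (q3 0) (q5 0) (q6 0)) 4 = 0"
      using det[of 0] by simp
    then have "?p * ?c * ?c = 0"
      using ab by (simp add: det3_def q coeff_mult eval_nat_numeral algebra_simps)
    then show ?thesis using ab p by simp
  qed
  have basis: "T m x y z = 0" if "x \<in> {l, m, k}" "y \<in> {l, m, k}" "z \<in> {l, m, k}" for x y z
    using that ml mm mk first[of l] first[of m] first[of k] second third by (auto simp: sym)
  have ext3: "T m x y w = 0" if xy: "x \<in> {l, m, k}" "y \<in> {l, m, k}" for x y w
  proof -
    obtain a b c where "w = a \<cdot> l + b \<cdot> m + c \<cdot> k" using indep3_span[OF ind] .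
    then show ?thesis using basis[OF xy] by (simp add: linear)
  qed
  have ext2: "T m x v w = 0" if x: "x \<in> {l, m, k}" for x v w
  proof -
    obtain a b c where "v = a \<cdot> l + b \<cdot> m + c \<cdot> k" using indep3_span[OF ind] .
    then show ?thesis using ext3[OF x] by (simp add: linear)
  qed
  obtain a b c where "u = a \<cdot> l + b \<cdot> m + c \<cdot> k" using indep3_span[OF ind] .
  then show ?thesis using ext2 by (simp add: linear)
qed

text \<open>By \<open>rk\<close> every quadric \<open>T l l - -\<close> with
  \<open>T l l l l \<noteq> 0\<close> has rank one, so the quartic ought to be a multiple of the
  fourth power of \<open>T l l l -\<close>. Accordingly \<open>T\<close> is shown to vanish once one
  argument lies in the hyperplane \<open>P\<close>, which contains \<open>m\<close>.\<close>

lemma rank_one_kernel_vanishes: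
  assumes rk: "\<And>l k. T l l l l \<noteq> 0 \<Longrightarrow> T l l l k = 0 \<Longrightarrow> T l l k k = 0"
    and p: "T l l l l \<noteq> 0" and m: "T l l l m = 0"
  shows "T m u v w = 0"
proof -
  define P where "P n \<longleftrightarrow> T l l l n = 0" for n
  have closed: "P (n + c \<cdot> n')" if "P n" "P n'" for n n' c
    using that by (simp add: P_def linear)
  let ?p = "T l l l l"
  have q2: "T l l n n = 0" if "P n" for n using rk[OF p] that by (simp add: P_def)
  have q34: "T l n n n = 0 \<and> T n n n n = 0" if n: "P n" for n
  proof -
    let ?u = "T l n n n" and ?w = "T n n n n"
    have n': "T l l l n = 0" "T l l n n = 0" using n q2 by (auto simp: P_def)
    define a where "a c = l + c \<cdot> n" for c
    define e where "e = [:?p, 0, 0, 4 * ?u, ?w:]"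
    define f where "f = [:0, 0, 3 * ?u, ?w:]"
    define g where "g = [:0, 2 * ?u, ?w:]"
    have ev: "T (a c) (a c) (a c) (a c) = poly e c" "T (a c) (a c) (a c) n = poly f c"
      "T (a c) (a c) n n = poly g c" for c
      using n' by (simp_all add: a_def e_def f_def g_def linear sym algebra_simps)
    have "poly (e * (e * g - f * f)) c = 0" for c
    proof (cases "poly e c = 0")
      case False
      \<comment> \<open>The projection of \<open>n\<close> to the hyperplane polar to
        \<open>a c\<close>, to which \<open>rk\<close> applies. The result is
        \<open>e * g = f * f\<close>; since \<open>f * f\<close> starts in degree 4, the
        coefficients of degrees 1 and 2 of \<open>e * g\<close> vanish, and these are
        \<open>2 * ?p * ?u\<close> and \<open>?p * ?w\<close>.\<close>
      define k where "k = n - (poly f c / poly e c) \<cdot> a c"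
      have "T (a c) (a c) (a c) k = 0"
        using False by (simp add: k_def linear ev)
      then have "T (a c) (a c) k k = 0" using rk[of "a c" k] False ev by simp
      moreover have "T (a c) (a c) k k = poly g c - poly f c * poly f c / poly e c"
        using False by (simp add: k_def linear ev swap34[of "a c" "a c" n "a c"])
      ultimately show ?thesis using False by (simp add: field_simps)
    qed simp
    then have "e * (e * g - f * f) = 0" by (intro poly_all_0_iff_0[THEN iffD1]) blast
    moreover have "e \<noteq> 0" using p by (simp add: e_def)
    ultimately have 0: "e * g - f * f = 0" by simp
    then have "coeff (e * g - f * f) 1 = 0" "coeff (e * g - f * f) 2 = 0" by simp_all
    then show ?thesis using p
      by (simp add: e_def f_def g_def coeff_mult numeral_2_eq_2)
  qed
  have m': "P m" using m by (simp add: P_def)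
  have dec: "\<exists>a n. v = a \<cdot> l + n \<and> P n" for v
    by (intro exI[of _ "T l l l v / ?p"] exI[of _ "v - (T l l l v / ?p) \<cdot> l"])
      (use p in \<open>simp add: P_def linear\<close>)
  have 2: "T l l x y = 0" if "P x" "P y" for x y
    by (rule polarize2[of P]) (use closed q2 that in auto)
  have 3: "T l x y z = 0" if "P x" "P y" "P z" for x y z
    by (rule polarize3[of P]) (use closed q34 that in auto)
  have 4: "T t x y z = 0" if "P t" "P x" "P y" "P z" for t x y z
    by (rule polarize4[of P]) (use closed q34 that in auto)
  obtain a x b y c z where d: "u = a \<cdot> l + x" "P x" "v = b \<cdot> l + y" "P y" "w = c \<cdot> l + z" "P z"
    using dec by metis
  have "T m l l l = 0" "T m x l l = 0" "T m l y l = 0" "T m l l z = 0"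
    "T m l y z = 0" "T m x l z = 0" "T m x y l = 0" "T m x y z = 0"
    using m 2[OF m' d(2)] 2[OF m' d(4)] 2[OF m' d(6)] 3[OF m' d(4,6)] 3[OF m' d(2,6)]
      3[OF m' d(2,4)] 4[OF m' d(2,4,6)] by (simp_all add: sym)
  then show ?thesis unfolding d(1,3,5) by (simp add: linear)
qed

text \<open>Were the Hessian identically zero, some nonzero \<open>m\<close> would satisfy
  \<open>T m - - - = 0\<close>. Either some quadric \<open>T l l - -\<close> with
  \<open>T l l l l \<noteq> 0\<close> has rank two and \<open>m\<close> spans its radical, or all of
  these have rank one and \<open>m\<close> is any covector in the polar hyperplane.\<close>

theorem exists_nondegenerate_at:
  assumes ess: "\<And>m. m \<noteq> 0 \<Longrightarrow> \<exists>u v w. T m u v w \<noteq> 0"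
  shows "\<exists>l. nondegenerate_at l"
proof (rule ccontr)
  assume "\<nexists>l. nondegenerate_at l"
  then have deg: "\<And>l. \<not> nondegenerate_at l" by blast
  have "\<exists>l. T l l l l \<noteq> 0"
  proof (rule ccontr)
    assume "\<nexists>l. T l l l l \<noteq> 0"
    then have "T m u v w = 0" for m u v w
      by - (rule polarize4[of "\<lambda>_. True"], auto)
    then show False using ess[of "(1, 0, 0)"] by (simp add: zero_prod_def)
  qed
  then obtain l where p: "T l l l l \<noteq> 0" by blast
  show False
  proof (cases "\<exists>l k. T l l l l \<noteq> 0 \<and> T l l l k = 0 \<and> T l l k k \<noteq> 0")
    case True
    then obtain l k where lk: "T l l l l \<noteq> 0" "T l l l k = 0" "T l l k k \<noteq> 0" by blast
    obtain m where m: "m \<noteq> 0" "\<And>n. T l l m n = 0"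
      using deg[of l] unfolding nondegenerate_at_def by blast
    then show False using degenerate_kernel_vanishes[OF deg lk m] ess by metis
  next
    case False
    have "\<exists>m. m \<noteq> 0 \<and> T l l l m = 0"
    proof (cases "T l l l (1, 0, 0) = 0")
      case True
      then show ?thesis by (intro exI[of _ "(1, 0, 0)"]) (simp add: zero_prod_def)
    next
      case F: False
      then show ?thesis
        by (intro exI[of _ "T l l l (0, 1, 0) \<cdot> (1, 0, 0) - T l l l (1, 0, 0) \<cdot> (0, 1, 0)"] conjI)
          (simp add: scale3_def zero_prod_def, simp add: linear)
    qed
    then obtain m where "m \<noteq> 0" "T l l l m = 0" by blast
    then show False using rank_one_kernel_vanishes[OF _ p] False ess by metis
  qed
qed

end

section \<open>The adapted basis\<close>

lemma nonzero_poly_has_nonroot: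
  fixes p :: "'k::field_char_0 poly"
  assumes "p \<noteq> 0"
  shows "\<exists>t. poly p t \<noteq> 0"
  using assms poly_all_0_iff_0 by blast

lemma dot3_eq_1_exists:
  assumes "v \<noteq> 0"
  shows "\<exists>u. dot3 u v = 1" "\<exists>u. dot3 v u = 1"
proof -
  obtain x y z where v: "v = (x, y, z)" by (metis prod.exhaust)
  then consider "x \<noteq> 0" | "y \<noteq> 0" | "z \<noteq> 0" using assms by (auto simp: zero_prod_def)
  then have "\<exists>u. dot3 u v = 1 \<and> dot3 v u = 1"
  proof cases
    case 1
    then show ?thesis by (intro exI[of _ "(1 / x, 0, 0)"]) (simp add: dot3_def v)
  next
    case 2
    then show ?thesis by (intro exI[of _ "(0, 1 / y, 0)"]) (simp add: dot3_def v)
  next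
    case 3
    then show ?thesis by (intro exI[of _ "(0, 0, 1 / z)"]) (simp add: dot3_def v)
  qed
  then show "\<exists>u. dot3 u v = 1" "\<exists>u. dot3 v u = 1" by blast+
qed

lemma orthogonal3_exists: "\<exists>u. u \<noteq> 0 \<and> dot3 u v = 0 \<and> dot3 u w = 0"
proof -
  obtain v1 v2 v3 w1 w2 w3 where v: "v = (v1, v2, v3)" and w: "w = (w1, w2, w3)"
    by (metis prod.exhaust)
  have "det3 v1 v2 v3 w1 w2 w3 0 0 0 = 0" by (simp add: det3_def)
  from det3_eq_0_kernel[OF this] obtain x y z where "(x, y, z) \<noteq> (0, 0, 0)"
    "v1 * x + v2 * y + v3 * z = 0" "w1 * x + w2 * y + w3 * z = 0" by blast
  then show ?thesis
    by (intro exI[of _ "(x, y, z)"]) (auto simp: dot3_def v w zero_prod_def mult.commute)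
qed

definition dual3 :: "'k::field vec3 \<Rightarrow> 'k vec3 \<Rightarrow> 'k vec3 \<Rightarrow> 'k vec3 \<Rightarrow> 'k vec3 \<Rightarrow> 'k vec3 \<Rightarrow> bool" where
  "dual3 a b c x y z \<longleftrightarrow> dot3 a x = 1 \<and> dot3 a y = 0 \<and> dot3 a z = 0 \<and>
     dot3 b x = 0 \<and> dot3 b y = 1 \<and> dot3 b z = 0 \<and> dot3 c x = 0 \<and> dot3 c y = 0 \<and> dot3 c z = 1"

lemma dual3_indep3:
  assumes "dual3 a b c x y z"
  shows "indep3 a b c"
  unfolding indep3_def
proof (intro allI impI)
  fix p q r assume *: "p \<cdot> a + q \<cdot> b + r \<cdot> c = 0"
  have "p = dot3 (p \<cdot> a + q \<cdot> b + r \<cdot> c) x" "q = dot3 (p \<cdot> a + q \<cdot> b + r \<cdot> c) y"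
    "r = dot3 (p \<cdot> a + q \<cdot> b + r \<cdot> c) z" using assms by (simp_all add: dual3_def)
  then show "p = 0 \<and> q = 0 \<and> r = 0" unfolding * by simp
qed

lemma dual3_extend:
  assumes "l \<noteq> 0" "x \<noteq> 0" "dot3 l x = 0"
  obtains a c y z where "dual3 a l c x y z"
proof -
  obtain y where y: "dot3 l y = 1" using dot3_eq_1_exists[OF assms(1)] by blast
  obtain a1 where a1: "dot3 a1 x = 1" using dot3_eq_1_exists[OF assms(2)] by blast
  define a where "a = a1 - dot3 a1 y \<cdot> l"
  obtain c where c: "c \<noteq> 0" "dot3 c x = 0" "dot3 c y = 0" using orthogonal3_exists by blast
  obtain z1 where z1: "dot3 c z1 = 1" using dot3_eq_1_exists[OF c(1)] by blast
  define z where "z = z1 - dot3 a z1 \<cdot> x - dot3 l z1 \<cdot> y"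
  have a: "dot3 a x = 1" "dot3 a y = 0" using a1 assms y by (simp_all add: a_def)
  have "dual3 a l c x y z" unfolding dual3_def
    using a c y z1 assms by (simp add: z_def)
  then show thesis by (rule that)
qed

text \<open>Stands for the equation of the set to be avoided. It is only ever restricted to
  parametrized lines and to conics \<open>u + t \<cdot> v + t\<^sup>2 \<cdot> w\<close>, so
  polynomiality along these is what is recorded.\<close>

locale form_function =
  fixes h :: "'k::{alg_closed_field,field_char_0} vec3 \<Rightarrow> 'k" and d :: nat
  assumes along_curve: "\<exists>p. \<forall>t. h (u + t \<cdot> v + t\<^sup>2 \<cdot> w) = poly p t"
    and homogeneous: "h (c \<cdot> v) = c ^ d * h v"
begin

lemma along_line: obtains p where "\<And>t. h (u + t \<cdot> v) = poly p t"
  using along_curve[of u v 0] by auto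

end

locale form_pair = symmetric_quadrilinear T + form_function h d
  for T :: "'k::{alg_closed_field,field_char_0} vec3 \<Rightarrow> 'k vec3 \<Rightarrow> 'k vec3 \<Rightarrow> 'k vec3 \<Rightarrow> 'k"
    and h :: "'k vec3 \<Rightarrow> 'k" and d
begin

lemma nondegenerate_at_neq_0:
  assumes "nondegenerate_at l"
  shows "l \<noteq> 0"
proof
  assume "l = 0"
  then have "(1, 0, 0) = (0 :: 'k vec3)" using assms by (simp add: nondegenerate_at_def linear)
  then show False by (simp add: zero_prod_def)
qed

lemma standard_indep3: "indep3 (1, 0, 0) (0, 1, 0) (0, 0, 1)"
  by (simp add: indep3_def scale3_def zero_prod_def)

text \<open>An incident pair of a covector and a point moves with a parameter \<open>t\<close>: at
  \<open>t = 0\<close> the covector is the nondegenerate \<open>l0\<close>, and for \<open>t\<close>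
  tending to infinity the point tends to \<open>v0\<close>. Each condition is the nonvanishing of a
  polynomial in \<open>t\<close>, so a common \<open>t\<close> exists.\<close>

lemma nondegenerate_at_on_point:
  assumes nd: "\<exists>l. nondegenerate_at l" and v0: "h v0 \<noteq> 0" "v0 \<noteq> 0"
  obtains l v where "nondegenerate_at l" "v \<noteq> 0" "dot3 l v = 0" "h v \<noteq> 0"
proof -
  obtain l0 where l0: "nondegenerate_at l0" using nd by blast
  show thesis
  proof (cases "dot3 l0 v0 = 0")
    case True
    then show thesis using that[OF l0 v0(2) _ v0(1)] by blast
  next
    case False
    let ?\<delta> = "dot3 l0 v0"
    have dot_comm: "dot3 u v = dot3 v u" for u v :: "'k vec3"
      by (simp add: dot3_def mult.commute split: prod.splits)
    obtain u where u: "u \<noteq> 0" "dot3 l0 u = 0"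
      using orthogonal3_exists[of l0 l0] dot_comm by metis
    obtain k where k: "dot3 k u = 1" using dot3_eq_1_exists[OF u(1)] by blast
    \<comment> \<open>Chosen so that \<open>dot3 m u\<close> cancels \<open>dot3 l0 v0\<close> and
      \<open>dot3 m v0 = 0\<close>, which keeps the pair incident for all \<open>t\<close>.\<close>
    define m where "m = dot3 k v0 \<cdot> l0 - ?\<delta> \<cdot> k"
    have inc: "dot3 (l0 + t \<cdot> m) (u + t \<cdot> v0) = 0" for t
      using u k by (simp add: m_def algebra_simps)
    let ?e1 = "(1, 0, 0) :: 'k vec3" and ?e2 = "(0, 1, 0) :: 'k vec3" and ?e3 = "(0, 0, 1) :: 'k vec3"
    define q where "q a b = [:T l0 l0 a b, 2 * T l0 m a b, T m m a b:]" for a b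
    define g where "g = det3 (q ?e1 ?e1) (q ?e1 ?e2) (q ?e1 ?e3) (q ?e1 ?e2) (q ?e2 ?e2) (q ?e2 ?e3)
      (q ?e1 ?e3) (q ?e2 ?e3) (q ?e3 ?e3)"
    have q: "T (l0 + t \<cdot> m) (l0 + t \<cdot> m) a b = poly (q a b) t" for t a b
      by (simp add: q_def linear algebra_simps swap12[of m l0])
    have g: "gram (l0 + t \<cdot> m) ?e1 ?e2 ?e3 = poly g t" for t
      unfolding gram_def g_def poly_det3 q ..
    have "poly g 0 \<noteq> 0"
      using gram_eq_0_iff[OF standard_indep3, of l0] l0 by (simp flip: g)
    then have g0: "g \<noteq> 0" by auto
    obtain p where p: "\<And>t. h (u + t \<cdot> v0) = poly p t" using along_line by blast
    obtain p' where p': "\<And>t. h (v0 + t \<cdot> u) = poly p' t" using along_line by blast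
    \<comment> \<open>\<open>v0\<close> is the point at infinity of this line; homogeneity exchanges
      the two affine charts.\<close>
    have "p \<noteq> 0"
    proof
      assume "p = 0"
      have "poly ([:0, 1:] * p') t = 0" for t
      proof (cases "t = 0")
        case False
        have "v0 + t \<cdot> u = t \<cdot> (u + (1 / t) \<cdot> v0)" using False by (simp add: vec3.scale_right_distrib)
        then have "h (v0 + t \<cdot> u) = t ^ d * h (u + (1 / t) \<cdot> v0)" by (simp only: homogeneous)
        then show ?thesis using p \<open>p = 0\<close> p' by simp
      qed simp
      then have "[:0, 1:] * p' = 0" by (intro poly_all_0_iff_0[THEN iffD1]) blast
      then have "p' = 0" by simp
      then show False using p'[of 0] v0(1) by simp
    qed
    then have "g * p \<noteq> 0" using g0 by simp
    then obtain t where t: "poly (g * p) t \<noteq> 0" using nonzero_poly_has_nonroot by blast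
    have "u + t \<cdot> v0 \<noteq> 0"
    proof
      assume 0: "u + t \<cdot> v0 = 0"
      have "dot3 l0 (u + t \<cdot> v0) = t * ?\<delta>" using u by simp
      then have "t = 0" using 0 False by simp
      then show False using 0 u by simp
    qed
    then show thesis
      using that[of "l0 + t \<cdot> m" "u + t \<cdot> v0"] inc t g p gram_eq_0_iff[OF standard_indep3, of "l0 + t \<cdot> m"]
      by auto
  qed
qed

text \<open>A nondegenerate quadric represents every linear functional. Hence any product
  \<open>u v\<close> extends to a conic \<open>u v - l w\<close> apolar to the cubic
  \<open>T l - - -\<close>, which is why the apolar net cuts out all point pairs on
  \<open>l = 0\<close>.\<close>

lemma nondegenerate_at_represents:
  assumes nd: "nondegenerate_at l"
  obtains w where "\<And>n. T l u v n = T l l w n"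
proof -
  let ?e1 = "(1, 0, 0) :: 'k vec3" and ?e2 = "(0, 1, 0) :: 'k vec3" and ?e3 = "(0, 0, 1) :: 'k vec3"
  have "gram l ?e1 ?e2 ?e3 \<noteq> 0" using gram_eq_0_iff[OF standard_indep3] nd by blast
  from det3_neq_0_solve[OF this[unfolded gram_def], of "T l u v ?e1" "T l u v ?e2" "T l u v ?e3"]
  obtain x y z where e: "T l l ?e1 ?e1 * x + T l l ?e1 ?e2 * y + T l l ?e1 ?e3 * z = T l u v ?e1"
    "T l l ?e1 ?e2 * x + T l l ?e2 ?e2 * y + T l l ?e2 ?e3 * z = T l u v ?e2"
    "T l l ?e1 ?e3 * x + T l l ?e2 ?e3 * y + T l l ?e3 ?e3 * z = T l u v ?e3" by blast
  define w where "w = x \<cdot> ?e1 + y \<cdot> ?e2 + z \<cdot> ?e3"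
  have b: "T l u v ?e1 = T l l w ?e1" "T l u v ?e2 = T l l w ?e2" "T l u v ?e3 = T l l w ?e3"
    unfolding w_def using e
    by (simp_all add: linear mult.commute swap34[of l l ?e2 ?e1] swap34[of l l ?e3 ?e1] swap34[of l l ?e3 ?e2])
  have "T l u v n = T l l w n" for n
  proof -
    obtain a b c where "n = a \<cdot> ?e1 + b \<cdot> ?e2 + c \<cdot> ?e3" using indep3_span[OF standard_indep3] .
    then show ?thesis using b by (simp add: linear)
  qed
  then show thesis by (rule that)
qed

text \<open>The conic \<open>b\<^sup>2 = ac\<close> is apolar to the cubic \<open>T b - - -\<close>.\<close>

definition adapted :: "'k vec3 \<Rightarrow> 'k vec3 \<Rightarrow> 'k vec3 \<Rightarrow> bool" where
  "adapted a b c \<longleftrightarrow> nondegenerate_at b \<and> (\<forall>n. T b a c n = T b b b n)"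

text \<open>The conic has the form (c0 - r a0)(c0 - s a0) - l (U a0 + W l + V c0) and meets l = 0 at
  \<open>x0 + r \<cdot> z0\<close> and \<open>x0 + s \<cdot> z0\<close>. Written as A C - \<nu> l^2,
  with A and C its tangents at these points, it becomes a c = b^2 after rescaling.\<close>

lemma adapted_basis_exists:
  assumes nd: "nondegenerate_at l" and x0: "x0 \<noteq> 0" "dot3 l x0 = 0" "h x0 \<noteq> 0"
  obtains a b c x y z where "dual3 a b c x y z" "adapted a b c" "h x \<noteq> 0" "h z \<noteq> 0"
proof -
  have l0: "l \<noteq> 0" using nd by (rule nondegenerate_at_neq_0)
  obtain a0 c0 y0 z0 where dual: "dual3 a0 l c0 x0 y0 z0" using dual3_extend[OF l0 x0(1,2)] .
  note d = dual[unfolded dual3_def]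
  note ind = dual3_indep3[OF dual]
  \<comment> \<open>The three relations give generators of the net restricting to the squares and
    the product of \<open>a0\<close> and \<open>c0\<close> on \<open>l = 0\<close>.\<close>
  obtain U1 W1 V1 where 1: "\<And>n. T l a0 a0 n = T l l (U1 \<cdot> a0 + W1 \<cdot> l + V1 \<cdot> c0) n"
    by (metis nondegenerate_at_represents[OF nd, of a0 a0] indep3_span[OF ind])
  obtain U2 W2 V2 where 2: "\<And>n. T l a0 c0 n = T l l (U2 \<cdot> a0 + W2 \<cdot> l + V2 \<cdot> c0) n"
    by (metis nondegenerate_at_represents[OF nd, of a0 c0] indep3_span[OF ind])
  obtain U3 W3 V3 where 3: "\<And>n. T l c0 c0 n = T l l (U3 \<cdot> a0 + W3 \<cdot> l + V3 \<cdot> c0) n"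
    by (metis nondegenerate_at_represents[OF nd, of c0 c0] indep3_span[OF ind])
  \<comment> \<open>\<open>\<Phi> r s\<close> is the discriminant of the conic of the net through \<open>x0 + s z0\<close> and \<open>x0 + r z0\<close>.  If all these
    conics were singular, completing squares would turn the net into all quadrics in two variables,
    contradicting that \<open>T l l - -\<close> is nondegenerate.\<close>
  define U where "U r s = U3 - (r + s) * U2 + r * s * U1" for r s
  define V where "V r s = V3 - (r + s) * V2 + r * s * V1" for r s
  define W where "W r s = W3 - (r + s) * W2 + r * s * W1" for r s
  define \<Phi> where "\<Phi> r s = W r s * (r - s)\<^sup>2 - (U r s + r * V r s) * (U r s + s * V r s)" for r s
  \<comment> \<open>\<open>\<Phi>\<close> as a polynomial in its first argument, so that
    \<open>r\<close> and \<open>s\<close> can be chosen one after the other.\<close>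
  define P where "P s = [:W3 - s * W2, s * W1 - W2:] * [:- s, 1:]\<^sup>2 -
      ([:U3 - s * U2, s * U1 - U2:] + [:0, 1:] * [:V3 - s * V2, s * V1 - V2:]) *
      ([:U3 - s * U2, s * U1 - U2:] + [:s:] * [:V3 - s * V2, s * V1 - V2:])" for s
  have P: "poly (P s) r = \<Phi> r s" for r s
    by (simp add: P_def \<Phi>_def U_def V_def W_def algebra_simps power2_eq_square)
  have sym\<Phi>: "\<Phi> r s = \<Phi> s r" for r s
    by (simp add: \<Phi>_def U_def V_def W_def algebra_simps power2_eq_square)
  have "\<exists>r s. r \<noteq> s \<and> \<Phi> r s \<noteq> 0"
  proof (rule ccontr)
    assume "\<nexists>r s. r \<noteq> s \<and> \<Phi> r s \<noteq> 0"
    then have z: "\<Phi> r s = 0" if "r \<noteq> s" for r s using that by blast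
    have "P s = 0" for s
    proof -
      have "poly ([:- s, 1:] * P s) r = 0" for r using z[of r s] by (auto simp: P)
      then have "[:- s, 1:] * P s = 0" by (intro poly_all_0_iff_0[THEN iffD1]) blast
      then show ?thesis by (subst (asm) mult_eq_0_iff) simp
    qed
    then have "\<Phi> r r = 0" for r using P[of r r] by simp
    \<comment> \<open>On the diagonal \<open>\<Phi>\<close> is minus a square. The vanishing of its
      root, a cubic in \<open>r\<close>, gives four linear relations.\<close>
    then have "U r r + r * V r r = 0" for r by (simp add: \<Phi>_def)
    moreover have "poly [:U3, V3 - 2 * U2, U1 - 2 * V2, V1:] r = U r r + r * V r r" for r
      by (simp add: U_def V_def algebra_simps)
    ultimately have "poly [:U3, V3 - 2 * U2, U1 - 2 * V2, V1:] r = 0" for r by simp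
    then have "[:U3, V3 - 2 * U2, U1 - 2 * V2, V1:] = 0"
      by (intro poly_all_0_iff_0[THEN iffD1]) blast
    then have uv: "U3 = 0" "V3 = 2 * U2" "U1 = 2 * V2" "V1 = 0" by simp_all
    have "(W3 + U2\<^sup>2) - (r + s) * (W2 + U2 * V2) + r * s * (W1 + V2\<^sup>2) = 0" if "r \<noteq> s" for r s
    proof -
      have "\<Phi> r s = (r - s)\<^sup>2 *
          ((W3 + U2\<^sup>2) - (r + s) * (W2 + U2 * V2) + r * s * (W1 + V2\<^sup>2))"
        by (simp add: \<Phi>_def U_def V_def W_def uv algebra_simps power2_eq_square)
      then show ?thesis using z[OF that] that by simp
    qed
    note vanish = this
    define X Y Z where "X = W3 + U2\<^sup>2" and "Y = W2 + U2 * V2" and "Z = W1 + V2\<^sup>2"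
    note vanish = vanish[folded X_def Y_def Z_def]
    have xyz: "X - Y = 0" "X + Y = 0" "X - Z = 0"
      using vanish[of 0 1] vanish[of 0 "-1"] vanish[of 1 "-1"] by simp_all
    have "2 * X = (X - Y) + (X + Y)" by simp
    then have "X = 0" by (simp only: xyz) simp
    then have "X = 0" "Y = 0" "Z = 0" using xyz by simp_all
    then have "W3 + U2\<^sup>2 = 0" "W2 + U2 * V2 = 0" "W1 + V2\<^sup>2 = 0"
      unfolding X_def Y_def Z_def .
    then have w: "W3 = - U2\<^sup>2" "W2 = - (U2 * V2)" "W1 = - V2\<^sup>2"
      by (simp_all only: eq_neg_iff_add_eq_0)
    \<comment> \<open>Completing squares: in these coordinates the net is spanned by a^2, a c and
      c^2.\<close>
    define a c where "a = a0 - V2 \<cdot> l" and "c = c0 - U2 \<cdot> l"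
    have aa: "T l a a n = 0" "T l a c n = 0" "T l c c n = 0" for n
      using 1[of n] 2[of n] 3[of n] unfolding a_def c_def uv w
      by (simp_all add: linear swap23[of l a0 l] swap23[of l c0 l] swap23[of l c0 a0]
          algebra_simps power2_eq_square)
    have dual': "dual3 a l c x0 (y0 + V2 \<cdot> x0 + U2 \<cdot> z0) z0"
      using d by (simp add: dual3_def a_def c_def)
    \<comment> \<open>\<open>T l l - -\<close> vanishes on the span of \<open>a\<close> and
      \<open>c\<close>, so a combination of the two that also pairs to 0 with \<open>l\<close> lies
      in the radical. Two unknowns and one equation leave a nonzero one.\<close>
    have km: "T l l m n = 0" if m: "m = p \<cdot> a + q \<cdot> c" "p * T l l a l + q * T l l c l = 0" for m n p q
    proof -
      obtain a' b' c' where n: "n = a' \<cdot> a + b' \<cdot> l + c' \<cdot> c" using indep3_span[OF dual3_indep3[OF dual']] .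
      have "T l l a a = 0" "T l l a c = 0" "T l l c c = 0" "T l l c a = 0"
        using aa[of l] by (simp_all add: sym)
      then have "T l l m n = b' * (p * T l l a l + q * T l l c l)"
        unfolding n m(1) by (simp add: linear algebra_simps)
      then show ?thesis unfolding m(2) by simp
    qed
    have nz: "p = 0 \<and> q = 0" if "p * T l l a l + q * T l l c l = 0" for p q
    proof -
      have "p \<cdot> a + q \<cdot> c = 0" using km[OF refl that] nd unfolding nondegenerate_at_def by blast
      then have "p \<cdot> a + 0 \<cdot> l + q \<cdot> c = 0" by simp
      then show ?thesis using dual3_indep3[OF dual'] unfolding indep3_def by blast
    qed
    show False using nz[of "T l l c l" "- T l l a l"] nz[of 1 1] by simp
  qed
  then obtain r0 s0 where rs0: "\<Phi> r0 s0 \<noteq> 0" by blast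
  obtain H where H: "\<And>t. h (x0 + t \<cdot> z0) = poly H t" using along_line by blast
  have "H \<noteq> 0" using H[of 0] x0(3) by auto
  moreover have "P s0 \<noteq> 0" using rs0 P[of s0 r0] by auto
  ultimately have "P s0 * H \<noteq> 0" by simp
  then obtain r where "poly (P s0 * H) r \<noteq> 0" using nonzero_poly_has_nonroot by blast
  then have r: "\<Phi> s0 r \<noteq> 0" "h (x0 + r \<cdot> z0) \<noteq> 0" using P sym\<Phi> H by auto
  then have "P r \<noteq> 0" using P[of r s0] by auto
  then have "P r * H * [:- r, 1:] \<noteq> 0" using \<open>H \<noteq> 0\<close> by (intro no_zero_divisors) simp_all
  then obtain s where "poly (P r * H * [:- r, 1:]) s \<noteq> 0" using nonzero_poly_has_nonroot by blast
  then have s: "\<Phi> r s \<noteq> 0" "h (x0 + s \<cdot> z0) \<noteq> 0" "r \<noteq> s" using P[of r s] sym\<Phi>[of r s] H by auto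
  define x z where "x = x0 + s \<cdot> z0" and "z = x0 + r \<cdot> z0"
  let ?U = "U r s" and ?V = "V r s" and ?W = "W r s"
  \<comment> \<open>The solution of V = \<zeta> + \<xi> and U = - (r \<zeta> + s \<xi>), which makes
    the terms linear in \<open>l\<close> absorbable into the two tangents; \<open>\<nu>\<close> is
    what remains at l^2.\<close>
  define \<zeta> \<xi> where "\<zeta> = - (?U + s * ?V) / (r - s)" and "\<xi> = (?U + r * ?V) / (r - s)"
  define \<nu> where "\<nu> = ?W + \<xi> * \<zeta>"
  have "w + (x / e) * (- y / e) = (w * e\<^sup>2 - x * y) / e\<^sup>2" if "e \<noteq> 0" for w x y e :: 'k
    using that by (simp add: field_simps power2_eq_square)
  from this[of "r - s" ?W "?U + r * ?V" "?U + s * ?V"]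
  have "\<nu> = \<Phi> r s / (r - s)\<^sup>2"
    using s(3) unfolding \<nu>_def \<Phi>_def \<zeta>_def \<xi>_def by simp
  then have \<nu>: "\<nu> \<noteq> 0" using s by simp
  \<comment> \<open>Normalizing \<open>a\<close> and \<open>c\<close> to 1 at \<open>x\<close> and
    \<open>z\<close> divides A C by - (r - s)^2, so this scale of \<open>l\<close> gives exactly a c
    = b^2.\<close>
  obtain \<mu> where \<mu>: "\<mu>\<^sup>2 = - \<nu> / (r - s)\<^sup>2" using nth_root_exists[of 2 "- \<nu> / (r - s)\<^sup>2"] by auto
  have \<mu>0: "\<mu> \<noteq> 0" using \<mu> \<nu> s(3) by auto
  define A C where "A = c0 - r \<cdot> a0 - \<xi> \<cdot> l" and "C = c0 - s \<cdot> a0 - \<zeta> \<cdot> l"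
  define a b c where "a = (1 / (s - r)) \<cdot> A" and "b = \<mu> \<cdot> l" and "c = (1 / (r - s)) \<cdot> C"
  define y where "y = (1 / \<mu>) \<cdot> (y0 + (\<xi> / (s - r)) \<cdot> x + (\<zeta> / (r - s)) \<cdot> z)"
  have D: "dot3 A x = s - r" "dot3 A z = 0" "dot3 A y0 = - \<xi>" "dot3 C x = 0" "dot3 C z = r - s"
    "dot3 C y0 = - \<zeta>" "dot3 l x = 0" "dot3 l z = 0" "dot3 l y0 = 1"
    using d by (simp_all add: A_def C_def x_def z_def)
  have dual': "dual3 a b c x y z"
    unfolding dual3_def a_def b_def c_def y_def using s(3) \<mu>0 by (simp add: D)
  have TAC: "T l A C n = \<nu> * T l l l n" for n
  proof -
    have z: "?V = \<zeta> + \<xi>" "?U = - (r * \<zeta> + s * \<xi>)"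
    proof -
      have e: "\<zeta> * (r - s) = - (?U + s * ?V)" "\<xi> * (r - s) = ?U + r * ?V"
        using s(3) by (simp_all add: \<zeta>_def \<xi>_def)
      have "(\<zeta> + \<xi>) * (r - s) = \<zeta> * (r - s) + \<xi> * (r - s)"
        "- (r * \<zeta> + s * \<xi>) * (r - s) = - (r * (\<zeta> * (r - s)) + s * (\<xi> * (r - s)))"
        by (simp_all add: algebra_simps)
      then have "(\<zeta> + \<xi>) * (r - s) = ?V * (r - s)" "- (r * \<zeta> + s * \<xi>) * (r - s) = ?U * (r - s)"
        unfolding e by (simp_all add: algebra_simps)
      then show "?V = \<zeta> + \<xi>" "?U = - (r * \<zeta> + s * \<xi>)" using s(3) by simp_all
    qed
    have "T l (c0 - r \<cdot> a0) (c0 - s \<cdot> a0) n = ?U * T l l a0 n + ?W * T l l l n + ?V * T l l c0 n"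
      using 1[of n] 2[of n] 3[of n] unfolding U_def V_def W_def
      by (simp add: linear swap23[of l c0 a0] algebra_simps)
    then show ?thesis unfolding A_def C_def \<nu>_def z
      by (simp add: linear swap23[of l a0 l] swap23[of l c0 l] algebra_simps)
  qed
  have "T b a c n = T b b b n" for n
  proof -
    have "T b a c n = \<mu> * (1 / (s - r)) * (1 / (r - s)) * \<nu> * T l l l n"
      by (simp add: a_def b_def c_def linear TAC mult_ac)
    also have "1 / (s - r) = - (1 / (r - s))"
      by (metis minus_diff_eq minus_divide_right)
    then have "(1 / (s - r)) * (1 / (r - s)) * \<nu> = \<mu>\<^sup>2"
      unfolding \<mu> by (simp add: power2_eq_square)
    then have "\<mu> * (1 / (s - r)) * (1 / (r - s)) * \<nu> * T l l l n = \<mu> * \<mu>\<^sup>2 * T l l l n"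
      by (metis mult.assoc)
    finally show ?thesis by (simp add: b_def linear power2_eq_square)
  qed
  moreover have "nondegenerate_at b"
    using nd \<mu>0 by (simp add: nondegenerate_at_def b_def linear)
  ultimately have "adapted a b c" by (simp add: adapted_def)
  then show thesis using that[OF dual'] r(2) s(2) by (simp add: x_def z_def)
qed

end

section \<open>Points on the conic and on the line\<close>

lemma sum_lessThan_5: "(\<Sum>j<5. f j) = f 0 + f 1 + f 2 + f 3 + f (4::nat)" for f :: "nat \<Rightarrow> 'k::comm_ring_1"
  by (simp add: eval_nat_numeral)

lemma sum_lessThan_3: "(\<Sum>j<3. f j) = f 0 + f 1 + f (2::nat)" for f :: "nat \<Rightarrow> 'k::comm_ring_1"
  by (simp add: eval_nat_numeral)

lemma all_less_5: "(\<forall>j<5. P j) \<longleftrightarrow> P 0 \<and> P 1 \<and> P 2 \<and> P 3 \<and> P (4::nat)"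
  by (simp add: eval_nat_numeral All_less_Suc conj_ac)

lemma all_less_3: "(\<forall>j<3. P j) \<longleftrightarrow> P 0 \<and> P 1 \<and> P (2::nat)"
  by (simp add: eval_nat_numeral All_less_Suc conj_ac)

text \<open>Schur complement of the invertible middle 3 x 3 block in the Hankel matrix with corners
  \<open>\<alpha>\<close> and \<open>\<beta>\<close>. What remains is a 2 x 2 matrix with diagonal
  \<open>\<alpha> - \<alpha>0\<close>, \<open>\<beta> - \<beta>0\<close> and constant off-diagonal
  entries, whose product is \<open>\<epsilon>\<close>.\<close>

lemma hankel5_nondegenerate:
  fixes f1 :: "'k::field"
  assumes "det3 f2 f3 f4 f3 f4 f5 f4 f5 f6 \<noteq> 0"
  obtains \<alpha>0 \<beta>0 \<epsilon> where "\<And>\<alpha> \<beta> x0 x1 x2 x3 x4. (\<alpha> - \<alpha>0) * (\<beta> - \<beta>0) \<noteq> \<epsilon> \<Longrightarrow>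
    \<alpha> * x0 + f1 * x1 + f2 * x2 + f3 * x3 + f4 * x4 = 0 \<Longrightarrow>
    f1 * x0 + f2 * x1 + f3 * x2 + f4 * x3 + f5 * x4 = 0 \<Longrightarrow>
    f2 * x0 + f3 * x1 + f4 * x2 + f5 * x3 + f6 * x4 = 0 \<Longrightarrow>
    f3 * x0 + f4 * x1 + f5 * x2 + f6 * x3 + f7 * x4 = 0 \<Longrightarrow>
    f4 * x0 + f5 * x1 + f6 * x2 + f7 * x3 + \<beta> * x4 = 0 \<Longrightarrow>
    x0 = 0 \<and> x1 = 0 \<and> x2 = 0 \<and> x3 = 0 \<and> x4 = 0"
proof -
  obtain u1 u2 u3 where u: "f2 * u1 + f3 * u2 + f4 * u3 = f1" "f3 * u1 + f4 * u2 + f5 * u3 = f2"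
    "f4 * u1 + f5 * u2 + f6 * u3 = f3"
    using det3_neq_0_solve[OF assms, of f1 f2 f3] by blast
  obtain v1 v2 v3 where v: "f2 * v1 + f3 * v2 + f4 * v3 = f5" "f3 * v1 + f4 * v2 + f5 * v3 = f6"
    "f4 * v1 + f5 * v2 + f6 * v3 = f7"
    using det3_neq_0_solve[OF assms, of f5 f6 f7] by blast
  define \<alpha>0 \<beta>0 e1 e2 where "\<alpha>0 = f1 * u1 + f2 * u2 + f3 * u3" and "\<beta>0 = f5 * v1 + f6 * v2 + f7 * v3"
    and "e1 = f4 - (f1 * v1 + f2 * v2 + f3 * v3)" and "e2 = f4 - (f5 * u1 + f6 * u2 + f7 * u3)"
  have "x0 = 0 \<and> x1 = 0 \<and> x2 = 0 \<and> x3 = 0 \<and> x4 = 0"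
    if ne: "(\<alpha> - \<alpha>0) * (\<beta> - \<beta>0) \<noteq> e1 * e2"
    and r0: "\<alpha> * x0 + f1 * x1 + f2 * x2 + f3 * x3 + f4 * x4 = 0"
    and r1: "f1 * x0 + f2 * x1 + f3 * x2 + f4 * x3 + f5 * x4 = 0"
    and r2: "f2 * x0 + f3 * x1 + f4 * x2 + f5 * x3 + f6 * x4 = 0"
    and r3: "f3 * x0 + f4 * x1 + f5 * x2 + f6 * x3 + f7 * x4 = 0"
    and r4: "f4 * x0 + f5 * x1 + f6 * x2 + f7 * x3 + \<beta> * x4 = 0" for \<alpha> \<beta> x0 x1 x2 x3 x4
  proof -
    let ?y1 = "x1 + x0 * u1 + x4 * v1" and ?y2 = "x2 + x0 * u2 + x4 * v2" and ?y3 = "x3 + x0 * u3 + x4 * v3"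
    have "f2 * ?y1 + f3 * ?y2 + f4 * ?y3 = (f2 * x1 + f3 * x2 + f4 * x3) +
        x0 * (f2 * u1 + f3 * u2 + f4 * u3) + x4 * (f2 * v1 + f3 * v2 + f4 * v3)"
      by (simp add: algebra_simps)
    also have "\<dots> = 0" unfolding u v using r1 by (simp add: algebra_simps)
    finally have 1: "f2 * ?y1 + f3 * ?y2 + f4 * ?y3 = 0" .
    have "f3 * ?y1 + f4 * ?y2 + f5 * ?y3 = (f3 * x1 + f4 * x2 + f5 * x3) +
        x0 * (f3 * u1 + f4 * u2 + f5 * u3) + x4 * (f3 * v1 + f4 * v2 + f5 * v3)"
      by (simp add: algebra_simps)
    also have "\<dots> = 0" unfolding u v using r2 by (simp add: algebra_simps)
    finally have 2: "f3 * ?y1 + f4 * ?y2 + f5 * ?y3 = 0" .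
    have "f4 * ?y1 + f5 * ?y2 + f6 * ?y3 = (f4 * x1 + f5 * x2 + f6 * x3) +
        x0 * (f4 * u1 + f5 * u2 + f6 * u3) + x4 * (f4 * v1 + f5 * v2 + f6 * v3)"
      by (simp add: algebra_simps)
    also have "\<dots> = 0" unfolding u v using r3 by (simp add: algebra_simps)
    finally have 3: "f4 * ?y1 + f5 * ?y2 + f6 * ?y3 = 0" .
    have y: "?y1 = 0" "?y2 = 0" "?y3 = 0" using det3_neq_0_unique[OF assms 1 2 3] by auto
    have "(\<alpha> - \<alpha>0) * x0 + e1 * x4 = (\<alpha> * x0 + f1 * x1 + f2 * x2 + f3 * x3 + f4 * x4)
        - (f1 * ?y1 + f2 * ?y2 + f3 * ?y3)"
      by (simp add: \<alpha>0_def e1_def algebra_simps)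
    then have 4: "(\<alpha> - \<alpha>0) * x0 + e1 * x4 = 0" unfolding r0 y by simp
    have "e2 * x0 + (\<beta> - \<beta>0) * x4 = (f4 * x0 + f5 * x1 + f6 * x2 + f7 * x3 + \<beta> * x4)
        - (f5 * ?y1 + f6 * ?y2 + f7 * ?y3)"
      by (simp add: \<beta>0_def e2_def algebra_simps)
    then have 5: "e2 * x0 + (\<beta> - \<beta>0) * x4 = 0" unfolding r4 y by simp
    have "((\<alpha> - \<alpha>0) * (\<beta> - \<beta>0) - e1 * e2) * x0 =
        (\<beta> - \<beta>0) * ((\<alpha> - \<alpha>0) * x0 + e1 * x4) - e1 * (e2 * x0 + (\<beta> - \<beta>0) * x4)"
      "((\<alpha> - \<alpha>0) * (\<beta> - \<beta>0) - e1 * e2) * x4 =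
        (\<alpha> - \<alpha>0) * (e2 * x0 + (\<beta> - \<beta>0) * x4) - e2 * ((\<alpha> - \<alpha>0) * x0 + e1 * x4)"
      by (simp_all add: algebra_simps)
    then have "x0 = 0" "x4 = 0" unfolding 4 5 using ne by simp_all
    then show ?thesis using y by simp
  qed
  then show thesis by (rule that)
qed

text \<open>Both expressions have degree at most one in \<open>\<beta>\<close>. First
  \<open>\<alpha>\<close> is chosen such that neither vanishes identically in
  \<open>\<beta>\<close>, then \<open>\<beta>\<close> avoids their roots. \<open>?Q\<close> is the
  determinant as a polynomial in \<open>\<beta>\<close>.\<close>

lemma avoid_two_bilinear_conditions:
  fixes \<alpha>0 :: "'k::field_char_0"
  assumes "(g1, g2, g3) \<noteq> (0, 0, 0)"
  obtains \<alpha> \<beta> where "(\<alpha> - \<alpha>0) * (\<beta> - \<beta>0) \<noteq> \<epsilon>"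
    "det3 (p - \<alpha>) g1 g2 g1 g2 g3 g2 g3 (q - \<beta>) \<noteq> 0"
proof -
  have "\<exists>\<alpha>. \<alpha> \<noteq> \<alpha>0 \<and> [:(p - \<alpha>) * (g2 * q - g3\<^sup>2) - g1 * (g1 * q - g2 * g3) + g2 * (g1 * g3 - g2\<^sup>2),
      - ((p - \<alpha>) * g2 - g1\<^sup>2):] \<noteq> 0"
  proof (cases "g1 = 0 \<and> g2 = 0")
    \<comment> \<open>Here the determinant is - (p - \<alpha>) g3^2, constant in
      \<open>\<beta>\<close>.\<close>
    case True
    then have g3: "g3 \<noteq> 0" using assms by simp
    have "[:- \<alpha>0, 1:] * [:- p, 1:] \<noteq> 0" by (intro no_zero_divisors) simp_all
    then obtain \<alpha> where "poly ([:- \<alpha>0, 1:] * [:- p, 1:]) \<alpha> \<noteq> 0" using nonzero_poly_has_nonroot by blast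
    then have "\<alpha> \<noteq> \<alpha>0" "\<alpha> \<noteq> p" by (auto simp del: mult_pCons_left mult_pCons_right)
    then show ?thesis using True g3 by (intro exI[of _ \<alpha>]) simp
  next
    case False
    then have "[:- \<alpha>0, 1:] * [:p * g2 - g1\<^sup>2, - g2:] \<noteq> 0" by (intro no_zero_divisors) auto
    then obtain \<alpha> where "poly ([:- \<alpha>0, 1:] * [:p * g2 - g1\<^sup>2, - g2:]) \<alpha> \<noteq> 0"
      using nonzero_poly_has_nonroot by blast
    then have "\<alpha> \<noteq> \<alpha>0" "p * g2 - g1\<^sup>2 - \<alpha> * g2 \<noteq> 0"
      by (auto simp del: mult_pCons_left mult_pCons_right simp: algebra_simps)
    then show ?thesis by (intro exI[of _ \<alpha>]) (auto simp: algebra_simps)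
  qed
  then obtain \<alpha> where \<alpha>: "\<alpha> \<noteq> \<alpha>0"
    and ne: "[:(p - \<alpha>) * (g2 * q - g3\<^sup>2) - g1 * (g1 * q - g2 * g3) + g2 * (g1 * g3 - g2\<^sup>2),
      - ((p - \<alpha>) * g2 - g1\<^sup>2):] \<noteq> 0" (is "?Q \<noteq> 0") by blast
  let ?L = "[:- (\<alpha> - \<alpha>0) * \<beta>0 - \<epsilon>, \<alpha> - \<alpha>0:]"
  have "?L * ?Q \<noteq> 0" using \<alpha> ne by (intro no_zero_divisors) auto
  then obtain \<beta> where "poly (?L * ?Q) \<beta> \<noteq> 0" using nonzero_poly_has_nonroot by blast
  then have "poly ?L \<beta> \<noteq> 0" "poly ?Q \<beta> \<noteq> 0" unfolding poly_mult by auto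
  then show thesis
    by (intro that[of \<alpha> \<beta>]) (auto simp: det3_def algebra_simps power2_eq_square)
qed

context symmetric_quadrilinear
begin

lemma pair_expansion:
  "T (p \<cdot> a + q \<cdot> b + r \<cdot> c) (p \<cdot> a + q \<cdot> b + r \<cdot> c) x y =
    p * p * T a a x y + 2 * p * q * T a b x y + 2 * p * r * T a c x y
    + q * q * T b b x y + 2 * q * r * T b c x y + r * r * T c c x y"
  by (simp add: linear swap12[of b a] swap12[of c a] swap12[of c b] algebra_simps)

lemma swap_pairs: "T u v w x = T w x u v"
  by (simp add: sym)

lemma quartic_expansion:
  assumes "u = p \<cdot> a + q \<cdot> b + r \<cdot> c"
  shows "T u u u u = p^4 * T a a a a + 4*p^3*q * T a a a b + 4*p^3*r * T a a a c + 6*p\<^sup>2*q\<^sup>2 * T a a b b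
         + 12*p\<^sup>2*q*r * T a a b c + 4*p*q^3 * T a b b b + 6*p\<^sup>2*r\<^sup>2 * T a a c c + 12*p*q\<^sup>2*r * T a b b c
         + q^4 * T b b b b + 12*p*q*r\<^sup>2 * T a b c c + 4*q^3*r * T b b b c + 4*p*r^3 * T a c c c + 6*q\<^sup>2*r\<^sup>2 * T b b c c
         + 4*q*r^3 * T b c c c + r^4 * T c c c c"
proof -
  have 1: "T x y u u = p * p * T a a x y + 2 * p * q * T a b x y + 2 * p * r * T a c x y
    + q * q * T b b x y + 2 * q * r * T b c x y + r * r * T c c x y" for x y
    unfolding swap_pairs[of x y] assms by (rule pair_expansion)
  have s: "T a b a a = T a a a b" "T a c a a = T a a a c" "T b b a a = T a a b b" "T b c a a = T a a b c"
    "T c c a a = T a a c c" "T a b a b = T a a b b" "T a c a b = T a a b c" "T b b a b = T a b b b"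
    "T b c a b = T a b b c" "T c c a b = T a b c c" "T a b a c = T a a b c" "T a c a c = T a a c c"
    "T b b a c = T a b b c" "T b c a c = T a b c c" "T c c a c = T a c c c" "T a c b b = T a b b c"
    "T b c b b = T b b b c" "T c c b b = T b b c c" "T a c b c = T a b c c"
    "T b c b c = T b b c c" "T c c b c = T b c c c"
    by (simp_all add: sym)
  have 2: "T a a u u = p * p * T a a a a + 2 * p * q * T a a a b + 2 * p * r * T a a a c + q * q * T a a b b + 2 * q * r * T a a b c + r * r * T a a c c"
    "T a b u u = p * p * T a a a b + 2 * p * q * T a a b b + 2 * p * r * T a a b c + q * q * T a b b b + 2 * q * r * T a b b c + r * r * T a b c c"
    "T a c u u = p * p * T a a a c + 2 * p * q * T a a b c + 2 * p * r * T a a c c + q * q * T a b b c + 2 * q * r * T a b c c + r * r * T a c c c"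
    "T b b u u = p * p * T a a b b + 2 * p * q * T a b b b + 2 * p * r * T a b b c + q * q * T b b b b + 2 * q * r * T b b b c + r * r * T b b c c"
    "T b c u u = p * p * T a a b c + 2 * p * q * T a b b c + 2 * p * r * T a b c c + q * q * T b b b c + 2 * q * r * T b b c c + r * r * T b c c c"
    "T c c u u = p * p * T a a c c + 2 * p * q * T a b c c + 2 * p * r * T a c c c + q * q * T b b c c + 2 * q * r * T b c c c + r * r * T c c c c"
    using 1[of a a] 1[of a b] 1[of a c] 1[of b b] 1[of b c] 1[of c c]
    by (simp_all only: s)
  have "T u u u u = p * p * T a a u u + 2 * p * q * T a b u u + 2 * p * r * T a c u u
    + q * q * T b b u u + 2 * q * r * T b c u u + r * r * T c c u u" by (rule 1)
  then show ?thesis unfolding 2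
    by (simp add: algebra_simps power2_eq_square power3_eq_cube power4_eq_xxxx)
qed

end

context form_pair
begin

text \<open>Weights, possibly zero, are kept here; their fourth roots are taken only when returning
  to forms.\<close>

definition decomposes :: "('k \<times> 'k vec3) list \<Rightarrow> bool" where
  "decomposes A \<longleftrightarrow> (\<forall>(c, v)\<in>set A. h v \<noteq> 0 \<and> v \<noteq> 0) \<and>
     (\<forall>u. T u u u u = (\<Sum>(c, v)\<leftarrow>A. c * dot3 u v ^ 4))"

text \<open>Give a, b, c the weights 2, 1, 0, the exponents of the parameter on the conic. By
  \<open>rel\<close> the value of \<open>T\<close> at a monomial divisible by b depends only on its
  weight, which yields the moments 1 to 7 of the octic. The moments 0 and 8 are free, and the
  discrepancies at the monomials without b form the quartic on the line.\<close>

lemma adapted_decomposition: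
  assumes dual: "dual3 a b c x y z" and ad: "adapted a b c" and hx: "h x \<noteq> 0" and hz: "h z \<noteq> 0"
  shows "\<exists>A. length A \<le> 8 \<and> decomposes A"
proof -
  note d = dual[unfolded dual3_def]
  note ind = dual3_indep3[OF dual]
  have rel: "T a b c n = T b b b n" for n using ad unfolding adapted_def by (metis swap12 swap23)
  let ?f1 = "T b c c c" and ?f2 = "T b b c c" and ?f3 = "T b b b c" and ?f4 = "T b b b b"
    and ?f5 = "T a b b b" and ?f6 = "T a a b b" and ?f7 = "T a a a b"
  have rels: "T a a b c = ?f5" "T a b b c = ?f4" "T a b c c = ?f3"
    using rel[of a] rel[of b] rel[of c] by (simp_all add: sym)
  \<comment> \<open>Read in the order c, b, a, this Gram matrix is the middle block of the 5 x 5
    Hankel matrix.\<close>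
  have "gram b a b c \<noteq> 0" using gram_eq_0_iff[OF ind] ad by (simp add: adapted_def)
  moreover have "T b b a c = ?f4" "T b b a b = ?f5" "T b b a a = ?f6" using rels by (simp_all add: sym)
  ultimately have det: "det3 ?f2 ?f3 ?f4 ?f3 ?f4 ?f5 ?f4 ?f5 ?f6 \<noteq> 0"
    unfolding gram_def by (simp add: det3_def algebra_simps)
  obtain \<alpha>0 \<beta>0 \<epsilon> where five: "\<And>\<alpha> \<beta> x0 x1 x2 x3 x4. (\<alpha> - \<alpha>0) * (\<beta> - \<beta>0) \<noteq> \<epsilon> \<Longrightarrow>
    \<alpha> * x0 + ?f1 * x1 + ?f2 * x2 + ?f3 * x3 + ?f4 * x4 = 0 \<Longrightarrow>
    ?f1 * x0 + ?f2 * x1 + ?f3 * x2 + ?f4 * x3 + ?f5 * x4 = 0 \<Longrightarrow>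
    ?f2 * x0 + ?f3 * x1 + ?f4 * x2 + ?f5 * x3 + ?f6 * x4 = 0 \<Longrightarrow>
    ?f3 * x0 + ?f4 * x1 + ?f5 * x2 + ?f6 * x3 + ?f7 * x4 = 0 \<Longrightarrow>
    ?f4 * x0 + ?f5 * x1 + ?f6 * x2 + ?f7 * x3 + \<beta> * x4 = 0 \<Longrightarrow>
    x0 = 0 \<and> x1 = 0 \<and> x2 = 0 \<and> x3 = 0 \<and> x4 = 0"
    using hankel5_nondegenerate[OF det, of ?f1 ?f7] by blast
  have conic: "\<exists>B. length B = 5 \<and> (\<forall>(k, v)\<in>set B. h v \<noteq> 0 \<and> v \<noteq> 0) \<and>
      (\<forall>u. (\<Sum>(k, v)\<leftarrow>B. k * dot3 u v ^ 4) =
        (let p = dot3 u x; q = dot3 u y; r = dot3 u z in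
         p^4 * \<beta> + 4*p^3*q * ?f7 + (4*p^3*r + 6*p\<^sup>2*q\<^sup>2) * ?f6 + (12*p\<^sup>2*q*r + 4*p*q^3) * ?f5
         + (6*p\<^sup>2*r\<^sup>2 + 12*p*q\<^sup>2*r + q^4) * ?f4 + (12*p*q*r\<^sup>2 + 4*q^3*r) * ?f3
         + (4*p*r^3 + 6*q\<^sup>2*r\<^sup>2) * ?f2 + 4*q*r^3 * ?f1 + r^4 * \<alpha>))"
    if ne: "(\<alpha> - \<alpha>0) * (\<beta> - \<beta>0) \<noteq> \<epsilon>" for \<alpha> \<beta>
  proof -
    define F where "F = (!) [\<alpha>, ?f1, ?f2, ?f3, ?f4, ?f5, ?f6, ?f7, \<beta>]"
    have F: "F 0 = \<alpha>" "F 1 = ?f1" "F 2 = ?f2" "F 3 = ?f3" "F 4 = ?f4" "F 5 = ?f5" "F 6 = ?f6"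
      "F 7 = ?f7" "F 8 = \<beta>" "F (Suc 0) = ?f1" "F (Suc (Suc 0)) = ?f2" "F (Suc (Suc (Suc 0))) = ?f3"
      by (simp_all add: F_def)
    obtain H where H: "\<And>t. h (z + t \<cdot> y + t\<^sup>2 \<cdot> x) = poly H t" using along_curve by blast
    have "H \<noteq> 0" using H[of 0] hz by auto
    have "\<exists>S k. finite S \<and> card S = 5 \<and> (\<forall>s\<in>S. poly H s \<noteq> 0) \<and>
            (\<forall>m<2*5-1. F m = (\<Sum>s\<in>S. k s * s ^ m))"
    proof (rule hankel_quadrature)
      fix X :: "nat \<Rightarrow> 'k" assume *: "\<And>i. i < 5 \<Longrightarrow> (\<Sum>j<5. F (i + j) * X j) = 0"
      show "\<forall>j<5. X j = 0" unfolding all_less_5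
        by (rule five[OF ne]) (use *[of 0] *[of 1] *[of 2] *[of 3] *[of 4] in \<open>simp_all add: sum_lessThan_5 F\<close>)
    qed (use \<open>H \<noteq> 0\<close> in auto)
    then obtain S k where S: "finite S" "card S = 5" "\<forall>s\<in>S. poly H s \<noteq> 0"
      "\<And>m. m < 9 \<Longrightarrow> F m = (\<Sum>s\<in>S. k s * s ^ m)" by auto
    obtain ss where ss: "set ss = S" "distinct ss" using finite_distinct_list[OF S(1)] by blast
    define pt where "pt s = z + s \<cdot> y + s\<^sup>2 \<cdot> x" for s
    define B where "B = map (\<lambda>s. (k s, pt s)) ss"
    have "length B = 5" using ss S(2) by (metis B_def distinct_card length_map)
    moreover have "h v \<noteq> 0 \<and> v \<noteq> 0" if "(k', v) \<in> set B" for k' v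
    proof -
      obtain s where s: "s \<in> S" "v = pt s" using \<open>(k', v) \<in> set B\<close> ss by (auto simp: B_def)
      have "dot3 c v = 1" using d by (simp add: s pt_def)
      then have "v \<noteq> 0" by auto
      moreover have "h v = poly H s" unfolding s(2) pt_def by (rule H)
      ultimately show ?thesis using S(3) s(1) by simp
    qed
    moreover have "(\<Sum>(k, v)\<leftarrow>B. k * dot3 u v ^ 4) =
        (let p = dot3 u x; q = dot3 u y; r = dot3 u z in
         p^4 * \<beta> + 4*p^3*q * ?f7 + (4*p^3*r + 6*p\<^sup>2*q\<^sup>2) * ?f6 + (12*p\<^sup>2*q*r + 4*p*q^3) * ?f5
         + (6*p\<^sup>2*r\<^sup>2 + 12*p*q\<^sup>2*r + q^4) * ?f4 + (12*p*q*r\<^sup>2 + 4*q^3*r) * ?f3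
         + (4*p*r^3 + 6*q\<^sup>2*r\<^sup>2) * ?f2 + 4*q*r^3 * ?f1 + r^4 * \<alpha>)" for u
    proof -
      define p q r where "p = dot3 u x" and "q = dot3 u y" and "r = dot3 u z"
      have "(\<Sum>(k, v)\<leftarrow>B. k * dot3 u v ^ 4) = (\<Sum>s\<leftarrow>ss. k s * dot3 u (pt s) ^ 4)"
        by (simp add: B_def comp_def)
      also have "\<dots> = (\<Sum>s\<in>S. k s * dot3 u (pt s) ^ 4)"
        using ss by (metis sum.distinct_set_conv_list)
      also have "\<dots> = (\<Sum>s\<in>S. k s * (r + s * q + s\<^sup>2 * p) ^ 4)"
        by (simp add: pt_def p_def q_def r_def)
      also have "\<dots> = (\<Sum>s\<in>S. p^4 * (k s * s^8) + 4*p^3*q * (k s * s^7)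
         + (4*p^3*r + 6*p\<^sup>2*q\<^sup>2) * (k s * s^6) + (12*p\<^sup>2*q*r + 4*p*q^3) * (k s * s^5)
         + (6*p\<^sup>2*r\<^sup>2 + 12*p*q\<^sup>2*r + q^4) * (k s * s^4) + (12*p*q*r\<^sup>2 + 4*q^3*r) * (k s * s^3)
         + (4*p*r^3 + 6*q\<^sup>2*r\<^sup>2) * (k s * s^2) + 4*q*r^3 * (k s * s^1) + r^4 * (k s * s^0))"
        by (intro sum.cong refl) (simp add: algebra_simps eval_nat_numeral)
      also have "\<dots> = p^4 * F 8 + 4*p^3*q * F 7
         + (4*p^3*r + 6*p\<^sup>2*q\<^sup>2) * F 6 + (12*p\<^sup>2*q*r + 4*p*q^3) * F 5
         + (6*p\<^sup>2*r\<^sup>2 + 12*p*q\<^sup>2*r + q^4) * F 4 + (12*p*q*r\<^sup>2 + 4*q^3*r) * F 3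
         + (4*p*r^3 + 6*q\<^sup>2*r\<^sup>2) * F 2 + 4*q*r^3 * F 1 + r^4 * F 0"
        by (simp only: S(4)[of 8] S(4)[of 7] S(4)[of 6] S(4)[of 5] S(4)[of 4] S(4)[of 3]
            S(4)[of 2] S(4)[of 1] S(4)[of 0] sum.distrib sum_distrib_left)
      finally show ?thesis unfolding F Let_def p_def q_def r_def .
    qed
    ultimately show ?thesis by blast
  qed
  have expand: "T u u u u = (let p = dot3 u x; q = dot3 u y; r = dot3 u z in
         p^4 * T a a a a + 4*p^3*q * ?f7 + 4*p^3*r * T a a a c + 6*p\<^sup>2*q\<^sup>2 * ?f6
         + (12*p\<^sup>2*q*r + 4*p*q^3) * ?f5 + 6*p\<^sup>2*r\<^sup>2 * T a a c c + (12*p*q\<^sup>2*r + q^4) * ?f4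
         + (12*p*q*r\<^sup>2 + 4*q^3*r) * ?f3 + 4*p*r^3 * T a c c c + 6*q\<^sup>2*r\<^sup>2 * ?f2
         + 4*q*r^3 * ?f1 + r^4 * T c c c c)" for u
  proof -
    obtain p q r where u: "u = p \<cdot> a + q \<cdot> b + r \<cdot> c" using indep3_span[OF ind] .
    have pqr: "dot3 u x = p" "dot3 u y = q" "dot3 u z = r" using d by (simp_all add: u)
    have "T u u u u = p^4 * T a a a a + 4*p^3*q * ?f7 + 4*p^3*r * T a a a c + 6*p\<^sup>2*q\<^sup>2 * ?f6
         + 12*p\<^sup>2*q*r * T a a b c + 4*p*q^3 * ?f5 + 6*p\<^sup>2*r\<^sup>2 * T a a c c + 12*p*q\<^sup>2*r * T a b b c
         + q^4 * ?f4 + 12*p*q*r\<^sup>2 * T a b c c + 4*q^3*r * ?f3 + 4*p*r^3 * T a c c c + 6*q\<^sup>2*r\<^sup>2 * ?f2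
         + 4*q*r^3 * ?f1 + r^4 * T c c c c"
      by (rule quartic_expansion[OF u])
    then show ?thesis unfolding Let_def pqr rels by (simp add: algebra_simps)
  qed
  let ?g1 = "T a c c c - ?f2" and ?g2 = "T a a c c - ?f4" and ?g3 = "T a a a c - ?f6"
  show ?thesis
  proof (cases "(?g1, ?g2, ?g3) = (0, 0, 0)")
    case True
    \<comment> \<open>With this choice the product of the two shifts is
      \<open>\<epsilon> + 1\<close>.\<close>
    let ?\<alpha> = "\<alpha>0 + 1" and ?\<beta> = "\<beta>0 + \<epsilon> + 1"
    obtain B where B: "length B = 5" "\<forall>(k, v)\<in>set B. h v \<noteq> 0 \<and> v \<noteq> 0"
      "\<And>u. (\<Sum>(k, v)\<leftarrow>B. k * dot3 u v ^ 4) =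
        (let p = dot3 u x; q = dot3 u y; r = dot3 u z in
         p^4 * ?\<beta> + 4*p^3*q * ?f7 + (4*p^3*r + 6*p\<^sup>2*q\<^sup>2) * ?f6 + (12*p\<^sup>2*q*r + 4*p*q^3) * ?f5
         + (6*p\<^sup>2*r\<^sup>2 + 12*p*q\<^sup>2*r + q^4) * ?f4 + (12*p*q*r\<^sup>2 + 4*q^3*r) * ?f3
         + (4*p*r^3 + 6*q\<^sup>2*r\<^sup>2) * ?f2 + 4*q*r^3 * ?f1 + r^4 * ?\<alpha>)"
      using conic[of ?\<alpha> ?\<beta>] by auto
    have xz: "x \<noteq> 0" "z \<noteq> 0" using d by auto
    have eqs: "T a c c c = ?f2" "T a a c c = ?f4" "T a a a c = ?f6" using True by simp_all
    have sum: "T u u u u = (T a a a a - ?\<beta>) * dot3 u x ^ 4 + (T c c c c - ?\<alpha>) * dot3 u z ^ 4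
      + (\<Sum>(k, v)\<leftarrow>B. k * dot3 u v ^ 4)" for u
      unfolding expand[of u] B(3) Let_def eqs by (simp add: algebra_simps)
    have "decomposes ([(T a a a a - ?\<beta>, x), (T c c c c - ?\<alpha>, z)] @ B)"
      unfolding decomposes_def
    proof (intro conjI allI)
      fix u
      show "T u u u u =
        (\<Sum>(k, v)\<leftarrow>[(T a a a a - ?\<beta>, x), (T c c c c - ?\<alpha>, z)] @ B. k * dot3 u v ^ 4)"
        unfolding sum[of u] by simp
    qed (use B(2) hx hz xz in auto)
    then show ?thesis using B(1) by (intro exI[of _ "[(T a a a a - ?\<beta>, x), (T c c c c - ?\<alpha>, z)] @ B"]) simp
  next
    case False
    obtain \<alpha> \<beta> where \<alpha>\<beta>: "(\<alpha> - \<alpha>0) * (\<beta> - \<beta>0) \<noteq> \<epsilon>"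
      and det': "det3 (T c c c c - \<alpha>) ?g1 ?g2 ?g1 ?g2 ?g3 ?g2 ?g3 (T a a a a - \<beta>) \<noteq> 0"
      by (rule avoid_two_bilinear_conditions[OF False])
    obtain B where B: "length B = 5" "\<forall>(k, v)\<in>set B. h v \<noteq> 0 \<and> v \<noteq> 0"
      "\<And>u. (\<Sum>(k, v)\<leftarrow>B. k * dot3 u v ^ 4) =
        (let p = dot3 u x; q = dot3 u y; r = dot3 u z in
         p^4 * \<beta> + 4*p^3*q * ?f7 + (4*p^3*r + 6*p\<^sup>2*q\<^sup>2) * ?f6 + (12*p\<^sup>2*q*r + 4*p*q^3) * ?f5
         + (6*p\<^sup>2*r\<^sup>2 + 12*p*q\<^sup>2*r + q^4) * ?f4 + (12*p*q*r\<^sup>2 + 4*q^3*r) * ?f3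
         + (4*p*r^3 + 6*q\<^sup>2*r\<^sup>2) * ?f2 + 4*q*r^3 * ?f1 + r^4 * \<alpha>)"
      using conic[OF \<alpha>\<beta>] by auto
    \<comment> \<open>On \<open>z + s \<cdot> x\<close> the coordinates are a = s, c = 1, so the
      discrepancy at a^i c^(4-i) is the i-th moment.\<close>
    define G where "G = (!) [T c c c c - \<alpha>, ?g1, ?g2, ?g3, T a a a a - \<beta>]"
    have G: "G 0 = T c c c c - \<alpha>" "G 1 = ?g1" "G 2 = ?g2" "G 3 = ?g3" "G 4 = T a a a a - \<beta>"
      "G (Suc 0) = ?g1" "G (Suc (Suc 0)) = ?g2" "G (Suc (Suc (Suc 0))) = ?g3"
      by (simp_all add: G_def)
    obtain H where H: "\<And>t. h (z + t \<cdot> x) = poly H t" using along_line by blast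
    have "H \<noteq> 0" using H[of 0] hz by auto
    have "\<exists>S k. finite S \<and> card S = 3 \<and> (\<forall>s\<in>S. poly H s \<noteq> 0) \<and>
            (\<forall>m<2*3-1. G m = (\<Sum>s\<in>S. k s * s ^ m))"
    proof (rule hankel_quadrature)
      fix X :: "nat \<Rightarrow> 'k" assume *: "\<And>i. i < 3 \<Longrightarrow> (\<Sum>j<3. G (i + j) * X j) = 0"
      show "\<forall>j<3. X j = 0" unfolding all_less_3
        by (rule det3_neq_0_unique[OF det']) (use *[of 0] *[of 1] *[of 2] in \<open>simp_all add: sum_lessThan_3 G\<close>)
    qed (use \<open>H \<noteq> 0\<close> in auto)
    then obtain S k where S: "finite S" "card S = 3" "\<forall>s\<in>S. poly H s \<noteq> 0"
      "\<And>m. m < 5 \<Longrightarrow> G m = (\<Sum>s\<in>S. k s * s ^ m)" by auto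
    obtain ss where ss: "set ss = S" "distinct ss" using finite_distinct_list[OF S(1)] by blast
    define pt where "pt s = z + s \<cdot> x" for s
    define C where "C = map (\<lambda>s. (k s, pt s)) ss"
    have len: "length C = 3" using ss S(2) by (metis C_def distinct_card length_map)
    have C: "h v \<noteq> 0 \<and> v \<noteq> 0" if "(k', v) \<in> set C" for k' v
    proof -
      obtain s where s: "s \<in> S" "v = pt s" using \<open>(k', v) \<in> set C\<close> ss by (auto simp: C_def)
      have "dot3 c v = 1" using d by (simp add: s pt_def)
      then have "v \<noteq> 0" by auto
      moreover have "h v = poly H s" unfolding s(2) pt_def by (rule H)
      ultimately show ?thesis using S(3) s(1) by simp
    qed
    have sumC: "(\<Sum>(k, v)\<leftarrow>C. k * dot3 u v ^ 4) =
        (let p = dot3 u x; r = dot3 u z in p^4 * (T a a a a - \<beta>) + 4*p^3*r * ?g3 + 6*p\<^sup>2*r\<^sup>2 * ?g2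
           + 4*p*r^3 * ?g1 + r^4 * (T c c c c - \<alpha>))" for u
    proof -
      define p r where "p = dot3 u x" and "r = dot3 u z"
      have "(\<Sum>(k, v)\<leftarrow>C. k * dot3 u v ^ 4) = (\<Sum>s\<leftarrow>ss. k s * dot3 u (pt s) ^ 4)"
        by (simp add: C_def comp_def)
      also have "\<dots> = (\<Sum>s\<in>S. k s * dot3 u (pt s) ^ 4)"
        using ss by (metis sum.distinct_set_conv_list)
      also have "\<dots> = (\<Sum>s\<in>S. k s * (r + s * p) ^ 4)"
        by (simp add: pt_def p_def r_def)
      also have "\<dots> = (\<Sum>s\<in>S. p^4 * (k s * s^4) + 4*p^3*r * (k s * s^3)
         + 6*p\<^sup>2*r\<^sup>2 * (k s * s^2) + 4*p*r^3 * (k s * s^1) + r^4 * (k s * s^0))"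
        by (intro sum.cong refl) (simp add: algebra_simps eval_nat_numeral)
      also have "\<dots> = p^4 * G 4 + 4*p^3*r * G 3 + 6*p\<^sup>2*r\<^sup>2 * G 2 + 4*p*r^3 * G 1 + r^4 * G 0"
        by (simp only: S(4)[of 4] S(4)[of 3] S(4)[of 2] S(4)[of 1] S(4)[of 0] sum.distrib sum_distrib_left)
      finally show ?thesis unfolding G Let_def p_def r_def .
    qed
    have sum: "T u u u u = (\<Sum>(k, v)\<leftarrow>B. k * dot3 u v ^ 4) + (\<Sum>(k, v)\<leftarrow>C. k * dot3 u v ^ 4)" for u
      unfolding expand[of u] B(3) sumC Let_def by (simp add: algebra_simps)
    have "decomposes (B @ C)"
      unfolding decomposes_def
    proof (intro conjI allI)
      fix u
      show "T u u u u = (\<Sum>(k, v)\<leftarrow>B @ C. k * dot3 u v ^ 4)"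
        unfolding sum[of u] by simp
    next
      have "\<forall>(k, v)\<in>set C. h v \<noteq> 0 \<and> v \<noteq> 0" 
        using C[of "fst t" "snd t" for t] by (simp add: case_prod_beta)
      then show "\<forall>(k, v)\<in>set (B @ C). h v \<noteq> 0 \<and> v \<noteq> 0"
        using B(2) by (simp add: ball_Un)
    qed
    then show ?thesis using B(1) len by (intro exI[of _ "B @ C"]) simp
  qed
qed

theorem decomposition_exists:
  assumes ess: "\<And>m. m \<noteq> 0 \<Longrightarrow> \<exists>u v w. T m u v w \<noteq> 0" and h: "h v0 \<noteq> 0" "v0 \<noteq> 0"
  shows "\<exists>A. length A \<le> 8 \<and> decomposes A"
proof -
  obtain l v where "nondegenerate_at l" "v \<noteq> 0" "dot3 l v = 0" "h v \<noteq> 0"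
    using nondegenerate_at_on_point[OF exists_nondegenerate_at[OF ess] h] .
  then obtain a b c x y z where "dual3 a b c x y z" "adapted a b c" "h x \<noteq> 0" "h z \<noteq> 0"
    by (rule adapted_basis_exists)
  then show ?thesis by (rule adapted_decomposition)
qed

end

section \<open>Forms and their polarizations\<close>

lemma lookup_Const_mult:
  "Poly_Mapping.lookup (Const c * p) m = c * Poly_Mapping.lookup p m"
  by (induction p rule: poly_mapping_single_add_induct)
    (auto simp: Const_def mult_single distrib_left lookup_add lookup_single when_def)

lemma Const_mult_Const: "Const a * Const b = (Const (a * b) :: ('n::finite, 'k::comm_ring_1) mpoly)"
  by (simp add: Const_def mult_single)

lemma Const_add: "Const (a + b) = (Const a + Const b :: ('n::finite, 'k::comm_ring_1) mpoly)"
  by (simp add: Const_def single_add)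

lemma Const_0 [simp]: "Const 0 = 0"
  by (simp add: Const_def)

lemma Const_1 [simp]: "Const 1 = 1"
  by (simp add: Const_def)

lemma Const_power: "Const a ^ n = (Const (a ^ n) :: ('n::finite, 'k::comm_ring_1) mpoly)"
  by (induction n) (simp_all add: Const_mult_Const)

lemma Const_of_nat: "Const (of_nat n) = (of_nat n :: ('n::finite, 'k::comm_ring_1) mpoly)"
  by (induction n) (simp_all add: Const_add)

lemma lookup_contraction_Var:
  "Poly_Mapping.lookup (contraction (Var i) f) m =
    Poly_Mapping.lookup f (m + Poly_Mapping.single i 1) * of_nat (Poly_Mapping.lookup m i + 1)"
proof (induction f rule: poly_mapping_single_add_induct)
  case (monomial b t f)
  let ?e = "Poly_Mapping.single i (1::nat)"
  have *: "b - ?e = m \<longleftrightarrow> b = m + ?e" if "Poly_Mapping.lookup b i \<noteq> 0"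
  proof -
    have "b - ?e + ?e = b"
      using that by (intro poly_mapping_eqI) (auto simp: lookup_add lookup_minus lookup_single when_def)
    then show ?thesis by (metis add_diff_cancel_right')
  qed
  have "Poly_Mapping.lookup (contraction (Var i) (Poly_Mapping.single b t)) m =
      Poly_Mapping.lookup (Poly_Mapping.single b t) (m + ?e) * of_nat (Poly_Mapping.lookup m i + 1)"
  proof (cases "Poly_Mapping.lookup b i = 0")
    case True
    then have "b \<noteq> m + ?e" by (auto simp: lookup_add)
    then show ?thesis using True
      by (simp add: Var_def contraction_single contraction_coeff_single[simplified] lookup_single)
  next
    case False
    show ?thesis using *[OF False]
      by (auto simp: Var_def contraction_single contraction_coeff_single[simplified] lookup_single
          when_def lookup_add)
  qed
  with monomial show ?case
    by (simp add: contraction_add_right lookup_add distrib_right)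
qed simp

lemma monom_degree_add: "monom_degree (a + b) = monom_degree a + monom_degree b"
  by (simp add: monom_degree_def lookup_add sum.distrib)

lemma monom_degree_single [simp]: "monom_degree (Poly_Mapping.single i n) = n"
  by (simp add: monom_degree_def lookup_single when_def)

lemma monom_degree_eq_0_iff: "monom_degree m = 0 \<longleftrightarrow> m = 0"
  by (simp add: monom_degree_def) (metis lookup_zero poly_mapping_eqI)

lemma forms_iff: "p \<in> forms d \<longleftrightarrow> (\<forall>m. Poly_Mapping.lookup p m \<noteq> 0 \<longrightarrow> monom_degree m = d)"
  by (auto simp: forms_def in_keys_iff)

lemma forms_0 [simp]: "0 \<in> forms d"
  by (simp add: forms_iff)

lemma forms_add: "p \<in> forms d \<Longrightarrow> q \<in> forms d \<Longrightarrow> p + q \<in> forms d"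
  by (auto simp: forms_iff lookup_add) (metis add.right_neutral)

lemma forms_diff:
  fixes p :: "('n::finite, 'k::comm_ring_1) mpoly"
  shows "p \<in> forms d \<Longrightarrow> q \<in> forms d \<Longrightarrow> p - q \<in> forms d"
  by (auto simp: forms_iff lookup_minus) (metis diff_zero)

lemma forms_Const_mult: "p \<in> forms d \<Longrightarrow> Const c * p \<in> forms d"
  by (auto simp: forms_iff lookup_Const_mult) (metis mult_zero_right)

lemma forms_Var: "Var i \<in> forms 1"
  by (auto simp: forms_iff Var_def lookup_single when_def)

lemma forms_mult:
  fixes p :: "('n::finite, 'k::comm_ring_1) mpoly"
  assumes "p \<in> forms d" "q \<in> forms e"
  shows "p * q \<in> forms (d + e)"
proof -
  have "monom_degree m = d + e" if "m \<in> Poly_Mapping.keys (p * q)" for m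
  proof -
    have "m \<in> {a + b |a b. a \<in> Poly_Mapping.keys p \<and> b \<in> Poly_Mapping.keys q}"
      using that keys_mult[of p q] by (rule set_rev_mp)
    then obtain a b where "m = a + b" "a \<in> Poly_Mapping.keys p" "b \<in> Poly_Mapping.keys q"
      by auto
    then show ?thesis using assms by (auto simp: forms_def monom_degree_add)
  qed
  then show ?thesis by (simp add: forms_def)
qed

lemma forms_power: "p \<in> forms 1 \<Longrightarrow> p ^ n \<in> forms n"
proof (induction n)
  case 0
  then show ?case by (auto simp: forms_iff lookup_one when_def monom_degree_eq_0_iff)
next
  case (Suc n)
  then show ?case using forms_mult[of p 1 "p ^ n" n] by simp
qed

lemma forms_sum_list: "(\<And>x. x \<in> set xs \<Longrightarrow> g x \<in> forms d) \<Longrightarrow> (\<Sum>x\<leftarrow>xs. g x) \<in> forms d"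
  by (induction xs) (auto intro: forms_add)

lemma forms_contraction_Var:
  assumes "f \<in> forms (Suc d)"
  shows "contraction (Var i) f \<in> forms d"
  using assms unfolding forms_iff lookup_contraction_Var
  by (metis Suc_eq_plus1 add_right_cancel monom_degree_add monom_degree_single mult_zero_left)

text \<open>A monomial of positive degree contains some variable, and its coefficient reappears in
  that partial derivative times a positive integer, which cancels in characteristic 0.\<close>

lemma forms_Suc_eq_0:
  fixes f :: "('n::finite, 'k::{comm_ring_1,ring_char_0,ring_no_zero_divisors}) mpoly"
  assumes f: "f \<in> forms (Suc d)" and z: "\<And>i. contraction (Var i) f = 0"
  shows "f = 0"
proof (rule poly_mapping_eqI)
  fix m
  show "Poly_Mapping.lookup f m = Poly_Mapping.lookup 0 m"
  proof (cases "monom_degree m = Suc d")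
    case True
    then obtain i where i: "Poly_Mapping.lookup m i \<noteq> 0" unfolding monom_degree_def by fastforce
    define m' where "m' = m - Poly_Mapping.single i 1"
    have m: "m = m' + Poly_Mapping.single i 1"
      using i by (intro poly_mapping_eqI) (auto simp: m'_def lookup_add lookup_minus lookup_single when_def)
    have "Poly_Mapping.lookup f m * of_nat (Poly_Mapping.lookup m' i + 1) = 0"
      using lookup_contraction_Var[of i f m'] z[of i] m by simp
    then show ?thesis by (simp del: of_nat_Suc of_nat_add)
  next
    case False
    then show ?thesis using f by (auto simp: forms_iff)
  qed
qed

lemma forms_0_eq_0: "f \<in> forms 0 \<Longrightarrow> Poly_Mapping.lookup f 0 = 0 \<Longrightarrow> f = 0"
  by (intro poly_mapping_eqI) (metis forms_iff lookup_zero monom_degree_eq_0_iff)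

section \<open>Linear forms as triples, and quartic forms as symmetric quadrilinear forms\<close>

locale three_variables =
  fixes i1 i2 i3 :: "'n::finite"
  assumes distinct: "i1 \<noteq> i2" "i1 \<noteq> i3" "i2 \<noteq> i3" and univ: "UNIV = {i1, i2, i3}"
begin

definition lin :: "'k::field vec3 \<Rightarrow> ('n, 'k) mpoly" where
  "lin u = (case u of (a, b, c) \<Rightarrow> Const a * Var i1 + Const b * Var i2 + Const c * Var i3)"

lemma lin_add: "lin (u + v) = lin u + lin v"
  by (auto simp: lin_def Const_add distrib_right split: prod.splits)

lemma lin_scale: "lin (c \<cdot> u) = Const c * lin u"
  by (auto simp: lin_def scale3_def distrib_left mult.assoc simp flip: Const_mult_Const split: prod.splits)

lemma lin_forms: "lin u \<in> forms 1"
  by (auto simp: lin_def intro!: forms_add forms_Const_mult forms_Var[unfolded One_nat_def] split: prod.splits)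

lemma lin_unit: "lin (1, 0, 0) = Var i1" "lin (0, 1, 0) = Var i2" "lin (0, 0, 1) = Var i3"
  by (simp_all add: lin_def)

lemma lookup_lin:
  "Poly_Mapping.lookup (lin (a, b, c)) (Poly_Mapping.single i1 1) = a"
  "Poly_Mapping.lookup (lin (a, b, c)) (Poly_Mapping.single i2 1) = b"
  "Poly_Mapping.lookup (lin (a, b, c)) (Poly_Mapping.single i3 1) = c"
proof -
  have inj: "Poly_Mapping.single i (1::nat) = Poly_Mapping.single j 1 \<longleftrightarrow> i = j" for i j :: 'n
    by (metis lookup_single_eq lookup_single_not_eq zero_neq_one)
  show "Poly_Mapping.lookup (lin (a, b, c)) (Poly_Mapping.single i1 1) = a"
    "Poly_Mapping.lookup (lin (a, b, c)) (Poly_Mapping.single i2 1) = b"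
    "Poly_Mapping.lookup (lin (a, b, c)) (Poly_Mapping.single i3 1) = c"
    using distinct by (simp_all add: lin_def lookup_add lookup_Const_mult Var_def lookup_single when_def inj
        inj[unfolded One_nat_def])
qed

lemma lin_eq_0_iff: "lin u = 0 \<longleftrightarrow> u = 0"
proof
  assume "lin u = 0"
  moreover obtain a b c where "u = (a, b, c)" by (metis prod.exhaust)
  ultimately show "u = 0"
    using lookup_lin(1)[of a b c] lookup_lin(2)[of a b c] lookup_lin(3)[of a b c]
    by (simp add: zero_prod_def)
qed (simp add: lin_def zero_prod_def)

lemma forms_1_lin:
  assumes "p \<in> forms 1"
  obtains u where "p = lin u"
proof -
  let ?l = "\<lambda>i. Poly_Mapping.lookup p (Poly_Mapping.single i 1)"
  let ?u = "(?l i1, ?l i2, ?l i3)"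
  have "p = lin ?u"
  proof (rule poly_mapping_eqI)
    fix m
    show "Poly_Mapping.lookup p m = Poly_Mapping.lookup (lin ?u) m"
    proof (cases "monom_degree m = 1")
      case True
      then obtain i where i: "Poly_Mapping.lookup m i \<noteq> 0" unfolding monom_degree_def by fastforce
      define m' where "m' = m - Poly_Mapping.single i 1"
      have m: "m = m' + Poly_Mapping.single i 1"
        using i by (intro poly_mapping_eqI) (auto simp: m'_def lookup_add lookup_minus lookup_single when_def)
      then have "m' = 0" using True monom_degree_add[of m' "Poly_Mapping.single i 1"]
        by (simp add: monom_degree_eq_0_iff)
      then have "m = Poly_Mapping.single i 1" using m by simp
      moreover have "i \<in> {i1, i2, i3}" using univ by blast
      ultimately show ?thesis by (auto simp: lookup_lin[unfolded One_nat_def])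
    next
      case False
      then show ?thesis using assms lin_forms[of ?u] unfolding forms_iff by metis
    qed
  qed
  then show thesis by (rule that)
qed

lemma contraction_lin_mult:
  "contraction (lin u) (f * g) = contraction (lin u) f * g + f * contraction (lin u) g"
proof -
  obtain a b c where u: "u = (a, b, c)" by (metis prod.exhaust)
  show ?thesis
    by (simp add: u lin_def contraction_add_left contraction_Const_left contraction_Var_mult algebra_simps)
qed

lemma contraction_lin_lin: "contraction (lin u) (lin v) = Const (dot3 u v)"
proof -
  obtain a b c x y z where u: "u = (a, b, c)" "v = (x, y, z)" by (metis prod.exhaust)
  show ?thesis
    using distinct
    by (auto simp: u lin_def contraction_add_left contraction_add_right contraction_Const_left
        contraction_Const_right contraction_Var_Var dot3_def Const_add simp flip: Const_mult_Const)
qed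

lemma contraction_lin_power:
  "contraction (lin u) (lin v ^ Suc n) = Const (of_nat (Suc n) * dot3 u v) * lin v ^ n"
proof (induction n)
  case 0
  then show ?case by (simp add: contraction_lin_lin)
next
  case (Suc n)
  have "contraction (lin u) (lin v ^ Suc (Suc n)) =
      Const (dot3 u v) * lin v ^ Suc n + lin v * (Const (of_nat (Suc n) * dot3 u v) * lin v ^ n)"
    unfolding power_Suc[of _ "Suc n"] contraction_lin_mult contraction_lin_lin Suc ..
  also have "\<dots> = Const (of_nat (Suc (Suc n)) * dot3 u v) * lin v ^ Suc n"
  proof -
    have "of_nat (Suc (Suc n)) * dot3 u v = dot3 u v + of_nat (Suc n) * dot3 u v"
      by (simp add: algebra_simps)
    then show ?thesis by (simp only: Const_add) (simp add: algebra_simps)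
  qed
  finally show ?case .
qed

text \<open>A quartic differentiated four times is a constant, read off at the exponent 0. This is
  4! times the usual polarization, whence the factor 24 below.\<close>

definition polar :: "('n, 'k::field) mpoly \<Rightarrow> 'k vec3 \<Rightarrow> 'k vec3 \<Rightarrow> 'k vec3 \<Rightarrow> 'k vec3 \<Rightarrow> 'k" where
  "polar f u v w x = Poly_Mapping.lookup (contraction (lin u * lin v * lin w * lin x) f) 0"

lemma polar_symmetric_quadrilinear:
  "symmetric_quadrilinear (polar (f :: ('n, 'k::{alg_closed_field,field_char_0}) mpoly))"
  by unfold_locales
    (simp_all add: polar_def lin_add lin_scale distrib_right contraction_add_left lookup_add
      mult.assoc contraction_Const_left lookup_Const_mult, simp_all add: mult_ac)

lemma polar_iterate:
  "polar f u v w x =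
    Poly_Mapping.lookup (contraction (lin u) (contraction (lin v) (contraction (lin w) (contraction (lin x) f)))) 0"
  by (simp add: polar_def contraction_mult mult.assoc)

lemma polar_add: "polar (f + g) u v w x = polar f u v w x + polar g u v w x"
  by (simp add: polar_def contraction_add_right lookup_add)

lemma polar_0: "polar 0 u v w x = 0"
  by (simp add: polar_def)

lemma polar_Const_mult: "polar (Const c * f) u v w x = c * polar f u v w x"
  by (simp add: polar_def contraction_Const_right lookup_Const_mult)

lemma polar_diff: "polar (f - g) u v w x = polar f u v w x - polar g u v w x"
  using polar_add[of "f - g" g u v w x] by simp

lemma polar_sum: "polar (\<Sum>i\<in>I. g i) u v w x = (\<Sum>i\<in>I. polar (g i) u v w x)"
  by (induction I rule: infinite_finite_induct) (simp_all add: polar_0 polar_add)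

lemma polar_sum_list: "polar (\<Sum>i\<leftarrow>xs. g i) u v w x = (\<Sum>i\<leftarrow>xs. polar (g i) u v w x)"
  by (induction xs) (simp_all add: polar_0 polar_add)

lemma polar_lin_power4:
  "polar (lin p ^ 4) u v w x = 24 * dot3 u p * dot3 v p * dot3 w p * dot3 x p"
proof -
  have 4: "contraction (lin x) (lin p ^ 4) = Const (4 * dot3 x p) * lin p ^ 3"
    using contraction_lin_power[of x p 3] by (simp add: eval_nat_numeral)
  have 3: "contraction (lin w) (lin p ^ 3) = Const (3 * dot3 w p) * lin p ^ 2"
    using contraction_lin_power[of w p 2] by (simp add: eval_nat_numeral)
  have 2: "contraction (lin v) (lin p ^ 2) = Const (2 * dot3 v p) * lin p"
    using contraction_lin_power[of v p 1] by (simp add: eval_nat_numeral)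
  show ?thesis
    unfolding polar_iterate 4 3 2 contraction_Const_right contraction_lin_lin lookup_Const_mult
    by (simp add: Const_def lookup_single)
qed

lemma Var_eq_lin: "\<exists>u. Var i = (lin u :: ('n, 'k::field) mpoly)"
  using univ lin_unit by (metis UNIV_I insertE singletonD)

lemma forms_4_eq_0:
  fixes f :: "('n, 'k::{alg_closed_field,field_char_0}) mpoly"
  assumes f: "f \<in> forms 4" and z: "\<And>u. polar f u u u u = 0"
  shows "f = 0"
proof -
  interpret symmetric_quadrilinear "polar f" by (rule polar_symmetric_quadrilinear)
  have "polar f u v w x = 0" for u v w x
    by (rule polarize4[of "\<lambda>_. True"]) (use z in auto)
  then have 0: "Poly_Mapping.lookup (contraction (Var i) (contraction (Var j) (contraction (Var k) (contraction (Var l) f)))) 0 = 0"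
    for i j k l using polar_iterate Var_eq_lin by metis
  have f4: "f \<in> forms (Suc (Suc (Suc (Suc 0))))" using f by (simp add: eval_nat_numeral)
  note F = forms_contraction_Var
  show ?thesis
    by (rule forms_Suc_eq_0[OF f4], rule forms_Suc_eq_0[OF F[OF f4]], rule forms_Suc_eq_0[OF F[OF F[OF f4]]],
        rule forms_Suc_eq_0[OF F[OF F[OF F[OF f4]]]], rule forms_0_eq_0[OF F[OF F[OF F[OF F[OF f4]]]] 0])
qed

text \<open>If \<open>polar f m - - -\<close> vanished, all third derivatives of the cubic
  \<open>contraction (lin m) f\<close> would be 0, hence the cubic itself, against essential
  dependence.\<close>

lemma polar_essential:
  fixes f :: "('n, 'k::{alg_closed_field,field_char_0}) mpoly"
  assumes f: "f \<in> forms 4" and ess: "essentially_depends_on_all f" and m: "m \<noteq> 0"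
  shows "\<exists>u v w. polar f m u v w \<noteq> 0"
proof (rule ccontr)
  assume "\<nexists>u v w. polar f m u v w \<noteq> 0"
  then have "polar f m u v w = 0" for u v w by blast
  then have z: "polar f u v w m = 0" for u v w
    unfolding polar_def by (metis mult.assoc mult.commute)
  let ?g = "contraction (lin m) f"
  have 0: "Poly_Mapping.lookup (contraction (Var i) (contraction (Var j) (contraction (Var k) ?g))) 0 = 0"
    for i j k using polar_iterate z Var_eq_lin by metis
  have f4: "f \<in> forms (Suc 3)" using f by (simp add: eval_nat_numeral)
  obtain a b c where abc: "m = (a, b, c)" by (metis prod.exhaust)
  have "?g \<in> forms 3"
    unfolding abc lin_def
    by (auto simp: contraction_add_left contraction_Const_left
        intro!: forms_add forms_Const_mult forms_contraction_Var f4)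
  then have g3: "?g \<in> forms (Suc (Suc (Suc 0)))" by (simp add: eval_nat_numeral)
  note F = forms_contraction_Var
  have "?g = 0"
    by (rule forms_Suc_eq_0[OF g3], rule forms_Suc_eq_0[OF F[OF g3]],
        rule forms_Suc_eq_0[OF F[OF F[OF g3]]], rule forms_0_eq_0[OF F[OF F[OF F[OF g3]]] 0])
  then show False using ess lin_forms[of m] lin_eq_0_iff[of m] m
    by (auto simp: essentially_depends_on_all_def)
qed

lemma eval_at_form_function:
  fixes p :: "('n, 'k::{alg_closed_field,field_char_0}) mpoly"
  assumes "p \<in> forms d"
  shows "form_function (\<lambda>v. eval_at p (lin v)) d"
proof
  fix u v w :: "'k vec3"
  let ?c = "\<lambda>u i. Poly_Mapping.lookup (lin u) (Poly_Mapping.single i 1)"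
  define q where "q = (\<Sum>m\<in>Poly_Mapping.keys p. [:Poly_Mapping.lookup p m:] *
        (\<Prod>i\<in>UNIV. [:?c u i, ?c v i, ?c w i:] ^ Poly_Mapping.lookup m i))"
  have "?c (u + t \<cdot> v + t\<^sup>2 \<cdot> w) i = poly [:?c u i, ?c v i, ?c w i:] t" for t i
    by (simp add: lin_add lin_scale lookup_add lookup_Const_mult algebra_simps power2_eq_square)
  then have "eval_at p (lin (u + t \<cdot> v + t\<^sup>2 \<cdot> w)) = poly q t" for t
    by (simp add: eval_at_def q_def poly_sum poly_prod del: poly_pCons)
  then show "\<exists>q. \<forall>t. eval_at p (lin (u + t \<cdot> v + t\<^sup>2 \<cdot> w)) = poly q t" by blast
next
  fix c :: 'k and v :: "'k vec3"
  show "eval_at p (lin (c \<cdot> v)) = c ^ d * eval_at p (lin v)"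
    unfolding eval_at_def sum_distrib_left
  proof (rule sum.cong[OF refl])
    fix m assume "m \<in> Poly_Mapping.keys p"
    then have "(\<Sum>i\<in>UNIV. Poly_Mapping.lookup m i) = d"
      using assms by (simp add: forms_def monom_degree_def)
    then have "(\<Prod>i\<in>UNIV. c ^ Poly_Mapping.lookup m i) = c ^ d" by (simp flip: power_sum)
    then show "Poly_Mapping.lookup p m *
        (\<Prod>i\<in>UNIV. Poly_Mapping.lookup (lin (c \<cdot> v)) (Poly_Mapping.single i 1) ^ Poly_Mapping.lookup m i) =
      c ^ d * (Poly_Mapping.lookup p m *
        (\<Prod>i\<in>UNIV. Poly_Mapping.lookup (lin v) (Poly_Mapping.single i 1) ^ Poly_Mapping.lookup m i))"
      by (simp add: lin_scale lookup_Const_mult power_mult_distrib prod.distrib mult_ac)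
  qed
qed

end

section \<open>The open rank\<close>

text \<open>\<open>P\<close> abstracts the condition of lying outside a closed set; the later lemmas
  use only its invariance under nonzero scalars.\<close>

definition power_sum :: "('a \<Rightarrow> bool) \<Rightarrow> nat \<Rightarrow> nat \<Rightarrow> 'a::comm_semiring_1 \<Rightarrow> bool" where
  "power_sum P d r f \<longleftrightarrow> (\<exists>v. (\<forall>i<r. P (v i)) \<and> f = (\<Sum>i<r. v i ^ d))"

lemma power_sum_0: "power_sum P d 0 0"
  by (simp add: power_sum_def)

lemma power_sum_Suc:
  assumes "power_sum P d r f" "P w"
  shows "power_sum P d (Suc r) (w ^ d + f)"
proof -
  obtain v where v: "\<forall>i<r. P (v i)" "f = (\<Sum>i<r. v i ^ d)" using assms(1) by (auto simp: power_sum_def)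
  have "(\<Sum>i<Suc r. (v(r := w)) i ^ d) = w ^ d + f" by (simp add: v(2) add.commute)
  then show ?thesis unfolding power_sum_def
    using v(1) assms(2) by (intro exI[of _ "v(r := w)"]) auto
qed

lemma power_sum_split:
  fixes f :: "('n::finite, 'k::{alg_closed_field,field_char_0}) mpoly"
  assumes f: "power_sum P 4 (Suc r) f" and scale: "\<And>c v. c \<noteq> 0 \<Longrightarrow> P v \<Longrightarrow> P (Const c * v)"
  shows "power_sum P 4 (Suc (Suc r)) f"
proof -
  obtain v where v: "\<forall>i<Suc r. P (v i)" "f = (\<Sum>i<Suc r. v i ^ 4)" using f by (auto simp: power_sum_def)
  let ?w = "v r"
  have w: "P ?w" using v by simp
  \<comment> \<open>\<open>2\<^sup>4 - 15 = 1\<close> splits one fourth power into two proportional ones\<close>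
  obtain b :: 'k where b: "b ^ 4 = - 15" using nth_root_exists[of 4 "- 15 :: 'k"] by auto
  have "b \<noteq> 0" using b by auto
  have "power_sum P 4 r (\<Sum>i<r. v i ^ 4)"
    unfolding power_sum_def using v(1) by (intro exI[of _ v]) auto
  then have "power_sum P 4 (Suc (Suc r)) ((Const 2 * ?w) ^ 4 + ((Const b * ?w) ^ 4 + (\<Sum>i<r. v i ^ 4)))"
    using w \<open>b \<noteq> 0\<close> by (intro power_sum_Suc scale) auto
  also have "(Const 2 * ?w) ^ 4 + ((Const b * ?w) ^ 4 + (\<Sum>i<r. v i ^ 4)) = f"
  proof -
    have "(Const 2 * ?w) ^ 4 + (Const b * ?w) ^ 4 = Const (2 ^ 4 + b ^ 4) * ?w ^ 4"
      by (simp only: power_mult_distrib Const_power Const_add distrib_right)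
    also have "\<dots> = ?w ^ 4" by (simp add: b)
    finally show ?thesis unfolding v(2) by (simp add: add.assoc[symmetric] add.commute)
  qed
  finally show ?thesis .
qed

text \<open>Pads decompositions, whose length may vary with the closed set, to one common length.
  Splitting needs a summand to start from, which \<open>f \<noteq> 0\<close> provides.\<close>

lemma power_sum_increase:
  fixes f :: "('n::finite, 'k::{alg_closed_field,field_char_0}) mpoly"
  assumes f: "power_sum P 4 r f" "r \<le> s" "f \<noteq> 0"
    and scale: "\<And>c v. c \<noteq> 0 \<Longrightarrow> P v \<Longrightarrow> P (Const c * v)"
  shows "power_sum P 4 s f"
proof -
  have r: "r > 0" using f by (auto simp: power_sum_def intro: gr0I)
  show ?thesis using f(2)
  proof (induction s rule: dec_induct)
    case (step n)
    then obtain n' where "n = Suc n'" using r by (metis gr0_implies_Suc le_trans not_le le0 neq0_conv)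
    then show ?case using power_sum_split[of P n' f] scale step.IH by simp
  qed (rule f(1))
qed

text \<open>Nonzero weights are absorbed by fourth roots; terms of weight 0 are dropped, so only a
  bound on the length remains.\<close>

lemma power_sum_list:
  fixes A :: "('k::{alg_closed_field,field_char_0} \<times> ('n::finite, 'k) mpoly) list"
  assumes "\<forall>(c, v)\<in>set A. P v" and scale: "\<And>c v. c \<noteq> 0 \<Longrightarrow> P v \<Longrightarrow> P (Const c * v)"
  shows "\<exists>r\<le>length A. power_sum P 4 r (\<Sum>(c, v)\<leftarrow>A. Const c * v ^ 4)"
  using assms(1)
proof (induction A)
  case Nil
  then show ?case using power_sum_0 by auto
next
  case (Cons a A)
  obtain c v where a: "a = (c, v)" by (metis prod.exhaust)
  obtain r where r: "r \<le> length A" "power_sum P 4 r (\<Sum>(c, v)\<leftarrow>A. Const c * v ^ 4)"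
    using Cons by auto
  show ?case
  proof (cases "c = 0")
    case True
    then show ?thesis using r by (intro exI[of _ r]) (simp add: a)
  next
    case False
    obtain e where e: "e ^ 4 = c" using nth_root_exists[of 4 c] by auto
    then have "e \<noteq> 0" using False by auto
    then have "P (Const e * v)" using Cons.prems scale by (simp add: a)
    from power_sum_Suc[OF r(2) this] show ?thesis using r(1)
      by (intro exI[of _ "Suc r"]) (simp add: a power_mult_distrib Const_power e)
  qed
qed

context three_variables
begin

lemma contraction_Var_1: "contraction (Var i) 1 = 0"
  by (intro poly_mapping_eqI) (auto simp: lookup_contraction_Var lookup_one when_def lookup_add
      dest!: arg_cong[of _ 0 "\<lambda>m. Poly_Mapping.lookup m i"])

lemma contraction_Var_numeral: "contraction (Var i) (numeral k :: ('n, 'k::comm_ring_1) mpoly) = 0"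
proof -
  have "numeral k = Const (numeral k) * (1 :: ('n, 'k) mpoly)"
    by (metis Const_of_nat mult.right_neutral of_nat_numeral)
  then show ?thesis by (metis contraction_Const_right contraction_Var_1 mult_zero_right)
qed

lemma line_eval_eq_0:
  assumes p: "p \<in> forms d" and lw: "line (lin v) = line (lin w)" and w: "eval_at p (lin w) = 0"
    and v0: "v \<noteq> (0 :: 'k::{alg_closed_field,field_char_0} vec3)"
  shows "eval_at p (lin v) = 0"
proof -
  interpret form_function "\<lambda>v. eval_at p (lin v)" d by (rule eval_at_form_function[OF p])
  have "lin v \<in> line (lin v)" unfolding line_def by (auto intro!: exI[of _ 1])
  then obtain c where "lin v = Const c * lin w" unfolding lw by (auto simp: line_def)
  then have "eval_at p (lin v) = c ^ d * eval_at p (lin w)" using homogeneous[of c w] by (simp add: lin_scale)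
  then show ?thesis using w by simp
qed

theorem open_decomposable_8:
  fixes f :: "('n, 'k::{alg_closed_field,field_char_0}) mpoly"
  assumes f: "f \<in> forms 4" and ess: "essentially_depends_on_all f"
  shows "open_decomposable 4 f 8"
  unfolding open_decomposable_def
proof (intro allI impI)
  fix X :: "('n, 'k) mpoly set set"
  assume X: "zariski_closed X \<and> X \<subset> proj_S1"
  then obtain E where E: "\<forall>p\<in>E. \<exists>d. p \<in> forms d"
    "X = {line v | v. v \<in> forms 1 \<and> v \<noteq> 0 \<and> (\<forall>p\<in>E. eval_at p v = 0)}"
    unfolding zariski_closed_def by blast
  obtain L where "L \<in> proj_S1" "L \<notin> X" using X by blast
  then obtain g where g: "g \<in> forms 1" "g \<noteq> 0" "line g \<notin> X" by (auto simp: proj_S1_def)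
  \<comment> \<open>One equation not vanishing at a point outside \<open>X\<close> suffices: off its
    zero set, \<open>X\<close> is avoided.\<close>
  then obtain p where p: "p \<in> E" "eval_at p g \<noteq> 0" using E(2) by blast
  obtain d where d: "p \<in> forms d" using E(1) p by blast
  obtain v0 where v0: "g = lin v0" using forms_1_lin[OF g(1)] .
  interpret symmetric_quadrilinear "polar f" by (rule polar_symmetric_quadrilinear)
  interpret form_function "\<lambda>v. eval_at p (lin v)" d by (rule eval_at_form_function[OF d])
  interpret form_pair "polar f" "\<lambda>v. eval_at p (lin v)" d ..
  have "\<exists>A. length A \<le> 8 \<and> decomposes A"
  proof (rule decomposition_exists)
    show "\<exists>u v w. polar f m u v w \<noteq> 0" if "m \<noteq> 0" for m
      using that by (rule polar_essential[OF f ess])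
    show "eval_at p (lin v0) \<noteq> 0" "v0 \<noteq> 0" using p g v0 by (auto simp: lin_eq_0_iff)
  qed
  then obtain A where A: "length A \<le> 8" "\<forall>(c, v)\<in>set A. eval_at p (lin v) \<noteq> 0 \<and> v \<noteq> 0"
    "\<And>u. polar f u u u u = (\<Sum>(c, v)\<leftarrow>A. c * dot3 u v ^ 4)"
    unfolding decomposes_def by blast
  define P where "P w \<longleftrightarrow> w \<in> forms 1 \<and> w \<noteq> 0 \<and> line w \<in> proj_S1 - X" for w
  have P: "P (lin v)" if v: "eval_at p (lin v) \<noteq> 0" "v \<noteq> 0" for v
  proof -
    have "line (lin v) \<notin> X"
    proof
      assume "line (lin v) \<in> X"
      then obtain w where w: "line (lin v) = line w" "w \<in> forms 1" "eval_at p w = 0"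
        using E(2) p(1) by auto
      obtain w' where "w = lin w'" using forms_1_lin[OF w(2)] .
      then show False using line_eval_eq_0[OF d _ _ v(2), of w'] w v(1) by simp
    qed
    then show ?thesis using v lin_forms[of v] by (auto simp: P_def proj_S1_def lin_eq_0_iff)
  qed
  have line_scale: "line (Const c * w) = line w" if "c \<noteq> 0" for c :: 'k and w :: "('n, 'k) mpoly"
  proof -
    have "Const a * (Const c * w) = Const (a * c) * w" for a by (simp add: mult.assoc flip: Const_mult_Const)
    moreover have "Const a * w = Const (a / c) * (Const c * w)" for a
      using that by (simp add: Const_mult_Const flip: mult.assoc)
    ultimately show ?thesis unfolding line_def by blast
  qed
  have scaleP: "P (Const c * w)" if c: "c \<noteq> 0" and "P w" for c w
  proof -
    have "Const c * w \<noteq> 0"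
    proof
      assume "Const c * w = 0"
      then have "Const (1 / c) * (Const c * w) = 0" by simp
      then have "w = 0" using c by (simp add: Const_mult_Const flip: mult.assoc)
      then show False using that by (simp add: P_def)
    qed
    then show ?thesis using that by (simp add: P_def line_scale forms_Const_mult)
  qed
  define A' where "A' = map (\<lambda>(c, v). (c / 24, lin v)) A"
  have "f = (\<Sum>(c, v)\<leftarrow>A'. Const c * v ^ 4)"
  proof -
    let ?g = "\<Sum>(c, v)\<leftarrow>A'. Const c * v ^ 4"
    have "?g \<in> forms 4"
      by (rule forms_sum_list) (auto simp: A'_def intro!: forms_Const_mult forms_power lin_forms)
    then have "f - ?g \<in> forms 4" using f by (intro forms_diff)
    moreover have "polar (f - ?g) u u u u = 0" for u
    proof -
      have "polar (Const (c / 24) * lin v ^ 4) u u u u = c * dot3 u v ^ 4" for c v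
        unfolding polar_Const_mult polar_lin_power4 by (simp add: power4_eq_xxxx)
      then have "polar ?g u u u u = (\<Sum>(c, v)\<leftarrow>A. c * dot3 u v ^ 4)"
        unfolding polar_sum_list A'_def by (simp add: comp_def case_prod_unfold)
      then show ?thesis by (simp add: polar_diff A(3))
    qed
    ultimately have "f - ?g = 0" by (rule forms_4_eq_0)
    then show ?thesis by simp
  qed
  moreover have "\<forall>(c, v)\<in>set A'. P v" using A(2) P by (auto simp: A'_def)
  ultimately obtain r where r: "r \<le> length A'" "power_sum P 4 r f"
    using power_sum_list[of A' P] scaleP by auto
  have "r \<le> 8" using r(1) A(1) by (simp add: A'_def)
  moreover have "f \<noteq> 0"
  proof
    assume "f = 0"
    moreover have "lin (1, 0, 0) \<noteq> (0 :: ('n, 'k) mpoly)" by (simp add: lin_eq_0_iff zero_prod_def)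
    ultimately show False using ess lin_forms unfolding essentially_depends_on_all_def
      by (metis contraction_zero_right)
  qed
  ultimately have "power_sum P 4 8 f" using power_sum_increase[OF r(2)] scaleP by blast
  then show "\<exists>v :: nat \<Rightarrow> _. (\<forall>i<8. v i \<in> forms 1 \<and> v i \<noteq> 0 \<and> line (v i) \<in> proj_S1 - X) \<and> f = (\<Sum>i<8. v i ^ 4)"
    unfolding power_sum_def P_def .
qed

section \<open>The lower bound\<close>

definition extremal :: "('n, 'k::field) mpoly" where
  "extremal = Var i1 * Var i1 * (Var i2 * Var i2) + Var i3 * Var i3 * (Var i3 * Var i3)"

lemma extremal_forms: "extremal \<in> forms 4"
proof -
  have *: "a * b * (c * d) \<in> forms 4"
    if "a \<in> forms 1" "b \<in> forms 1" "c \<in> forms 1" "d \<in> forms 1" for a b c d :: "('n, 'k::field) mpoly"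
    using forms_mult[OF forms_mult[OF that(1,2)] forms_mult[OF that(3,4)]] by (simp add: eval_nat_numeral)
  show ?thesis unfolding extremal_def by (intro forms_add * forms_Var)
qed

lemma polar_extremal:
  defines "a \<equiv> (1 :: 'k::{alg_closed_field,field_char_0}, 0, 0)" and "b \<equiv> (0, 1, 0)" and "c \<equiv> (0, 0, 1)"
  shows "polar extremal a a a a = (0 :: 'k)" "polar extremal a a a b = (0 :: 'k)"
    "polar extremal a a a c = (0 :: 'k)" "polar extremal a a b b = (4 :: 'k)"
    "polar extremal a a b c = (0 :: 'k)" "polar extremal a a c c = (0 :: 'k)"
    "polar extremal a b b b = (0 :: 'k)" "polar extremal a b b c = (0 :: 'k)"
    "polar extremal a b c c = (0 :: 'k)" "polar extremal a c c c = (0 :: 'k)"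
    "polar extremal b b b b = (0 :: 'k)" "polar extremal b b b c = (0 :: 'k)"
    "polar extremal b b c c = (0 :: 'k)" "polar extremal b c c c = (0 :: 'k)"
    "polar extremal c c c c = (24 :: 'k)"
  using distinct
  by (simp_all add: polar_iterate a_def b_def c_def lin_unit extremal_def contraction_Var_mult
      contraction_add_right contraction_Var_Var lookup_add lookup_one contraction_Var_1
      contraction_Var_numeral lookup_numeral when_def)


text \<open>The three derivatives along a b b, a a b and c c c recover multiples of the coordinates
  of \<open>u\<close>.\<close>

lemma extremal_essential:
  "essentially_depends_on_all (extremal :: ('n, 'k::{alg_closed_field,field_char_0}) mpoly)"
  unfolding essentially_depends_on_all_def
proof (intro ballI impI notI)
  fix l :: "('n, 'k) mpoly" assume l: "l \<in> forms 1" "l \<noteq> 0" "contraction l extremal = 0"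
  obtain u where u: "l = lin u" using forms_1_lin[OF l(1)] .
  obtain p q r where pqr: "u = (p, q, r)" by (metis prod.exhaust)
  interpret symmetric_quadrilinear "polar (extremal :: ('n, 'k) mpoly)"
    by (rule polar_symmetric_quadrilinear)
  let ?a = "(1, 0, 0) :: 'k vec3" and ?b = "(0, 1, 0) :: 'k vec3" and ?c = "(0, 0, 1) :: 'k vec3"
  have z: "polar extremal x y z u = 0" for x y z
    unfolding polar_iterate l(3)[unfolded u] by simp
  have u': "u = p \<cdot> ?a + q \<cdot> ?b + r \<cdot> ?c" by (simp add: pqr scale3_def)
  have "polar extremal ?a ?b ?b u = 4 * p" "polar extremal ?a ?a ?b u = 4 * q"
    "polar extremal ?c ?c ?c u = 24 * r"
    unfolding u' by (simp_all add: linear polar_extremal sym)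
  then have "u = 0" using z by (simp add: pqr zero_prod_def)
  then show False using l(2) u by (simp add: lin_eq_0_iff)
qed

lemma eval_at_Var3: "eval_at (Var i3) (lin (x, y, z)) = (z :: 'k::{alg_closed_field,field_char_0})"
proof -
  have keys: "Poly_Mapping.keys (Var i3 :: ('n, 'k) mpoly) = {Poly_Mapping.single i3 1}"
    by (simp add: Var_def)
  have "(\<Prod>i\<in>UNIV. Poly_Mapping.lookup (lin (x, y, z)) (Poly_Mapping.single i 1) ^
      Poly_Mapping.lookup (Poly_Mapping.single i3 (1::nat)) i) =
    (\<Prod>i\<in>UNIV. if i = i3 then z else 1)"
    by (intro prod.cong) (auto simp: lookup_single when_def lookup_lin lookup_lin[unfolded One_nat_def])
  also have "\<dots> = z" by simp
  finally show ?thesis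
    unfolding eval_at_def keys by (simp add: Var_def)
qed

text \<open>
  At most seven points impose at most seven conditions on the cubics spanned by \<open>x\<^sup>2y\<close>, \<open>xy\<^sup>2\<close>
  and \<open>z\<close> times the quadrics, so a nonzero one vanishes on all of them.  Apolarity kills its
  \<open>x\<^sup>2y\<close>, \<open>xy\<^sup>2\<close> and \<open>z\<^sup>3\<close> terms; as no point lies on \<open>z = 0\<close>, the remaining quadric vanishes
  on the points, and apolarity reduces it in turn to \<open>0\<close>.
\<close>

lemma extremal_not_short_power_sum:
  fixes v :: "nat \<Rightarrow> 'k::{alg_closed_field,field_char_0} vec3"
  assumes eq: "extremal = (\<Sum>i<r. lin (v i) ^ 4)" and off: "\<And>i. i < r \<Longrightarrow> snd (snd (v i)) \<noteq> 0"
  shows "r \<ge> 8"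
proof (rule ccontr)
  assume "\<not> r \<ge> 8"
  then have r: "r < 8" by simp
  define x y z where "x i = fst (v i)" and "y i = fst (snd (v i))" and "z i = snd (snd (v i))" for i
  have v: "v i = (x i, y i, z i)" for i by (simp add: x_def y_def z_def)
  have z0: "z i \<noteq> 0" if "i < r" for i using off[OF that] by (simp add: z_def)
  let ?a = "(1, 0, 0) :: 'k vec3" and ?b = "(0, 1, 0) :: 'k vec3" and ?c = "(0, 0, 1) :: 'k vec3"
  have dots: "dot3 ?a (v i) = x i" "dot3 ?b (v i) = y i" "dot3 ?c (v i) = z i" for i
    by (simp_all add: v dot3_def)
  have pol: "polar extremal s t u w = 24 * (\<Sum>i<r. dot3 s (v i) * dot3 t (v i) * dot3 u (v i) * dot3 w (v i))"
    for s t u w unfolding eq polar_sum polar_lin_power4 by (simp add: sum_distrib_left mult.assoc)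
  define S where "S = (\<lambda>g :: nat \<Rightarrow> 'k. \<Sum>i<r. g i)"
  have M: "S (\<lambda>i. x i * x i * x i * x i) = 0" "S (\<lambda>i. x i * x i * x i * y i) = 0"
    "S (\<lambda>i. x i * x i * x i * z i) = 0" "24 * S (\<lambda>i. x i * x i * y i * y i) = 4"
    "S (\<lambda>i. x i * x i * y i * z i) = 0" "S (\<lambda>i. x i * x i * z i * z i) = 0"
    "S (\<lambda>i. x i * y i * y i * y i) = 0" "S (\<lambda>i. x i * y i * y i * z i) = 0"
    "S (\<lambda>i. x i * y i * z i * z i) = 0" "S (\<lambda>i. x i * z i * z i * z i) = 0"
    "S (\<lambda>i. y i * y i * y i * y i) = 0" "S (\<lambda>i. y i * y i * y i * z i) = 0"
    "S (\<lambda>i. y i * y i * z i * z i) = 0" "S (\<lambda>i. y i * z i * z i * z i) = 0"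
    "24 * S (\<lambda>i. z i * z i * z i * z i) = 24"
    using polar_extremal[where 'k = 'k] unfolding pol dots S_def by simp_all
  have M4: "S (\<lambda>i. x i * x i * y i * y i) \<noteq> 0" "S (\<lambda>i. z i * z i * z i * z i) \<noteq> 0"
    using M(4) M(15) by auto
  define A where "A i j = [x i * x i * y i, x i * y i * y i, z i * z i * z i, z i * x i * x i,
      z i * x i * y i, z i * y i * y i, z i * x i * z i, z i * y i * z i] ! j" for i j
  obtain c where c: "\<exists>j\<in>{..<8}. c j \<noteq> 0" and sys: "\<forall>i<r. (\<Sum>j<8. A i j * c j) = 0"
    using underdetermined_system[of "{..<8}" r A] r by auto
  have S_add: "S (\<lambda>i. g i + h i) = S g + S h" for g h by (simp add: S_def sum.distrib)
  have S_mult: "S (\<lambda>i. k * g i) = k * S g" for k g by (simp add: S_def sum_distrib_left)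
  have S_0: "S g = 0" if "\<And>i. i < r \<Longrightarrow> g i = 0" for g using that by (simp add: S_def)
  have cubic: "c 0 * (x i * x i * y i) + c 1 * (x i * y i * y i) + c 2 * (z i * z i * z i)
      + c 3 * (z i * x i * x i) + c 4 * (z i * x i * y i) + c 5 * (z i * y i * y i)
      + c 6 * (z i * x i * z i) + c 7 * (z i * y i * z i) = 0" if "i < r" for i
    using sys that by (simp add: A_def eval_nat_numeral algebra_simps)
  have "S (\<lambda>i. c 0 * (x i * x i * y i * w i) + c 1 * (x i * y i * y i * w i) + c 2 * (z i * z i * z i * w i)
      + c 3 * (z i * x i * x i * w i) + c 4 * (z i * x i * y i * w i) + c 5 * (z i * y i * y i * w i)
      + c 6 * (z i * x i * z i * w i) + c 7 * (z i * y i * z i * w i)) = 0" for w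
  proof (rule S_0)
    fix i assume "i < r"
    show "c 0 * (x i * x i * y i * w i) + c 1 * (x i * y i * y i * w i) + c 2 * (z i * z i * z i * w i)
      + c 3 * (z i * x i * x i * w i) + c 4 * (z i * x i * y i * w i) + c 5 * (z i * y i * y i * w i)
      + c 6 * (z i * x i * z i * w i) + c 7 * (z i * y i * z i * w i) = 0"
      using arg_cong[OF cubic[OF \<open>i < r\<close>], of "\<lambda>t. t * w i"] by (simp add: algebra_simps)
  qed
  then have cub: "c 0 * S (\<lambda>i. x i * x i * y i * w i) + c 1 * S (\<lambda>i. x i * y i * y i * w i)
      + c 2 * S (\<lambda>i. z i * z i * z i * w i) + c 3 * S (\<lambda>i. z i * x i * x i * w i)
      + c 4 * S (\<lambda>i. z i * x i * y i * w i) + c 5 * S (\<lambda>i. z i * y i * y i * w i)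
      + c 6 * S (\<lambda>i. z i * x i * z i * w i) + c 7 * S (\<lambda>i. z i * y i * z i * w i) = 0" for w
    by (simp add: S_add S_mult)
  note M' = M(1-3,5-14)
  \<comment> \<open>Only the moments of x^2 y^2 and z^4 are nonzero, so each multiplier, here and
    below, is chosen to complete exactly one monomial to one of these.\<close>
  have c0: "c 0 = 0" using cub[of y] M4 M' by (simp add: mult_ac)
  have c1: "c 1 = 0" using cub[of x] M4 M' by (simp add: mult_ac)
  have c2: "c 2 = 0" using cub[of z] M4 M' by (simp add: mult_ac)
  have quadric: "c 3 * (x i * x i) + c 4 * (x i * y i) + c 5 * (y i * y i) + c 6 * (x i * z i)
      + c 7 * (y i * z i) = 0" if "i < r" for i
  proof -
    have "z i * (c 3 * (x i * x i) + c 4 * (x i * y i) + c 5 * (y i * y i) + c 6 * (x i * z i)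
      + c 7 * (y i * z i)) = 0" using cubic[OF that] c0 c1 c2 by (simp add: algebra_simps)
    then show ?thesis using z0[OF that] by simp
  qed
  have "S (\<lambda>i. c 3 * (x i * x i * w i * u i) + c 4 * (x i * y i * w i * u i) + c 5 * (y i * y i * w i * u i)
      + c 6 * (x i * z i * w i * u i) + c 7 * (y i * z i * w i * u i)) = 0" for w u
  proof (rule S_0)
    fix i assume "i < r"
    show "c 3 * (x i * x i * w i * u i) + c 4 * (x i * y i * w i * u i) + c 5 * (y i * y i * w i * u i)
      + c 6 * (x i * z i * w i * u i) + c 7 * (y i * z i * w i * u i) = 0"
      using arg_cong[OF quadric[OF \<open>i < r\<close>], of "\<lambda>t. t * (w i * u i)"] by (simp add: algebra_simps)
  qed
  then have quad: "c 3 * S (\<lambda>i. x i * x i * w i * u i) + c 4 * S (\<lambda>i. x i * y i * w i * u i)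
      + c 5 * S (\<lambda>i. y i * y i * w i * u i) + c 6 * S (\<lambda>i. x i * z i * w i * u i)
      + c 7 * S (\<lambda>i. y i * z i * w i * u i) = 0" for w u
    by (simp add: S_add S_mult)
  have c3: "c 3 = 0" using quad[of y y] M4 M' by (simp add: mult_ac)
  have c4: "c 4 = 0" using quad[of x y] M4 M' by (simp add: mult_ac)
  have c5: "c 5 = 0" using quad[of x x] M4 M' by (simp add: mult_ac)
  have line: "c 6 * x i + c 7 * y i = 0" if "i < r" for i
  proof -
    have "z i * (c 6 * x i + c 7 * y i) = 0"
      using quadric[OF that] c3 c4 c5 by (simp add: algebra_simps)
    then show ?thesis using z0[OF that] by simp
  qed
  have "S (\<lambda>i. c 6 * (x i * w i * u i * t i) + c 7 * (y i * w i * u i * t i)) = 0" for w u t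
  proof (rule S_0)
    fix i assume "i < r"
    show "c 6 * (x i * w i * u i * t i) + c 7 * (y i * w i * u i * t i) = 0"
      using arg_cong[OF line[OF \<open>i < r\<close>], of "\<lambda>s. s * (w i * u i * t i)"] by (simp add: algebra_simps)
  qed
  then have lin: "c 6 * S (\<lambda>i. x i * w i * u i * t i) + c 7 * S (\<lambda>i. y i * w i * u i * t i) = 0" for w u t
    by (simp add: S_add S_mult)
  have c6: "c 6 = 0" using lin[of x y y] M4 M' by (simp add: mult_ac)
  have c7: "c 7 = 0" using lin[of x x y] M4 M' by (simp add: mult_ac)
  have "c j = 0" if "j < 8" for j
  proof -
    have "j \<in> {0, 1, 2, 3, 4, 5, 6, 7}" using that by auto
    then show ?thesis using c0 c1 c2 c3 c4 c5 c6 c7 by auto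
  qed
  then show False using c by auto
qed

lemma extremal_open_decomposable_ge:
  assumes "open_decomposable 4 (extremal :: ('n, 'k::{alg_closed_field,field_char_0}) mpoly) r"
  shows "r \<ge> 8"
proof -
  \<comment> \<open>The forbidden set is the line z = 0, so that dividing by the third coordinate is
    allowed at every point.\<close>
  define X where "X = {line v | v. v \<in> forms 1 \<and> v \<noteq> 0 \<and> eval_at (Var i3 :: ('n, 'k) mpoly) v = 0}"
  have notin: "line (lin u) \<notin> X" if u: "snd (snd u) \<noteq> 0" for u :: "'k vec3"
  proof
    assume "line (lin u) \<in> X"
    then obtain w where w: "line (lin u) = line w" "w \<in> forms 1" "eval_at (Var i3) w = 0"
      by (auto simp: X_def)
    obtain w' where w': "w = lin w'" using forms_1_lin[OF w(2)] .
    have "u \<noteq> 0" using u by auto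
    then have "eval_at (Var i3) (lin u) = 0"
      using line_eval_eq_0[OF forms_Var, of u w' i3] w w' by simp
    then show False using u eval_at_Var3[of "fst u" "fst (snd u)" "snd (snd u)"] by simp
  qed
  have "zariski_closed X"
    unfolding zariski_closed_def X_def
    by (intro exI[of _ "{Var i3}"]) (use forms_Var in auto)
  moreover have "X \<subset> proj_S1"
  proof
    show "X \<subseteq> proj_S1" by (auto simp: X_def proj_S1_def)
    have "line (lin (0, 0, 1 :: 'k)) \<in> proj_S1"
      using lin_forms[of "(0, 0, 1 :: 'k)"] by (auto simp: proj_S1_def lin_eq_0_iff zero_prod_def)
    then show "X \<noteq> proj_S1" using notin[of "(0, 0, 1)"] by auto
  qed
  ultimately obtain v where v: "\<forall>i<r. v i \<in> forms 1 \<and> v i \<noteq> 0 \<and> line (v i) \<in> proj_S1 - X"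
    and eq: "(extremal :: ('n, 'k) mpoly) = (\<Sum>i<r. v i ^ 4)"
    using assms unfolding open_decomposable_def by blast
  have "\<exists>u. v i = lin u \<and> snd (snd u) \<noteq> 0" if i: "i < r" for i
  proof -
    obtain u where u: "v i = lin u" using v i forms_1_lin by blast
    have "eval_at (Var i3) (v i) \<noteq> 0" using v i unfolding X_def by blast
    then have "eval_at (Var i3) (lin u) \<noteq> 0" using u by simp
    then have "snd (snd u) \<noteq> 0" using eval_at_Var3[of "fst u" "fst (snd u)" "snd (snd u)"] by auto
    then show ?thesis using u by blast
  qed
  then obtain w where w: "\<And>i. i < r \<Longrightarrow> v i = lin (w i) \<and> snd (snd (w i)) \<noteq> 0" by metis
  have "extremal = (\<Sum>i<r. lin (w i) ^ 4)" unfolding eq using w by (intro sum.cong) auto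
  then show ?thesis using w by (intro extremal_not_short_power_sum) auto
qed

lemma open_rank_extremal: "open_rank 4 (extremal :: ('n, 'k::{alg_closed_field,field_char_0}) mpoly) = 8"
proof (rule antisym)
  show "open_rank 4 (extremal :: ('n, 'k) mpoly) \<le> 8"
    unfolding open_rank_def numeral_eq_enat
    using open_decomposable_8[OF extremal_forms extremal_essential] by (intro Inf_lower) blast
  show "8 \<le> open_rank 4 (extremal :: ('n, 'k) mpoly)"
    unfolding open_rank_def numeral_eq_enat
    by (intro Inf_greatest) (use extremal_open_decomposable_ge in force)
qed

end

theorem mainTheorem1:
  assumes "CARD('n::finite) = 3"
  shows "(\<forall>f :: ('n, 'k::{alg_closed_field, field_char_0}) mpoly.
            f \<in> forms 4 \<and> essentially_depends_on_all f \<longrightarrow> open_rank 4 f \<le> 8) \<and>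
         (\<exists>f :: ('n, 'k) mpoly.
            f \<in> forms 4 \<and> essentially_depends_on_all f \<and> open_rank 4 f = 8)"
proof -
  obtain i1 i2 i3 :: 'n where "UNIV = {i1, i2, i3}" "i1 \<noteq> i2" "i1 \<noteq> i3" "i2 \<noteq> i3"
    using assms unfolding card_3_iff by blast
  then interpret three_variables i1 i2 i3 by unfold_locales
  have "open_rank 4 f \<le> 8" if "f \<in> forms 4" "essentially_depends_on_all f" for f :: "('n, 'k) mpoly"
    unfolding open_rank_def numeral_eq_enat
    using open_decomposable_8[OF that] by (intro Inf_lower) blast
  then show ?thesis using extremal_forms extremal_essential open_rank_extremal by blast
qed

end
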